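(* Let $\mathbf{T}=\{(z,w)\in\mathbf{C}^2 : |z|<|w|<1\}$ be the Hartogs triangle. On $\mathbf{T}$, $\overline\partial_{\tilde c}=\overline\partial_c$ on functions; that is, the weak minimal closure and the strong minimal closure of the Cauchy-Riemann operator coincide as unbounded operators $L^2(\mathbf{T})\dashrightarrow L^2_{0,1}(\mathbf{T})$.
   Context: $L^2_{0,1}$ denotes $(0,1)$-forms with square-integrable coefficients. Strong minimal closure $\overline\partial_c$ (on functions): the closure in the graph norm of $\overline\partial$ restricted to smooth functions compactly supported in $\mathbf{T}$; i.e. $f\in\mathrm{Dom}(\overline\partial_c)$ if and only if there is a sequence $f_\nu\in C_0^\infty(\mathbf{T})$ with $f_\nu\to f$ and $\overline\partial f_\nu\to\overline\partial f$ in $L^2$; then $\overline\partial_c f=\overline\partial f$. Weak minimal closure $\overline\partial_{\tilde c}$ (on functions): $f\in\mathrm{Dom}(\overline\partial_{\tilde c})$ if and only if $f\in L^2(\mathbf{T})$ and $\overline\partial f^0\in L^2_{0,1}(\mathbf{C}^2)$, where $f^0$ is the extension of $f$ by zero outside $\mathbf{T}$ and $\overline\partial f^0$ is taken in the sense of distributions on $\mathbf{C}^2$; then $\overline\partial_{\tilde c}f$ is the restriction of $\overline\partial f^0$ to $\mathbf{T}$. *)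

theory Defs
  imports "HOL-Analysis.Analysis"
begin

definition hartogs_triangle :: "(complex \<times> complex) set" where
  "hartogs_triangle = {(z, w). cmod z < cmod w \<and> cmod w < 1}"

text \<open>Smoothness is meant in the real sense: \<^term>\<open>frechet_derivative\<close> is the
  real-linear total derivative.\<close>

primrec Ck :: "nat \<Rightarrow> ('a::euclidean_space \<Rightarrow> 'b::real_normed_vector) \<Rightarrow> bool" where
  "Ck 0 f \<longleftrightarrow> continuous_on UNIV f"
| "Ck (Suc k) f \<longleftrightarrow>
     (\<forall>x. f differentiable (at x)) \<and> (\<forall>v. Ck k (\<lambda>x. frechet_derivative f (at x) v))"

definition test_functions :: "'a::euclidean_space set \<Rightarrow> ('a \<Rightarrow> complex) set" where
  "test_functions \<Omega> =
     {\<phi>. (\<forall>k. Ck k \<phi>) \<and> compact (closure {x. \<phi> x \<noteq> 0}) \<and> closure {x. \<phi> x \<noteq> 0} \<subseteq> \<Omega>}"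

text \<open>A (0,1)-form $a\,d\bar z + b\,d\bar w$ is represented by the function with values $(a, b)$.
  The Wirtinger derivatives are
  $\partial/\partial\bar z = \frac12(\partial_x + i\,\partial_y)$ for $z = x + iy$,
  and likewise in $w$.\<close>

definition dbar :: "(complex \<times> complex \<Rightarrow> complex) \<Rightarrow> complex \<times> complex \<Rightarrow> complex \<times> complex" where
  "dbar f p =
     ((frechet_derivative f (at p) (1, 0) + \<i> * frechet_derivative f (at p) (\<i>, 0)) / 2,
      (frechet_derivative f (at p) (0, 1) + \<i> * frechet_derivative f (at p) (0, \<i>)) / 2)"

text \<open>Elements of $L^2(\Omega)$ are handled through representatives; the values of a
  representative outside \<open>\<Omega>\<close> are irrelevant. Functions and (0,1)-forms are covered by the
  same definition, with value type \<^typ>\<open>complex\<close> and \<^typ>\<open>complex \<times> complex\<close> respectively.\<close>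

definition L2 :: "'a::euclidean_space set \<Rightarrow> ('a \<Rightarrow> 'b::euclidean_space) set" where
  "L2 \<Omega> = {f \<in> borel_measurable (lebesgue_on \<Omega>). integrable (lebesgue_on \<Omega>) (\<lambda>x. (norm (f x))\<^sup>2)}"

definition L2_tendsto ::
  "'a::euclidean_space set \<Rightarrow> (nat \<Rightarrow> 'a \<Rightarrow> 'b::euclidean_space) \<Rightarrow> ('a \<Rightarrow> 'b) \<Rightarrow> bool" where
  "L2_tendsto \<Omega> F f \<longleftrightarrow>
     (\<lambda>n. \<integral>\<^sup>+ x. ennreal ((norm (F n x - f x))\<^sup>2) \<partial>lebesgue_on \<Omega>) \<longlonglongrightarrow> 0"

text \<open>\<open>\<partial>\<close>-bar of \<open>f\<close> equals \<open>g\<close> in the sense of distributions on the open set \<open>\<Omega>\<close>; it is only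
  used for \<open>f\<close> and \<open>g\<close> in \<^term>\<open>L2 \<Omega>\<close>, so that all integrals exist.\<close>

definition has_distr_dbar ::
  "(complex \<times> complex) set \<Rightarrow> (complex \<times> complex \<Rightarrow> complex)
     \<Rightarrow> (complex \<times> complex \<Rightarrow> complex \<times> complex) \<Rightarrow> bool" where
  "has_distr_dbar \<Omega> f g \<longleftrightarrow>
     (\<forall>\<phi> \<in> test_functions \<Omega>.
        (LINT p|lebesgue_on \<Omega>. f p * fst (dbar \<phi> p)) = - (LINT p|lebesgue_on \<Omega>. fst (g p) * \<phi> p) \<and>
        (LINT p|lebesgue_on \<Omega>. f p * snd (dbar \<phi> p)) = - (LINT p|lebesgue_on \<Omega>. snd (g p) * \<phi> p))"

text \<open>The two closures are unbounded operators from $L^2(\Omega)$ to $L^2_{0,1}(\Omega)$ and are given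
  by their graphs. Each graph contains, with a pair \<open>(f, g)\<close>, all pairs whose components agree
  with \<open>f\<close> and \<open>g\<close> almost everywhere on \<open>\<Omega>\<close>, so equality of these sets is equality of the
  operators between the spaces of equivalence classes (same domain, same values).\<close>

definition dbar_strong_minimal ::
  "(complex \<times> complex) set
     \<Rightarrow> ((complex \<times> complex \<Rightarrow> complex) \<times> (complex \<times> complex \<Rightarrow> complex \<times> complex)) set" where
  "dbar_strong_minimal \<Omega> =
     {(f, g). f \<in> L2 \<Omega> \<and> g \<in> L2 \<Omega> \<and> has_distr_dbar \<Omega> f g \<and>
        (\<exists>F. (\<forall>n. F n \<in> test_functions \<Omega>) \<and>
             L2_tendsto \<Omega> F f \<and> L2_tendsto \<Omega> (\<lambda>n. dbar (F n)) g)}"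

definition zero_extension :: "'a set \<Rightarrow> ('a \<Rightarrow> 'b::zero) \<Rightarrow> 'a \<Rightarrow> 'b" where
  "zero_extension \<Omega> f = (\<lambda>x. if x \<in> \<Omega> then f x else 0)"

definition dbar_weak_minimal ::
  "(complex \<times> complex) set
     \<Rightarrow> ((complex \<times> complex \<Rightarrow> complex) \<times> (complex \<times> complex \<Rightarrow> complex \<times> complex)) set" where
  "dbar_weak_minimal \<Omega> =
     {(f, g). f \<in> L2 \<Omega> \<and> g \<in> L2 \<Omega> \<and>
        (\<exists>h \<in> L2 UNIV. has_distr_dbar UNIV (zero_extension \<Omega> f) h \<and>
             (AE p in lebesgue_on \<Omega>. g p = h p))}"

end

theory Submission
  imports Defs
begin

text \<open>
  Both operators extend the Cauchy-Riemann operator on test functions, and the inclusion of the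
  strong closure in the weak one is formal: if test functions \<open>F\<^sub>n\<close> in the Hartogs triangle
  converge to \<open>f\<close> together with their \<open>\<partial>\<close>-bar, integrate by parts against a test function on the
  whole space and pass to the limit (\<open>weak_dbar_limit\<close>).

  For the converse let \<open>f\<close> vanish outside the triangle and have \<open>\<partial>\<close>-bar in \<open>L\<^sup>2\<close> of the whole
  space. The complex linear maps $(z,w) \mapsto (a^2 z, a w)$ with $a > 1$ expand, and composing
  with them moves the support of \<open>f\<close> into the open triangle, except that it still reaches the
  singular boundary point \<open>0\<close>. Being holomorphic, they only rescale the components of \<open>\<partial>\<close>-bar.
  If \<open>f\<close> vanishes for small \<open>w\<close>, a dilation followed by a mollification therefore gives test
  functions that converge in the graph norm (\<open>approximable_if_away_from_origin\<close>).

  It remains to cut \<open>f\<close> off near \<open>0\<close>. A cutoff \<open>\<rho>\<close> at scale \<open>\<epsilon>\<close> costs the term $f\,\bar\partial\rho$.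
  The point \<open>0\<close> is the only point of the closed triangle with $w = 0$, so \<open>\<rho>\<close> can be a function
  of \<open>w\<close> alone, and then $|\bar\partial\rho| \le 2/|w|$ uniformly in \<open>\<epsilon>\<close>. This cost tends to
  zero once $f/|w|$ is known to be in \<open>L\<^sup>2\<close>, which is a Hardy inequality: for fixed \<open>w\<close> the
  function $f(\cdot,w)$ is supported in the disc $|z| \le |w|$, and the Poincare inequality on
  that disc reads $\|f(\cdot,w)\| \le C |w| \|\partial f/\partial\bar z(\cdot,w)\|$. It is proved
  for test functions (\<open>hardy_test_function\<close>) and passes to $\rho f$, whose derivative in
  $\bar z$ is just $\rho\,\partial f/\partial\bar z$ because \<open>\<rho>\<close> does not depend on \<open>z\<close>; the
  bound is thus independent of \<open>\<epsilon>\<close>, and Fatou's lemma yields it for \<open>f\<close>.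
\<close>

section \<open>Smooth functions and integration by parts\<close>

type_synonym C2 = "complex \<times> complex"

lemma CkI:
  assumes "\<And>x. (f has_derivative f' x) (at x)" "\<And>v. Ck k (\<lambda>x. f' x v)"
  shows "Ck (Suc k) f"
proof -
  have "frechet_derivative f (at x) = f' x" for x
    using frechet_derivative_at[OF assms(1)] by simp
  then show ?thesis
    using assms by (auto simp: differentiable_def)
qed

lemma Ck_has_derivative:
  assumes "Ck (Suc k) f"
  shows "(f has_derivative frechet_derivative f (at x)) (at x)"
  using assms frechet_derivative_works by auto

lemma Ck_Suc_imp_Ck: "Ck (Suc k) f \<Longrightarrow> Ck k f"
proof (induction k arbitrary: f)
  case 0
  then show ?case
    by (simp add: continuous_on_eq_continuous_within differentiable_imp_continuous_within)
next
  case (Suc k)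
  show ?case
    unfolding Ck.simps(2)[of k f]
  proof (intro conjI allI)
    show "f differentiable (at x)" for x
      using Suc.prems by (simp only: Ck.simps(2)[of "Suc k"])
    show "Ck k (\<lambda>x. frechet_derivative f (at x) v)" for v
      using Suc.prems by (intro Suc.IH) (simp only: Ck.simps(2)[of "Suc k"])
  qed
qed

lemma Ck_const: "Ck k (\<lambda>x. c)"
proof (induction k arbitrary: c)
  case (Suc k)
  show ?case
    by (rule CkI[where f' = "\<lambda>_ _. 0"]) (auto intro: derivative_eq_intros Suc.IH)
qed simp

lemma Ck_linear:
  assumes "bounded_linear L"
  shows "Ck k L"
proof (cases k)
  case 0
  then show ?thesis
    using assms by (simp add: linear_continuous_on)
next
  case (Suc j)
  show ?thesis
    unfolding Suc
    by (rule CkI[where f' = "\<lambda>_. L"]) (auto intro: bounded_linear_imp_has_derivative assms Ck_const)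
qed

lemma Ck_add: "Ck k f \<Longrightarrow> Ck k g \<Longrightarrow> Ck k (\<lambda>x. f x + g x)"
proof (induction k arbitrary: f g)
  case 0
  then show ?case by (auto intro: continuous_intros)
next
  case (Suc k)
  show ?case
    by (rule CkI[where f' = "\<lambda>x v. frechet_derivative f (at x) v + frechet_derivative g (at x) v"])
      (use Suc in \<open>auto intro!: has_derivative_add simp: frechet_derivative_works[symmetric]\<close>)
qed

lemma Ck_mult:
  fixes f g :: "'a::euclidean_space \<Rightarrow> complex"
  shows "Ck k f \<Longrightarrow> Ck k g \<Longrightarrow> Ck k (\<lambda>x. f x * g x)"
proof (induction k arbitrary: f g)
  case 0
  then show ?case by (auto intro: continuous_intros)
next
  case (Suc k)
  show ?case
  proof (rule CkI[where f' = "\<lambda>x v. f x * frechet_derivative g (at x) v + frechet_derivative f (at x) v * g x"])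
    show "((\<lambda>x. f x * g x) has_derivative
           (\<lambda>v. f x * frechet_derivative g (at x) v + frechet_derivative f (at x) v * g x)) (at x)" for x
      by (intro has_derivative_mult Ck_has_derivative[OF Suc.prems(1)] Ck_has_derivative[OF Suc.prems(2)])
    show "Ck k (\<lambda>x. f x * frechet_derivative g (at x) v + frechet_derivative f (at x) v * g x)" for v
      by (intro Ck_add Suc.IH) (use Suc.prems Ck_Suc_imp_Ck in auto)
  qed
qed

lemma Ck_linear_compose:
  assumes "bounded_linear L"
  shows "Ck k f \<Longrightarrow> Ck k (\<lambda>x. L (f x))"
proof (induction k arbitrary: f)
  case 0
  then show ?case
    using assms by (auto intro: continuous_intros bounded_linear.continuous_on)
next
  case (Suc k)
  show ?case
    by (rule CkI[where f' = "\<lambda>x v. L (frechet_derivative f (at x) v)"])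
      (use Suc in \<open>auto intro!: bounded_linear.has_derivative[OF assms] simp: frechet_derivative_works[symmetric]\<close>)
qed

lemma Ck_compose_affine:
  assumes "bounded_linear A"
  shows "Ck k f \<Longrightarrow> Ck k (\<lambda>x. f (A x + c))"
proof (induction k arbitrary: f)
  case 0
  have "continuous_on UNIV (\<lambda>x. A x + c)"
    by (intro continuous_intros linear_continuous_on assms)
  with 0 show ?case
    by (auto intro: continuous_on_compose2)
next
  case (Suc k)
  show ?case
  proof (rule CkI[where f' = "\<lambda>x v. frechet_derivative f (at (A x + c)) (A v)"])
    fix x
    have "((\<lambda>x. A x + c) has_derivative A) (at x)"
      using bounded_linear_imp_has_derivative[OF assms]
      by (auto intro!: derivative_eq_intros)
    from has_derivative_compose[OF this Ck_has_derivative[OF Suc.prems]]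
    show "((\<lambda>x. f (A x + c)) has_derivative (\<lambda>v. frechet_derivative f (at (A x + c)) (A v))) (at x)" .
  qed (use Suc in auto)
qed

text \<open>The functions $t^{-m} e^{-1/t}$, extended by zero to $t \le 0$. Differentiation maps them to
  combinations of each other, so one induction shows that all of them are smooth; both the
  mollifiers and the cutoff functions are obtained by composing them with quadratic polynomials.\<close>

definition flat :: "nat \<Rightarrow> real \<Rightarrow> real" where
  "flat m t = (if t \<le> 0 then 0 else inverse t ^ m * exp (- inverse t))"

lemma flat_nonneg: "0 \<le> flat m t"
  by (simp add: flat_def)

lemma flat_tendsto_0: "((\<lambda>t. flat m t) \<longlongrightarrow> 0) (at_right 0)"
proof -
  have "((\<lambda>s::real. s ^ m / exp s) \<longlongrightarrow> 0) at_top"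
    by (rule tendsto_power_div_exp_0)
  then have "((\<lambda>t::real. inverse t ^ m / exp (inverse t)) \<longlongrightarrow> 0) (at_right 0)"
    by (rule filterlim_compose) (rule filterlim_inverse_at_top_right)
  then show ?thesis
    by (rule Lim_transform_eventually)
      (auto simp: eventually_at_right_field flat_def exp_minus divide_inverse intro!: exI[of _ 1])
qed

lemma flat_has_derivative:
  "(flat m has_real_derivative (- real m * flat (Suc m) t + flat (Suc (Suc m)) t)) (at t)"
proof -
  consider "t < 0" | "t > 0" | "t = 0" by linarith
  then show ?thesis
  proof cases
    case 1
    have "((\<lambda>_. 0) has_real_derivative 0) (at t)" by simp
    then have "(flat m has_real_derivative 0) (at t)"
      by (rule has_field_derivative_transform_within_open[where S = "{..<0}"])
        (use 1 in \<open>auto simp: flat_def\<close>)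
    with 1 show ?thesis by (simp add: flat_def)
  next
    case 2
    have "((\<lambda>t. inverse t ^ m * exp (- inverse t)) has_real_derivative
        (- real m * flat (Suc m) t + flat (Suc (Suc m)) t)) (at t)"
    proof (cases m)
      case 0
      with 2 show ?thesis
        by (auto intro!: derivative_eq_intros simp: flat_def power2_eq_square)
    next
      case (Suc j)
      have "((\<lambda>t. inverse t ^ m) has_real_derivative (- real m * inverse t ^ Suc m)) (at t)"
        using 2 DERIV_power[OF DERIV_inverse[of t], of m] unfolding Suc
        by (simp add: power2_eq_square algebra_simps)
      moreover have "((\<lambda>t. exp (- inverse t)) has_real_derivative (exp (- inverse t) * inverse t ^ 2)) (at t)"
        using 2 by (auto intro!: derivative_eq_intros simp: power2_eq_square)
      ultimately show ?thesis
        by (rule DERIV_cong[OF DERIV_mult]) (use 2 in \<open>simp add: flat_def power2_eq_square algebra_simps\<close>)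
    qed
    then show ?thesis
      by (rule has_field_derivative_transform_within_open[where S = "{0<..}"])
        (use 2 in \<open>auto simp: flat_def\<close>)
  next
    case 3
    have "((\<lambda>h. (flat m (0 + h) - flat m 0) / h) \<longlongrightarrow> 0) (at 0)"
    proof -
      have "((\<lambda>h. flat (Suc m) h) \<longlongrightarrow> 0) (at_left 0)"
        by (rule Lim_transform_eventually[OF tendsto_const])
          (auto simp: eventually_at_left_field flat_def intro!: exI[of _ "-1"])
      with flat_tendsto_0[of "Suc m"] have "((\<lambda>h. flat (Suc m) h) \<longlongrightarrow> 0) (at 0)"
        by (simp add: filterlim_split_at)
      then show ?thesis
        by (rule Lim_transform_eventually)
          (auto simp: eventually_at_filter flat_def divide_inverse)
    qed
    then show ?thesis
      using 3 by (simp add: DERIV_def flat_def)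
  qed
qed

lemma flat_compose_has_derivative:
  assumes "(q has_derivative q') (at x)"
  shows "((\<lambda>x. complex_of_real (flat m (q x))) has_derivative
    (\<lambda>v. of_real (- real m * flat (Suc m) (q x) + flat (Suc (Suc m)) (q x)) * of_real (q' v))) (at x)"
proof -
  have "((\<lambda>x. flat m (q x)) has_derivative
      (\<lambda>v. q' v * (- real m * flat (Suc m) (q x) + flat (Suc (Suc m)) (q x)))) (at x)"
    using has_derivative_compose[OF assms flat_has_derivative[unfolded has_field_derivative_def]]
    by (simp add: mult.commute)
  from bounded_linear.has_derivative[OF bounded_linear_of_real this]
  show ?thesis by (simp add: mult.commute)
qed

lemma Ck_flat_compose:
  assumes q: "\<And>x. (q has_derivative q' x) (at x)" and q': "\<And>v j. Ck j (\<lambda>x. complex_of_real (q' x v))"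
  shows "Ck k (\<lambda>x. complex_of_real (flat m (q x)))"
proof (induction k arbitrary: m)
  case 0
  have "isCont (\<lambda>x. complex_of_real (flat m (q x))) x" for x
    by (rule has_derivative_continuous[OF flat_compose_has_derivative[OF q]])
  then show ?case
    unfolding Ck.simps(1) by (intro continuous_at_imp_continuous_on ballI)
next
  case (Suc k)
  show ?case
  proof (rule CkI[OF flat_compose_has_derivative[OF q]])
    fix v
    have "Ck k (\<lambda>x. (of_real (- real m) * complex_of_real (flat (Suc m) (q x))
        + complex_of_real (flat (Suc (Suc m)) (q x))) * of_real (q' x v))"
      by (intro Ck_mult Ck_add Ck_const Suc.IH q')
    then show "Ck k (\<lambda>x. of_real (- real m * flat (Suc m) (q x) + flat (Suc (Suc m)) (q x)) * complex_of_real (q' x v))"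
      by simp
  qed
qed

definition C1c :: "('a::euclidean_space \<Rightarrow> complex) \<Rightarrow> bool" where
  "C1c f \<longleftrightarrow> Ck (Suc 0) f \<and> (\<exists>R. \<forall>x. R < norm x \<longrightarrow> f x = 0)"

abbreviation fd :: "('a::euclidean_space \<Rightarrow> complex) \<Rightarrow> 'a \<Rightarrow> 'a \<Rightarrow> complex" where
  "fd f x v \<equiv> frechet_derivative f (at x) v"

lemma frechet_derivative_zero_open:
  assumes "open S" "x \<in> S" "\<And>y. y \<in> S \<Longrightarrow> f y = 0"
  shows "frechet_derivative f (at x) v = 0"
proof -
  have "((\<lambda>_. 0) has_derivative (\<lambda>_. 0)) (at x)" by simp
  then have "(f has_derivative (\<lambda>_. 0)) (at x)"
    by (rule has_derivative_transform_within_open[OF _ assms(1,2)]) (simp add: assms(3))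
  then show ?thesis
    using frechet_derivative_at by metis
qed

lemma C1cE:
  assumes "C1c f"
  obtains R where "R > 0" "\<And>x. R < norm x \<Longrightarrow> f x = 0" "\<And>x v. R < norm x \<Longrightarrow> fd f x v = 0"
proof -
  obtain R where R: "\<forall>x. R < norm x \<longrightarrow> f x = 0" using assms by (auto simp: C1c_def)
  have "fd f x v = 0" if "max R 1 < norm x" for x v
    by (rule frechet_derivative_zero_open[of "{x. R < norm x}"])
      (use R that in \<open>auto intro!: open_Collect_less continuous_intros\<close>)
  with R show ?thesis
    by (intro that[of "max R 1"]) auto
qed

lemma C1c_has_derivative: "C1c f \<Longrightarrow> (f has_derivative fd f x) (at x)"
  unfolding C1c_def using Ck_has_derivative by blast

lemma C1c_continuous: "C1c f \<Longrightarrow> continuous_on UNIV f"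
  unfolding C1c_def using Ck_Suc_imp_Ck[of 0] by auto

lemma C1c_fd_continuous: "C1c f \<Longrightarrow> continuous_on UNIV (\<lambda>x. fd f x v)"
  unfolding C1c_def by auto

lemma C1c_linear_fd: "C1c f \<Longrightarrow> bounded_linear (fd f x)"
  by (rule has_derivative_bounded_linear[OF C1c_has_derivative])

lemma C1c_mult: "C1c f \<Longrightarrow> C1c g \<Longrightarrow> C1c (\<lambda>x. f x * g x)"
  unfolding C1c_def by (auto intro: Ck_mult simp del: Ck.simps)

lemma C1c_mult_Ck: "C1c f \<Longrightarrow> Ck (Suc 0) g \<Longrightarrow> C1c (\<lambda>x. g x * f x)"
  unfolding C1c_def by (auto intro: Ck_mult simp del: Ck.simps)

lemma C1c_cnj: "C1c f \<Longrightarrow> C1c (\<lambda>x. cnj (f x))"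
  unfolding C1c_def by (auto intro: Ck_linear_compose[OF bounded_linear_cnj] simp del: Ck.simps)

lemma fd_mult:
  assumes "Ck (Suc j) f" "Ck (Suc k) g"
  shows "fd (\<lambda>x. f x * g x) x v = f x * fd g x v + fd f x v * g x"
  using frechet_derivative_at[OF has_derivative_mult[OF Ck_has_derivative[OF assms(1)] Ck_has_derivative[OF assms(2)]], of x]
  by (simp add: fun_eq_iff)

lemma fd_cnj:
  assumes "Ck (Suc j) f"
  shows "fd (\<lambda>x. cnj (f x)) x v = cnj (fd f x v)"
  using frechet_derivative_at[OF bounded_linear.has_derivative[OF bounded_linear_cnj Ck_has_derivative[OF assms]], of x]
  by (simp add: fun_eq_iff)

lemma fd_compose_affine:
  assumes "Ck (Suc j) f" "bounded_linear A"
  shows "fd (\<lambda>x. f (A x + c)) x v = fd f (A x + c) (A v)"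
proof -
  have "((\<lambda>x. A x + c) has_derivative A) (at x)"
    using bounded_linear_imp_has_derivative[OF assms(2)] by (auto intro!: derivative_eq_intros)
  from frechet_derivative_at[OF has_derivative_compose[OF this Ck_has_derivative[OF assms(1)]]]
  show ?thesis by (simp add: fun_eq_iff)
qed

lemma uniformly_continuous_bounded_support:
  fixes f :: "'a::euclidean_space \<Rightarrow> 'b::real_normed_vector"
  assumes "continuous_on UNIV f" "\<And>x. R < norm x \<Longrightarrow> f x = 0"
  shows "uniformly_continuous_on UNIV f"
  unfolding uniformly_continuous_on_def
proof (intro allI impI)
  fix e :: real assume "e > 0"
  have "uniformly_continuous_on (cball 0 (R + 1)) f"
    by (intro compact_uniformly_continuous continuous_on_subset[OF assms(1)]) auto
  then obtain d where d: "d > 0"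
    "\<And>x y. x \<in> cball 0 (R+1) \<Longrightarrow> y \<in> cball 0 (R+1) \<Longrightarrow> dist y x < d \<Longrightarrow> dist (f y) (f x) < e"
    unfolding uniformly_continuous_on_def using \<open>e > 0\<close> by metis
  have "dist (f y) (f x) < e" if "dist y x < min d 1" for x y
  proof (cases "norm x \<le> R + 1 \<and> norm y \<le> R + 1")
    case True
    then show ?thesis using d that by auto
  next
    case False
    have "norm x \<le> norm y + 1" "norm y \<le> norm x + 1"
      using that norm_triangle_ineq2[of x y] norm_triangle_ineq2[of y x]
      by (auto simp: dist_norm norm_minus_commute)
    with False have "R < norm x" "R < norm y" by auto
    then show ?thesis using assms(2) \<open>e > 0\<close> by simp
  qed
  then show "\<exists>d>0. \<forall>x\<in>UNIV. \<forall>x'\<in>UNIV. dist x' x < d \<longrightarrow> dist (f x') (f x) < e"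
    using d(1) by (intro exI[of _ "min d 1"]) auto
qed

lemma bounded_bounded_support:
  fixes f :: "'a::euclidean_space \<Rightarrow> 'b::real_normed_vector"
  assumes "continuous_on UNIV f" "\<And>x. R < norm x \<Longrightarrow> f x = 0"
  obtains B where "B > 0" "\<And>x. norm (f x) \<le> B"
proof -
  have "compact (f ` cball 0 R)"
    by (intro compact_continuous_image continuous_on_subset[OF assms(1)]) auto
  then obtain B where B: "B > 0" "\<forall>y\<in>f ` cball 0 R. norm y \<le> B"
    using compact_imp_bounded bounded_pos by metis
  have "norm (f x) \<le> B" for x
    using B assms(2)[of x] by (cases "norm x \<le> R") auto
  with B(1) that show ?thesis by blast
qed

text \<open>Compactness of the support makes the partial derivatives uniformly continuous; this turns
  into uniformity of the total derivative by the mean value theorem along segments.\<close>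

lemma C1c_uniformly_differentiable:
  assumes f: "C1c f" and "e > 0"
  obtains d where "d > 0"
    "\<And>x h. norm h < d \<Longrightarrow> norm (f (x + h) - f x - fd f x h) \<le> e * norm h"
proof -
  obtain R where R: "\<And>x v. R < norm x \<Longrightarrow> fd f x v = 0" using C1cE[OF f] by metis
  define e' where "e' = e / DIM('a)"
  have "e' > 0" using \<open>e > 0\<close> by (simp add: e'_def)
  have "uniformly_continuous_on UNIV (\<lambda>x. fd f x b)" for b
    by (rule uniformly_continuous_bounded_support[OF C1c_fd_continuous[OF f] R])
  then have "\<forall>b. \<exists>d>0. \<forall>x y. dist y x < d \<longrightarrow> dist (fd f y b) (fd f x b) < e'"
    using \<open>e' > 0\<close> unfolding uniformly_continuous_on_def by auto
  then obtain d where d: "\<And>b. d b > 0" "\<And>b x y. dist y x < d b \<Longrightarrow> dist (fd f y b) (fd f x b) < e'"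
    by metis
  define \<delta> where "\<delta> = Min (d ` (Basis :: 'a set))"
  have "\<delta> > 0" unfolding \<delta>_def using d(1) by (subst Min_gr_iff) auto
  have \<delta>_le: "\<delta> \<le> d b" if "b \<in> Basis" for b unfolding \<delta>_def using that by (intro Min_le) auto
  have "norm (f (x + h) - f x - fd f x h) \<le> e * norm h" if h: "norm h < \<delta>" for x h
  proof -
    have "norm (f (x + h) - f x - fd f x ((x + h) - x)) \<le> norm ((x + h) - x) * e"
    proof (rule differentiable_bound_linearization[where S = "ball x \<delta>"])
      show "x + t *\<^sub>R (x + h - x) \<in> ball x \<delta>" if "t \<in> {0..1}" for t
      proof -
        have "norm (t *\<^sub>R h) \<le> 1 * norm h" using that by (simp add: mult_left_le_one_le)
        then show ?thesis using h by (simp add: dist_norm)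
      qed
      show "(f has_derivative fd f y) (at y within ball x \<delta>)" for y
        using C1c_has_derivative[OF f] has_derivative_at_withinI by blast
      show "onorm (fd f y - fd f x) \<le> e" if "y \<in> ball x \<delta>" for y
      proof -
        have "bounded_linear (\<lambda>v. fd f y v - fd f x v)"
          by (intro bounded_linear_sub C1c_linear_fd f)
        then have "onorm (\<lambda>v. fd f y v - fd f x v) \<le> (\<Sum>i\<in>Basis. norm (fd f y i - fd f x i))"
          by (rule onorm_componentwise)
        also have "\<dots> \<le> (\<Sum>i\<in>(Basis::'a set). e')"
        proof (rule sum_mono)
          fix i :: 'a assume "i \<in> Basis"
          then have "dist y x < d i" using that \<delta>_le[of i] by (auto simp: dist_commute)
          from d(2)[OF this] show "norm (fd f y i - fd f x i) \<le> e'" by (simp add: dist_norm)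
        qed
        also have "\<dots> = e" by (simp add: e'_def)
        finally show ?thesis by (simp add: fun_diff_def)
      qed
      show "x \<in> ball x \<delta>" using \<open>\<delta> > 0\<close> by simp
    qed
    then show ?thesis by (simp add: mult.commute)
  qed
  with \<open>\<delta> > 0\<close> that show ?thesis by blast
qed

lemma C1c_lipschitz:
  assumes f: "C1c f"
  obtains B where "B > 0" "\<And>x h. norm (f (x + h) - f x) \<le> B * norm h"
proof -
  obtain R where R: "\<And>x v. R < norm x \<Longrightarrow> fd f x v = 0" using C1cE[OF f] by metis
  have "\<forall>b. \<exists>B>0. \<forall>x. norm (fd f x b) \<le> B"
    using bounded_bounded_support[OF C1c_fd_continuous[OF f] R] by metis
  then obtain B where B: "\<And>b. B b > 0" "\<And>b x. norm (fd f x b) \<le> B b" by metis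
  have "norm (f (x + h) - f x) \<le> (\<Sum>i\<in>Basis. B i) * norm ((x + h) - x)" for x h
  proof (rule differentiable_bound[where S = UNIV])
    show "(f has_derivative fd f y) (at y within UNIV)" for y
      using C1c_has_derivative[OF f] by simp
    show "onorm (fd f y) \<le> (\<Sum>i\<in>Basis. B i)" for y
      by (rule order.trans[OF onorm_componentwise[OF C1c_linear_fd[OF f, of y]]]) (intro sum_mono B(2))
  qed auto
  moreover have "(\<Sum>i\<in>(Basis::'a set). B i) > 0" using B(1) by (intro sum_pos) auto
  ultimately show ?thesis using that by simp
qed

lemma integrable_bounded_support:
  fixes f :: "'a::euclidean_space \<Rightarrow> 'b::{banach, second_countable_topology}"
  assumes "f \<in> borel_measurable borel" "\<And>x. norm (f x) \<le> M" "\<And>x. R < norm x \<Longrightarrow> f x = 0"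
  shows "integrable lborel f"
proof (rule integrableI_bounded_set[where A = "cball 0 R" and B = M])
  show "emeasure lborel (cball (0::'a) R) < \<infinity>"
    by (rule emeasure_lborel_cball_finite)
qed (use assms in auto)

lemma borel_measurable_continuous: "continuous_on UNIV f \<Longrightarrow> f \<in> borel_measurable borel"
  by (rule borel_measurable_continuous_onI)

lemma C1c_difference_quotient_integral:
  fixes F K :: "'a::euclidean_space \<Rightarrow> complex"
  assumes F: "C1c F" and K: "K \<in> borel_measurable borel" "\<And>x. norm (K x) \<le> M"
  shows "(\<lambda>n. \<integral>x. of_nat (Suc n) * (F (x + v /\<^sub>R real (Suc n)) - F x) * K x \<partial>lborel)
    \<longlonglongrightarrow> (LBINT x. fd F x v * K x)"
proof -
  obtain B where B: "B > 0" "\<And>x h. norm (F (x + h) - F x) \<le> B * norm h" using C1c_lipschitz[OF F] by metis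
  obtain R where R: "\<And>x. R < norm x \<Longrightarrow> F x = 0" using C1cE[OF F] by metis
  have [measurable]: "F \<in> borel_measurable borel" "(\<lambda>x. fd F x v) \<in> borel_measurable borel"
    using C1c_continuous[OF F] C1c_fd_continuous[OF F] borel_measurable_continuous by auto
  note [measurable] = K(1)
  have M: "M \<ge> 0" using K(2)[of 0] norm_ge_zero order_trans by blast
  define w where "w = (\<lambda>x::'a. B * norm v * M * indicator (cball 0 (R + norm v)) x :: real)"
  show ?thesis
  proof (rule integral_dominated_convergence[where w = w])
    have "emeasure lborel (cball (0::'a) (R + norm v)) < \<infinity>"
      by (rule emeasure_lborel_cball_finite)
    then show "integrable lborel w"
      unfolding w_def by (intro integrable_mult_right integrable_real_indicator) auto
    show "AE x in lborel. (\<lambda>n. of_nat (Suc n) * (F (x + v /\<^sub>R real (Suc n)) - F x) * K x) \<longlonglongrightarrow> fd F x v * K x"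
    proof (intro AE_I2 tendsto_mult tendsto_const)
      fix x
      show "(\<lambda>n. of_nat (Suc n) * (F (x + v /\<^sub>R real (Suc n)) - F x)) \<longlonglongrightarrow> fd F x v"
      proof (rule LIMSEQ_I)
        fix e :: real assume "e > 0"
        then have "e / (norm v + 1) > 0" by (simp add: add_nonneg_pos)
        from C1c_uniformly_differentiable[OF F this] obtain d where d: "d > 0"
          "\<And>x h. norm h < d \<Longrightarrow> norm (F (x + h) - F x - fd F x h) \<le> e / (norm v + 1) * norm h" by metis
        have "(\<lambda>n. norm v / real (Suc n)) \<longlonglongrightarrow> 0"
          using LIMSEQ_Suc[OF lim_const_over_n[of "norm v"]] by simp
        from LIMSEQ_D[OF this d(1)] obtain N where N: "\<And>n. n \<ge> N \<Longrightarrow> norm v / real (Suc n) < d"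
          by auto
        show "\<exists>N. \<forall>n\<ge>N. norm (of_nat (Suc n) * (F (x + v /\<^sub>R real (Suc n)) - F x) - fd F x v) < e"
        proof (intro exI allI impI)
          fix n assume n: "N \<le> n"
          let ?h = "v /\<^sub>R real (Suc n)"
          have lin: "fd F x ?h = fd F x v /\<^sub>R real (Suc n)"
            using C1c_linear_fd[OF F, of x] by (simp add: linear_scale bounded_linear.linear)
          have eq: "of_nat (Suc n) * (F (x + ?h) - F x) - fd F x v = of_nat (Suc n) * (F (x + ?h) - F x - fd F x ?h)"
            unfolding lin scaleR_conv_of_real by (simp add: field_simps del: of_nat_Suc)
          have h: "norm ?h = norm v / real (Suc n)" by (simp add: divide_inverse_commute)
          have "norm (of_nat (Suc n) * (F (x + ?h) - F x) - fd F x v)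
              = real (Suc n) * norm (F (x + ?h) - F x - fd F x ?h)"
            unfolding eq norm_mult by (simp only: norm_of_nat)
          also have "\<dots> \<le> real (Suc n) * (e / (norm v + 1) * norm ?h)"
            by (intro mult_left_mono d(2)) (use N[OF n] h in auto)
          also have "\<dots> = e * (norm v / (norm v + 1))"
            unfolding h by (simp del: of_nat_Suc)
          also have "\<dots> < e * 1"
            by (intro mult_strict_left_mono) (use \<open>e > 0\<close> in \<open>auto simp: add_nonneg_pos\<close>)
          finally show "norm (of_nat (Suc n) * (F (x + ?h) - F x) - fd F x v) < e" by simp
        qed
      qed
    qed
    show "AE x in lborel. norm (of_nat (Suc n) * (F (x + v /\<^sub>R real (Suc n)) - F x) * K x) \<le> w x" for n
    proof (rule AE_I2)
      fix x
      let ?h = "v /\<^sub>R real (Suc n)"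
      have h: "norm ?h = norm v / real (Suc n)" by (simp add: divide_inverse_commute)
      also have "\<dots> \<le> norm v" by (simp add: divide_le_eq mult_right_le_one_le ) (simp add: algebra_simps)
      finally have hle: "norm ?h \<le> norm v" .
      show "norm (of_nat (Suc n) * (F (x + ?h) - F x) * K x) \<le> w x"
      proof (cases "norm x \<le> R + norm v")
        case True
        have "norm (of_nat (Suc n) * (F (x + ?h) - F x) * K x)
           = real (Suc n) * norm (F (x + ?h) - F x) * norm (K x)"
          unfolding norm_mult by (simp only: norm_of_nat)
        also have "\<dots> \<le> real (Suc n) * (B * norm ?h) * M"
          by (intro mult_mono mult_left_mono B(2) K(2)) (use B(1) in auto)
        also have "\<dots> = B * norm v * M"
          unfolding h by (simp del: of_nat_Suc)
        finally show ?thesis using True by (simp add: w_def)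
      next
        case False
        have "norm x - norm ?h \<le> norm (x + ?h)"
          by (metis norm_diff_ineq)
        with False hle have "R < norm x" "R < norm (x + ?h)" by (auto intro: order.strict_trans2 simp: not_le) (smt (verit) norm_ge_zero)
        then show ?thesis using R M B(1) by (simp add: w_def)
      qed
    qed
  qed measurable
qed

lemma lborel_integral_translate:
  fixes f :: "'a::euclidean_space \<Rightarrow> 'b::{banach, second_countable_topology}"
  assumes [measurable]: "f \<in> borel_measurable borel"
  shows "(LBINT x. f (x + a)) = (LBINT x. f x)"
proof -
  have "(LBINT x. f x) = (\<integral>x. f x \<partial>distr lborel borel ((+) a))"
    by (simp add: lborel_distr_plus)
  also have "\<dots> = (LBINT x. f (a + x))"
    by (subst integral_distr) auto
  finally show ?thesis by (simp add: add.commute)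
qed

lemma lborel_integrable_translate:
  fixes f :: "'a::euclidean_space \<Rightarrow> 'b::{banach, second_countable_topology}"
  assumes "integrable lborel f"
  shows "integrable lborel (\<lambda>x. f (x + a))"
proof -
  have "integrable (distr lborel borel ((+) a)) f"
    using assms by (simp add: lborel_distr_plus)
  then have "integrable lborel (\<lambda>x. f (a + x))"
    by (rule integrable_distr[rotated]) auto
  then show ?thesis by (simp add: add.commute)
qed

text \<open>By translation invariance of the measure and of the weight \<open>K\<close> along \<open>v\<close>, every difference
  quotient of \<open>G\<close> in the direction \<open>v\<close> has weighted integral zero. Since \<open>K\<close> is not
  differentiated, the truncated weight of the Hardy inequality is covered.\<close>

lemma integral_weight_derivative_zero:
  fixes G K :: "'a::euclidean_space \<Rightarrow> complex"
  assumes G: "C1c G" and K: "K \<in> borel_measurable borel" "\<And>x. norm (K x) \<le> M"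
    and inv: "\<And>x t. K (x + t *\<^sub>R v) = K x"
  shows "(LBINT x. fd G x v * K x) = 0"
proof -
  obtain R where R: "\<And>x. R < norm x \<Longrightarrow> G x = 0" using C1cE[OF G] by metis
  have [measurable]: "G \<in> borel_measurable borel" using C1c_continuous[OF G] borel_measurable_continuous by auto
  note [measurable] = K(1)
  obtain B where B: "B > 0" "\<And>x. norm (G x) \<le> B"
    using bounded_bounded_support[OF C1c_continuous[OF G] R] by metis
  have int: "integrable lborel (\<lambda>x. G x * K x)"
    by (rule integrable_bounded_support[where M = "B * M" and R = R])
      (use R B K(2) in \<open>auto simp: norm_mult intro!: mult_mono order.trans[OF norm_ge_zero K(2)]\<close>)
  have "(LBINT x. of_nat (Suc n) * (G (x + v /\<^sub>R real (Suc n)) - G x) * K x) = 0" for n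
  proof -
    let ?h = "v /\<^sub>R real (Suc n)"
    have *: "of_nat (Suc n) * (G (x + ?h) - G x) * K x
       = of_nat (Suc n) * (G (x + ?h) * K (x + ?h) - G x * K x)" for x
      using inv[of x "inverse (real (Suc n))"] by (simp add: algebra_simps)
    show ?thesis
      unfolding * using int lborel_integrable_translate[OF int, of ?h]
        lborel_integral_translate[of "\<lambda>x. G x * K x" ?h] by simp
  qed
  with C1c_difference_quotient_integral[OF G K, of v] show ?thesis
    using LIMSEQ_unique[OF _ tendsto_const] by simp
qed

lemma integral_derivative_zero: "C1c G \<Longrightarrow> (LBINT x. fd G x v) = 0"
  using integral_weight_derivative_zero[of G "\<lambda>_. 1" 1 v] by simp

lemma C1c_integrable_fd_mult:
  assumes F: "C1c F" and G: "continuous_on UNIV G"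
  shows "integrable lborel (\<lambda>x. fd F x v * G x)"
proof -
  obtain R where R: "\<And>x v. R < norm x \<Longrightarrow> fd F x v = 0" using C1cE[OF F] by metis
  have c: "continuous_on UNIV (\<lambda>x. fd F x v * G x)"
    by (intro continuous_intros C1c_fd_continuous F G)
  obtain B where "B > 0" "\<And>x. norm (fd F x v * G x) \<le> B"
    using bounded_bounded_support[OF c, of R] R by auto
  with R show ?thesis
    by (intro integrable_bounded_support[of _ B R] borel_measurable_continuous[OF c]) auto
qed

lemma integral_by_parts_C1c:
  assumes F: "C1c F" and G: "Ck (Suc 0) G"
  shows "(LBINT x. fd F x v * G x) = - (LBINT x. F x * fd G x v)"
proof -
  have C: "C1c (\<lambda>x. F x * G x)"
    using C1c_mult_Ck[OF F G] by (simp add: mult.commute)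
  have FC: "Ck (Suc 0) F" using F by (simp add: C1c_def del: Ck.simps)
  have eq: "fd (\<lambda>x. F x * G x) x v = F x * fd G x v + fd F x v * G x" for x
    by (rule fd_mult[OF FC G])
  have 1: "integrable lborel (\<lambda>x. fd F x v * G x)"
    by (rule C1c_integrable_fd_mult[OF F]) (use Ck_Suc_imp_Ck[OF G] in simp)
  have "integrable lborel (\<lambda>x. fd (\<lambda>x. F x * G x) x v)"
    using C1c_integrable_fd_mult[OF C, of "\<lambda>_. 1" v] by simp
  from Bochner_Integration.integrable_diff[OF this 1] have 2: "integrable lborel (\<lambda>x. F x * fd G x v)"
    unfolding eq by simp
  have "0 = (LBINT x. F x * fd G x v + fd F x v * G x)"
    using integral_derivative_zero[OF C, of v] unfolding eq by simp
  also have "\<dots> = (LBINT x. F x * fd G x v) + (LBINT x. fd F x v * G x)"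
    by (rule Bochner_Integration.integral_add[OF 2 1])
  finally show ?thesis by (simp add: eq_neg_iff_add_eq_0 add.commute)
qed

text \<open>Formally both sides equal minus the integral of \<open>F\<close> times a mixed second derivative of \<open>G\<close>.
  Second derivatives are avoided by replacing the derivative along \<open>v\<close> with a difference quotient,
  which a translation moves from \<open>F\<close> to \<open>G\<close>; only one integration by parts along \<open>w\<close> remains.\<close>

lemma integral_mixed_derivatives_symmetric:
  assumes F: "C1c F" and G: "C1c G"
  shows "(LBINT x. fd F x v * fd G x w) = (LBINT x. fd F x w * fd G x v)"
proof -
  have FC: "Ck (Suc 0) F" "Ck (Suc 0) G" using F G by (auto simp: C1c_def simp del: Ck.simps)
  obtain R where R: "\<And>x. R < norm x \<Longrightarrow> F x = 0" "\<And>x v. R < norm x \<Longrightarrow> fd F x v = 0" using C1cE[OF F] by metis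
  obtain R' where R': "\<And>x v. R' < norm x \<Longrightarrow> fd G x v = 0" using C1cE[OF G] by metis
  have cont: "continuous_on UNIV (\<lambda>x. fd F x w)" "continuous_on UNIV (\<lambda>x. fd G x w)" "continuous_on UNIV F"
    using C1c_fd_continuous C1c_continuous F G by auto
  then have [measurable]: "(\<lambda>x. fd F x w) \<in> borel_measurable borel" "(\<lambda>x. fd G x w) \<in> borel_measurable borel"
      "F \<in> borel_measurable borel"
    using borel_measurable_continuous by auto
  obtain B where B: "\<And>x. norm (fd F x w) \<le> B" using bounded_bounded_support[OF cont(1) R(2)] by metis
  obtain B' where B': "\<And>x. norm (fd G x w) \<le> B'" using bounded_bounded_support[OF cont(2) R'] by metis
  have L1: "(\<lambda>n. \<integral>x. of_nat (Suc n) * (F (x + v /\<^sub>R real (Suc n)) - F x) * fd G x w \<partial>lborel)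
    \<longlonglongrightarrow> (LBINT x. fd F x v * fd G x w)"
    by (rule C1c_difference_quotient_integral[OF F _ B']) measurable
  have L2: "(\<lambda>n. \<integral>x. of_nat (Suc n) * (G (x + (-v) /\<^sub>R real (Suc n)) - G x) * fd F x w \<partial>lborel)
    \<longlonglongrightarrow> (LBINT x. fd G x (-v) * fd F x w)"
    by (rule C1c_difference_quotient_integral[OF G _ B]) measurable
  have "(LBINT x. of_nat (Suc n) * (F (x + v /\<^sub>R real (Suc n)) - F x) * fd G x w)
      = - (LBINT x. of_nat (Suc n) * (G (x + (-v) /\<^sub>R real (Suc n)) - G x) * fd F x w)" for n
  proof -
    let ?h = "v /\<^sub>R real (Suc n)"
    define H where "H = (\<lambda>x. G (x + (- ?h)) + (- 1) * G x)"
    have aff: "bounded_linear (\<lambda>x::'a. x)" by (rule bounded_linear_ident)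
    have HC: "Ck (Suc 0) H"
      unfolding H_def by (intro Ck_add Ck_mult Ck_const Ck_compose_affine[OF aff] FC)
    have fdH: "fd H x w = fd G (x - ?h) w - fd G x w" for x
    proof -
      have "((\<lambda>x. G (x + (- ?h))) has_derivative (\<lambda>v. fd G (x - ?h) v)) (at x)"
        using has_derivative_compose[OF _ Ck_has_derivative[OF FC(2)], of "\<lambda>x. x + (- ?h)" "\<lambda>v. v" x UNIV]
          has_derivative_add_const[OF has_derivative_ident, of "- ?h" "at x"] by simp
      from has_derivative_diff[OF this Ck_has_derivative[OF FC(2)]]
      have "(H has_derivative (\<lambda>v. fd G (x - ?h) v - fd G x v)) (at x)"
        by (simp add: H_def)
      from frechet_derivative_at[OF this] show ?thesis by (simp add: fun_eq_iff)
    qed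
    have int1: "integrable lborel (\<lambda>x. F (x + ?h) * fd G x w)"
      using C1c_integrable_fd_mult[OF G, of "\<lambda>x. F (x + ?h)" w]
        continuous_on_compose2[OF cont(3), of UNIV "\<lambda>x. x + ?h"]
        continuous_on_add[OF continuous_on_id continuous_on_const, of UNIV ?h]
      by (simp add: mult.commute)
    have int2: "integrable lborel (\<lambda>x. F x * fd G x w)"
      using C1c_integrable_fd_mult[OF G cont(3)] by (simp add: mult.commute)
    have int3: "integrable lborel (\<lambda>x. F x * fd G (x - ?h) w)"
      using lborel_integrable_translate[OF int1, of "- ?h"] by simp
    have "(LBINT x. of_nat (Suc n) * (F (x + ?h) - F x) * fd G x w)
      = of_nat (Suc n) * (LBINT x. F (x + ?h) * fd G x w - F x * fd G x w)"
      by (simp add: algebra_simps flip: integral_mult_right_zero)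
    also have "(LBINT x. F (x + ?h) * fd G x w - F x * fd G x w)
      = (LBINT x. F (x + ?h) * fd G x w) - (LBINT x. F x * fd G x w)"
      using int1 int2 by simp
    also have "(LBINT x. F (x + ?h) * fd G x w) = (LBINT x. F x * fd G (x - ?h) w)"
      using lborel_integral_translate[of "\<lambda>x. F (x + ?h) * fd G x w" "- ?h"] by simp
    also have "\<dots> - (LBINT x. F x * fd G x w) = (LBINT x. F x * fd H x w)"
      unfolding fdH using int2 int3 by (simp add: algebra_simps)
    also have "\<dots> = - (LBINT x. fd F x w * H x)"
      using integral_by_parts_C1c[OF F HC] by simp
    finally show ?thesis
      by (simp add: H_def algebra_simps flip: integral_mult_right_zero)
  qed
  with LIMSEQ_unique[OF L1, of "- (LBINT x. fd G x (-v) * fd F x w)"] tendsto_minus[OF L2]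
  have "(LBINT x. fd F x v * fd G x w) = - (LBINT x. fd G x (-v) * fd F x w)"
    by simp
  also have "\<dots> = (LBINT x. fd F x w * fd G x v)"
    using linear_neg[OF bounded_linear.linear[OF C1c_linear_fd[OF G]]] by (simp add: mult.commute)
  finally show ?thesis .
qed

section \<open>Square-integrable functions and mollification\<close>

lemma borel_measurable_fst_comp[measurable (raw)]:
  fixes h :: "'c \<Rightarrow> 'a::second_countable_topology \<times> 'b::second_countable_topology"
  assumes "h \<in> borel_measurable M"
  shows "(\<lambda>x. fst (h x)) \<in> borel_measurable M"
  by (rule borel_measurable_continuous_on[OF _ assms]) (intro continuous_intros)

lemma borel_measurable_snd_comp[measurable (raw)]:
  fixes h :: "'c \<Rightarrow> 'a::second_countable_topology \<times> 'b::second_countable_topology"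
  assumes "h \<in> borel_measurable M"
  shows "(\<lambda>x. snd (h x)) \<in> borel_measurable M"
  by (rule borel_measurable_continuous_on[OF _ assms]) (intro continuous_intros)

text \<open>The square of the \<open>L\<^sup>2\<close> norm, with values in the extended nonnegative reals: estimates then need
  no integrability side conditions. The triangle inequality is used in the form
  $\|f+g\|^2 \le 2\|f\|^2 + 2\|g\|^2$.\<close>

definition sqL2 :: "('a::euclidean_space \<Rightarrow> 'b::real_normed_vector) \<Rightarrow> ennreal" where
  "sqL2 f = (\<integral>\<^sup>+ x. ennreal ((norm (f x))\<^sup>2) \<partial>lborel)"

lemma norm_add_sq_le: "(norm (a + b))\<^sup>2 \<le> 2 * (norm a)\<^sup>2 + 2 * (norm (b::'b::real_normed_vector))\<^sup>2"
proof -
  have "(norm (a + b))\<^sup>2 \<le> (norm a + norm b)\<^sup>2"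
    by (intro power_mono norm_triangle_ineq) auto
  also have "\<dots> \<le> 2 * (norm a)\<^sup>2 + 2 * (norm b)\<^sup>2"
    using sum_squares_bound[of "norm a" "norm b"] by (simp add: power2_sum)
  finally show ?thesis .
qed

lemma sqL2_add:
  fixes f g :: "'a::euclidean_space \<Rightarrow> 'b::euclidean_space"
  assumes [measurable]: "f \<in> borel_measurable borel" "g \<in> borel_measurable borel"
  shows "sqL2 (\<lambda>x. f x + g x) \<le> 2 * sqL2 f + 2 * sqL2 g"
proof -
  have "sqL2 (\<lambda>x. f x + g x) \<le> (\<integral>\<^sup>+ x. 2 * ennreal ((norm (f x))\<^sup>2) + 2 * ennreal ((norm (g x))\<^sup>2) \<partial>lborel)"
    unfolding sqL2_def
  proof (rule nn_integral_mono)
    fix x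
    have "ennreal ((norm (f x + g x))\<^sup>2) \<le> ennreal (2 * (norm (f x))\<^sup>2 + 2 * (norm (g x))\<^sup>2)"
      by (intro ennreal_leI norm_add_sq_le)
    then show "ennreal ((norm (f x + g x))\<^sup>2) \<le> 2 * ennreal ((norm (f x))\<^sup>2) + 2 * ennreal ((norm (g x))\<^sup>2)"
      by (simp add: ennreal_plus ennreal_mult)
  qed
  also have "\<dots> = 2 * sqL2 f + 2 * sqL2 g"
    unfolding sqL2_def by (subst nn_integral_add) (auto simp: nn_integral_cmult)
  finally show ?thesis .
qed

lemma sqL2_mono: "(\<And>x. norm (f x) \<le> norm (g x)) \<Longrightarrow> sqL2 f \<le> sqL2 g"
  unfolding sqL2_def by (intro nn_integral_mono ennreal_leI power_mono) auto

lemma sqL2_minus_commute: "sqL2 (\<lambda>x. f x - g x) = sqL2 (\<lambda>x. g x - f x)"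
  by (simp add: sqL2_def norm_minus_commute)

lemma sqL2_diff_triangle:
  fixes f g h :: "'a::euclidean_space \<Rightarrow> 'b::euclidean_space"
  assumes [measurable]: "f \<in> borel_measurable borel" "g \<in> borel_measurable borel" "h \<in> borel_measurable borel"
  shows "sqL2 (\<lambda>x. f x - h x) \<le> 2 * sqL2 (\<lambda>x. f x - g x) + 2 * sqL2 (\<lambda>x. g x - h x)"
  using sqL2_add[of "\<lambda>x. f x - g x" "\<lambda>x. g x - h x"] by simp

lemma sqL2_dominated_convergence:
  fixes u :: "nat \<Rightarrow> 'a::euclidean_space \<Rightarrow> 'b::euclidean_space"
  assumes [measurable]: "\<And>i. u i \<in> borel_measurable borel" "w \<in> borel_measurable borel"
    and bound: "\<And>j x. norm (u j x) \<le> w x"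
    and w: "sqL2 w < \<infinity>"
    and lim: "AE x in lborel. (\<lambda>i. u i x) \<longlonglongrightarrow> 0"
  shows "(\<lambda>i. sqL2 (u i)) \<longlonglongrightarrow> 0"
proof -
  have "(\<lambda>i. \<integral>\<^sup>+ x. ennreal ((norm (u i x))\<^sup>2) \<partial>lborel) \<longlonglongrightarrow> (\<integral>\<^sup>+ x. 0 \<partial>(lborel :: 'a measure))"
  proof (rule nn_integral_dominated_convergence[where w = "\<lambda>x. ennreal ((norm (w x))\<^sup>2)"])
    show "(\<integral>\<^sup>+ x. ennreal ((norm (w x))\<^sup>2) \<partial>lborel) < \<infinity>" using w by (simp add: sqL2_def)
    show "AE x in lborel. ennreal ((norm (u j x))\<^sup>2) \<le> ennreal ((norm (w x))\<^sup>2)" for j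
      by (intro AE_I2 ennreal_leI power_mono order.trans[OF bound]) auto
    show "AE x in lborel. (\<lambda>i. ennreal ((norm (u i x))\<^sup>2)) \<longlonglongrightarrow> 0"
      using lim
    proof eventually_elim
      case (elim x)
      then have "(\<lambda>i. (norm (u i x))\<^sup>2) \<longlonglongrightarrow> (norm (0::'b))\<^sup>2" by (intro tendsto_intros)
      then have "(\<lambda>i. ennreal ((norm (u i x))\<^sup>2)) \<longlonglongrightarrow> ennreal ((norm (0::'b))\<^sup>2)"
        by (rule tendsto_ennrealI)
      then show ?case by simp
    qed
  qed auto
  then show ?thesis by (simp add: sqL2_def)
qed

lemma sqL2_bounded_support_finite:
  assumes "\<And>x. norm (f x) \<le> M" "\<And>x::'a::euclidean_space. R < norm x \<Longrightarrow> f x = 0"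
  shows "sqL2 f < \<infinity>"
proof -
  have "sqL2 f \<le> (\<integral>\<^sup>+ x. ennreal (M\<^sup>2) * indicator (cball (0::'a) R) x \<partial>lborel)"
    unfolding sqL2_def
  proof (rule nn_integral_mono)
    fix x :: 'a
    show "ennreal ((norm (f x))\<^sup>2) \<le> ennreal (M\<^sup>2) * indicator (cball 0 R) x"
      using assms(2)[of x] assms(1)[of x]
      by (cases "norm x \<le> R") (auto intro!: ennreal_leI power_mono)
  qed
  also have "\<dots> = ennreal (M\<^sup>2) * emeasure lborel (cball (0::'a) R)"
    by (rule nn_integral_cmult_indicator) auto
  also have "\<dots> < \<infinity>"
    using emeasure_lborel_cball_finite[of "0::'a" R] by (simp add: ennreal_mult_less_top)
  finally show ?thesis .
qed

lemma lebesgue_measurable_continuous_limit: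
  fixes f :: "'a::euclidean_space \<Rightarrow> 'b::euclidean_space"
  assumes "f \<in> borel_measurable lebesgue"
  obtains g :: "nat \<Rightarrow> 'a \<Rightarrow> 'b" where "\<And>n. continuous_on UNIV (g n)"
    "AE x in lebesgue. (\<lambda>n. g n x) \<longlonglongrightarrow> f x"
proof -
  have "f measurable_on UNIV"
    using assms by (intro lebesgue_measurable_imp_measurable_on) auto
  then obtain N g where N: "negligible N" and g: "\<And>n. continuous_on UNIV (g n)"
    "\<And>x. x \<notin> N \<Longrightarrow> (\<lambda>n. g n x) \<longlonglongrightarrow> f x"
    unfolding measurable_on_def by auto
  have "N \<in> null_sets lebesgue" using N negligible_iff_null_sets by blast
  then have "AE x in lebesgue. (\<lambda>n. g n x) \<longlonglongrightarrow> f x"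
    using AE_not_in[of N lebesgue] g(2) by (auto elim!: eventually_mono)
  with g(1) that show ?thesis by blast
qed

text \<open>Tonelli's theorem for convolutions needs measurability with respect to a product of Borel
  algebras, so Lebesgue measurable functions are replaced by Borel representatives.\<close>

lemma lebesgue_borel_representative:
  fixes f :: "'a::euclidean_space \<Rightarrow> 'b::euclidean_space"
  assumes "f \<in> borel_measurable lebesgue"
  obtains f' where "f' \<in> borel_measurable borel" "AE x in lebesgue. f x = f' x"
proof -
  obtain g :: "nat \<Rightarrow> 'a \<Rightarrow> 'b" where g: "\<And>n. continuous_on UNIV (g n)"
    "AE x in lebesgue. (\<lambda>n. g n x) \<longlonglongrightarrow> f x"
    using lebesgue_measurable_continuous_limit[OF assms] by metis
  have "AE x in lborel. (\<lambda>n. g n x) \<longlonglongrightarrow> f x" using g(2) by (simp add: AE_completion_iff)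
  then obtain N where N: "N \<in> null_sets lborel" "{x \<in> space lborel. \<not> (\<lambda>n. g n x) \<longlonglongrightarrow> f x} \<subseteq> N"
    by (auto simp: eventually_ae_filter)
  note N' = N(1)[THEN null_setsD2, simplified]
  define f' where "f' x = (if x \<in> N then 0 else f x)" for x
  have "f' \<in> borel_measurable borel"
  proof (rule borel_measurable_LIMSEQ_metric)
    have [measurable]: "g n \<in> borel_measurable borel" "N \<in> sets borel" for n
      using g(1) borel_measurable_continuous N' by auto
    show "(\<lambda>x. if x \<in> N then 0 else g n x) \<in> borel_measurable borel" for n by measurable
    show "(\<lambda>n. if x \<in> N then 0 else g n x) \<longlonglongrightarrow> f' x" for x
      using N(2) by (cases "x \<in> N") (auto simp: f'_def)
  qed
  moreover have "AE x in lborel. f x = f' x"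
    using AE_not_in[OF N(1)] by (auto simp: f'_def elim!: eventually_mono)
  then have "AE x in lebesgue. f x = f' x" by (rule AE_completion)
  ultimately show ?thesis using that by blast
qed

lemma ennreal_add_lt_quarters:
  assumes "a < ennreal (e / 4)" "b < ennreal (e / 4)"
  shows "2 * a + 2 * b < ennreal e"
proof -
  obtain a' b' where ab: "a = ennreal a'" "b = ennreal b'" "0 \<le> a'" "0 \<le> b'"
    using assms by (cases a; cases b) auto
  have "2 * a + 2 * b = ennreal (2 * a' + 2 * b')"
    using ab by (simp add: ennreal_mult)
  also have "\<dots> < ennreal e"
    using assms ab by (intro ennreal_lessI) (auto simp: ennreal_less_iff)
  finally show ?thesis .
qed

lemma tendsto_0_ex_less:
  fixes u :: "nat \<Rightarrow> ennreal"
  assumes "u \<longlonglongrightarrow> 0" "0 < e"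
  shows "\<exists>n. u n < e"
proof -
  have "eventually (\<lambda>n. u n < e) sequentially"
    using assms by (rule order_tendstoD(2))
  then show ?thesis
    by (meson eventually_happens' sequentially_bot)
qed

text \<open>Truncating \<open>f\<close> in range and domain is harmless by dominated convergence. The truncated function
  is an almost everywhere limit of continuous functions, and applying the same (continuous)
  truncation to these makes dominated convergence available again.\<close>

lemma sqL2_approx_continuous:
  fixes f :: "'a::euclidean_space \<Rightarrow> 'b::euclidean_space"
  assumes f[measurable]: "f \<in> borel_measurable borel" and fin: "sqL2 f < \<infinity>" and "(e::real) > 0"
  obtains g R where "continuous_on UNIV g" "\<And>x. R < norm x \<Longrightarrow> g x = 0" "sqL2 (\<lambda>x. f x - g x) < ennreal e"
proof -
  \<comment> \<open>a cutoff in the domain, and the nearest point retraction onto a ball in the range\<close>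
  define c where "c m x = max 0 (min 1 (real m + 1 - norm x))" for m and x :: 'a
  define P where "P m = closest_point (cball (0::'b) (real m))" for m
  have c01: "0 \<le> c m x" "c m x \<le> 1" for m x by (auto simp: c_def)
  have c0: "c m x = 0" if "real m + 1 < norm x" for m x using that by (simp add: c_def)
  have c1: "c m x = 1" if "norm x \<le> real m" for m x using that by (simp add: c_def)
  have ccont: "continuous_on UNIV (c m)" for m unfolding c_def by (intro continuous_intros)
  have Pcont: "continuous_on UNIV (P m)" for m unfolding P_def by (intro continuous_on_closest_point) auto
  have Pm: "norm (P m y) \<le> real m" for m y
    using closest_point_in_set[of "cball (0::'b) (real m)" y] by (auto simp: P_def)
  have Pid: "P m y = y" if "norm y \<le> real m" for m y
    unfolding P_def using that by (intro closest_point_self) auto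
  have Ple: "norm (P m y) \<le> norm y" for m y
    using closest_point_lipschitz[of "cball (0::'b) (real m)" y 0] Pid[of 0 m] by (auto simp: P_def)
  have [measurable]: "c m \<in> borel_measurable borel" "P m \<in> borel_measurable borel" for m
    using ccont Pcont borel_measurable_continuous by auto
  define fm where "fm m x = c m x *\<^sub>R P m (f x)" for m x
  have fm_meas[measurable]: "fm m \<in> borel_measurable borel" for m unfolding fm_def by measurable
  have fmle: "norm (fm m x) \<le> norm (f x)" for m x
  proof -
    have "norm (fm m x) \<le> 1 * norm (f x)"
      unfolding fm_def norm_scaleR by (intro mult_mono Ple) (use c01 in auto)
    then show ?thesis by simp
  qed
  have "(\<lambda>m. sqL2 (\<lambda>x. f x - fm m x)) \<longlonglongrightarrow> 0"
  proof (rule sqL2_dominated_convergence[where w = "\<lambda>x. norm (f x) + norm (f x)"])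
    show "norm (f x - fm m x) \<le> norm (f x) + norm (f x)" for m x
      using norm_triangle_ineq4[of "f x" "fm m x"] fmle[of m x] by linarith
    have "sqL2 (\<lambda>x. norm (f x) + norm (f x)) \<le> 2 * sqL2 (\<lambda>x. norm (f x)) + 2 * sqL2 (\<lambda>x. norm (f x))"
      by (rule sqL2_add) measurable
    also have "\<dots> < \<infinity>" using fin by (simp add: sqL2_def ennreal_mult_less_top)
    finally show "sqL2 (\<lambda>x. norm (f x) + norm (f x)) < \<infinity>" .
    show "AE x in lborel. (\<lambda>m. f x - fm m x) \<longlonglongrightarrow> 0"
    proof (rule AE_I2)
      fix x
      obtain M where M: "max (norm x) (norm (f x)) \<le> real M" using real_arch_simple by blast
      have "f x - fm m x = 0" if "m \<ge> M" for m
      proof -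
        have "norm x \<le> real m" "norm (f x) \<le> real m" using M of_nat_mono[OF that, where 'a = real] by linarith+
        then show ?thesis by (simp add: fm_def c1 Pid)
      qed
      then show "(\<lambda>m. f x - fm m x) \<longlonglongrightarrow> 0"
        by (intro tendsto_eventually eventually_sequentiallyI)
    qed
  qed measurable
  moreover have e4: "ennreal (e / 4) > 0" using \<open>e > 0\<close> by simp
  ultimately obtain m where m: "sqL2 (\<lambda>x. f x - fm m x) < ennreal (e / 4)"
    using tendsto_0_ex_less by fast
  have "f \<in> borel_measurable lebesgue" by (rule measurable_completion) simp
  from lebesgue_measurable_continuous_limit[OF this]
  obtain g :: "nat \<Rightarrow> 'a \<Rightarrow> 'b" where g: "\<And>n. continuous_on UNIV (g n)"
    "AE x in lebesgue. (\<lambda>n. g n x) \<longlonglongrightarrow> f x" by metis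
  define gm where "gm n x = c m x *\<^sub>R P m (g n x)" for n x
  have gm_cont: "continuous_on UNIV (gm n)" for n
    unfolding gm_def using continuous_on_compose2[OF Pcont g(1)] by (intro continuous_on_scaleR ccont) simp
  then have gm_meas[measurable]: "gm n \<in> borel_measurable borel" for n using borel_measurable_continuous by blast
  define w where "w x = (2 * real m) * indicator (cball 0 (real m + 1)) x" for x :: 'a
  have "(\<lambda>n. sqL2 (\<lambda>x. fm m x - gm n x)) \<longlonglongrightarrow> 0"
  proof (rule sqL2_dominated_convergence[where w = w])
    show "w \<in> borel_measurable borel" unfolding w_def
      by (intro borel_measurable_times borel_measurable_const borel_measurable_indicator) simp
    show "sqL2 w < \<infinity>" by (rule sqL2_bounded_support_finite[where M = "2 * real m" and R = "real m + 1"])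
        (auto simp: w_def indicator_def)
    show "norm (fm m x - gm n x) \<le> w x" for n x
    proof (cases "norm x \<le> real m + 1")
      case True
      have "norm (fm m x - gm n x) = c m x * norm (P m (f x) - P m (g n x))"
        using c01 by (simp add: fm_def gm_def flip: scaleR_diff_right)
      also have "\<dots> \<le> 1 * (real m + real m)"
        by (intro mult_mono order.trans[OF norm_triangle_ineq4] add_mono Pm c01) auto
      finally show ?thesis using True by (simp add: w_def)
    qed (simp add: fm_def gm_def w_def c0)
    show "AE x in lborel. (\<lambda>n. fm m x - gm n x) \<longlonglongrightarrow> 0"
      using g(2) unfolding AE_completion_iff
    proof eventually_elim
      case (elim x)
      have "isCont (P m) (f x)" using Pcont by (simp add: continuous_on_eq_continuous_at)
      from isCont_tendsto_compose[OF this elim]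
      have "(\<lambda>n. fm m x - gm n x) \<longlonglongrightarrow> fm m x - c m x *\<^sub>R P m (f x)"
        unfolding gm_def by (intro tendsto_intros)
      then show ?case by (simp add: fm_def)
    qed
  qed measurable
  then obtain n where n: "sqL2 (\<lambda>x. fm m x - gm n x) < ennreal (e / 4)"
    using tendsto_0_ex_less[OF _ e4] by fast
  have "sqL2 (\<lambda>x. f x - gm n x) \<le> 2 * sqL2 (\<lambda>x. f x - fm m x) + 2 * sqL2 (\<lambda>x. fm m x - gm n x)"
    by (rule sqL2_diff_triangle) measurable
  also have "\<dots> < ennreal e" by (rule ennreal_add_lt_quarters[OF m n])
  finally have "sqL2 (\<lambda>x. f x - gm n x) < ennreal e" .
  moreover have "gm n x = 0" if "real m + 1 < norm x" for x using that by (simp add: gm_def c0)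
  ultimately show ?thesis using that[OF gm_cont, of "real m + 1" n] by simp
qed

text \<open>This is Jensen's inequality for the square; here it follows from the Cauchy-Schwarz inequality
  for the factorization $|g| k = (|g| \sqrt k) \sqrt k$.\<close>

lemma norm_average_sq_le:
  fixes g :: "'a::euclidean_space \<Rightarrow> complex"
  assumes [measurable]: "g \<in> borel_measurable borel" "k \<in> borel_measurable borel"
    and k: "\<And>y. 0 \<le> k y" "(\<integral>\<^sup>+ y. ennreal (k y) \<partial>lborel) = 1"
  shows "ennreal ((norm (LBINT y. g y * of_real (k y)))\<^sup>2)
    \<le> (\<integral>\<^sup>+ y. ennreal ((norm (g y))\<^sup>2) * ennreal (k y) \<partial>lborel)"
proof -
  have *: "ennreal (norm (LBINT y. g y * of_real (k y))) \<le> (\<integral>\<^sup>+ y. ennreal (norm (g y) * sqrt (k y)) * ennreal (sqrt (k y)) \<partial>lborel)"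
  proof (cases "integrable lborel (\<lambda>y. g y * complex_of_real (k y))")
    case True
    from integral_norm_bound_ennreal[OF this]
    have "ennreal (norm (LBINT y. g y * of_real (k y))) \<le> (\<integral>\<^sup>+ y. ennreal (norm (g y * of_real (k y))) \<partial>lborel)" .
    also have "\<dots> = (\<integral>\<^sup>+ y. ennreal (norm (g y) * sqrt (k y)) * ennreal (sqrt (k y)) \<partial>lborel)"
    proof (rule nn_integral_cong)
      fix y
      have "norm (g y * of_real (k y)) = (norm (g y) * sqrt (k y)) * sqrt (k y)"
        using k(1)[of y] real_sqrt_mult_self[of "k y"] by (simp add: norm_mult mult.assoc del: real_sqrt_mult_self)
      then show "ennreal (norm (g y * of_real (k y))) = ennreal (norm (g y) * sqrt (k y)) * ennreal (sqrt (k y))"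
        using k(1)[of y] by (simp only: ennreal_mult mult_nonneg_nonneg norm_ge_zero real_sqrt_ge_zero)
    qed
    finally show ?thesis .
  qed (simp add: not_integrable_integral_eq)
  have "ennreal ((norm (LBINT y. g y * of_real (k y)))\<^sup>2) = (ennreal (norm (LBINT y. g y * of_real (k y))))\<^sup>2"
    by (simp add: ennreal_power)
  also have "\<dots> \<le> (\<integral>\<^sup>+ y. ennreal (norm (g y) * sqrt (k y)) * ennreal (sqrt (k y)) \<partial>lborel)\<^sup>2"
    by (intro power_mono *) auto
  also have "\<dots> \<le> (\<integral>\<^sup>+ y. (ennreal (norm (g y) * sqrt (k y)))\<^sup>2 \<partial>lborel) * (\<integral>\<^sup>+ y. (ennreal (sqrt (k y)))\<^sup>2 \<partial>lborel)"
    by (rule Cauchy_Schwarz_nn_integral) measurable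
  also have "(\<integral>\<^sup>+ y. (ennreal (sqrt (k y)))\<^sup>2 \<partial>lborel) = 1"
    using k by (simp add: ennreal_power)
  also have "(\<integral>\<^sup>+ y. (ennreal (norm (g y) * sqrt (k y)))\<^sup>2 \<partial>lborel)
      = (\<integral>\<^sup>+ y. ennreal ((norm (g y))\<^sup>2) * ennreal (k y) \<partial>lborel)"
  proof (rule nn_integral_cong)
    fix y
    have "(norm (g y) * sqrt (k y))\<^sup>2 = (norm (g y))\<^sup>2 * k y"
      using k(1)[of y] by (simp add: power_mult_distrib)
    then show "(ennreal (norm (g y) * sqrt (k y)))\<^sup>2 = ennreal ((norm (g y))\<^sup>2) * ennreal (k y)"
      using k(1)[of y] by (subst ennreal_power) (simp_all add: ennreal_mult)
  qed
  finally show ?thesis by simp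
qed

lemma L2_mult_integrable:
  fixes f g :: "'a::euclidean_space \<Rightarrow> complex"
  assumes [measurable]: "f \<in> borel_measurable borel" "g \<in> borel_measurable borel"
    and "sqL2 f < \<infinity>" "sqL2 g < \<infinity>"
  shows "integrable lborel (\<lambda>x. f x * g x)"
proof (rule integrableI_bounded)
  have "(\<integral>\<^sup>+ x. ennreal (norm (f x * g x)) \<partial>lborel) \<le> (\<integral>\<^sup>+ x. ennreal ((norm (f x))\<^sup>2) + ennreal ((norm (g x))\<^sup>2) \<partial>lborel)"
  proof (rule nn_integral_mono)
    fix x
    have "norm (f x * g x) \<le> (norm (f x))\<^sup>2 + (norm (g x))\<^sup>2"
      using sum_squares_bound[of "norm (f x)" "norm (g x)"] mult_nonneg_nonneg[OF norm_ge_zero[of "f x"] norm_ge_zero[of "g x"]]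
      unfolding norm_mult by linarith
    from ennreal_leI[OF this] show "ennreal (norm (f x * g x)) \<le> ennreal ((norm (f x))\<^sup>2) + ennreal ((norm (g x))\<^sup>2)"
      by simp
  qed
  also have "\<dots> = sqL2 f + sqL2 g" unfolding sqL2_def by (rule nn_integral_add) auto
  also have "\<dots> < \<infinity>" using assms by simp
  finally show "(\<integral>\<^sup>+ x. ennreal (norm (f x * g x)) \<partial>lborel) < \<infinity>" .
qed measurable

definition convolve :: "('a::euclidean_space \<Rightarrow> complex) \<Rightarrow> ('a \<Rightarrow> complex) \<Rightarrow> 'a \<Rightarrow> complex" where
  "convolve \<phi> f x = (LBINT u. f u * \<phi> (x - u))"

lemma convolve_integrable:
  fixes f :: "'a::euclidean_space \<Rightarrow> complex"
  assumes f: "integrable lborel f" and c: "continuous_on UNIV \<psi>" and s: "\<And>x. R < norm x \<Longrightarrow> \<psi> x = 0"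
  shows "integrable lborel (\<lambda>u. f u * \<psi> (y - u))"
proof -
  have [measurable]: "f \<in> borel_measurable borel" using f by auto
  have [measurable]: "\<psi> \<in> borel_measurable borel" using c borel_measurable_continuous by blast
  obtain B where B: "B > 0" "\<And>x. norm (\<psi> x) \<le> B" using bounded_bounded_support[OF c s] by metis
  show ?thesis
    by (rule Bochner_Integration.integrable_bound[of _ "\<lambda>u. B *\<^sub>R f u"])
      (use f B in \<open>auto simp: norm_mult mult.commute[of B] intro!: mult_left_mono\<close>)
qed

text \<open>The error of the linear approximation of \<open>\<phi>\<close> is uniform in the base point, hence it is
  multiplied only by the \<open>L\<^sup>1\<close> norm of \<open>f\<close> when it is integrated.\<close>

lemma convolve_has_derivative:
  fixes f :: "'a::euclidean_space \<Rightarrow> complex"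
  assumes f: "integrable lborel f" and \<phi>: "C1c \<phi>"
  shows "(convolve \<phi> f has_derivative (\<lambda>v. convolve (\<lambda>y. fd \<phi> y v) f x)) (at x)"
proof -
  obtain R where R: "\<And>x. R < norm x \<Longrightarrow> \<phi> x = 0" "\<And>x v. R < norm x \<Longrightarrow> fd \<phi> x v = 0" using C1cE[OF \<phi>] by metis
  note int\<phi> = convolve_integrable[OF f C1c_continuous[OF \<phi>] R(1)]
  note intd = convolve_integrable[OF f C1c_fd_continuous[OF \<phi>] R(2)]
  have lin: "linear (fd \<phi> y)" for y using C1c_linear_fd[OF \<phi>] bounded_linear.linear by blast
  define N where "N = (LBINT u. norm (f u))"
  have "N \<ge> 0" by (simp add: N_def)
  show ?thesis
  proof (rule has_derivativeI)
    have "linear (\<lambda>v. convolve (\<lambda>y. fd \<phi> y v) f x)"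
    proof (rule linearI)
      show "convolve (\<lambda>y. fd \<phi> y (v + w)) f x = convolve (\<lambda>y. fd \<phi> y v) f x + convolve (\<lambda>y. fd \<phi> y w) f x" for v w
        unfolding convolve_def linear_add[OF lin] distrib_left
        by (rule Bochner_Integration.integral_add[OF intd intd])
      show "convolve (\<lambda>y. fd \<phi> y (r *\<^sub>R v)) f x = r *\<^sub>R convolve (\<lambda>y. fd \<phi> y v) f x" for r v
        unfolding convolve_def linear_scale[OF lin] mult_scaleR_right
        by simp
    qed
    then show "bounded_linear (\<lambda>v. convolve (\<lambda>y. fd \<phi> y v) f x)"
      by (simp add: linear_conv_bounded_linear)
    show "((\<lambda>y. (convolve \<phi> f y - convolve \<phi> f x - convolve (\<lambda>z. fd \<phi> z (y - x)) f x) /\<^sub>R norm (y - x)) \<longlongrightarrow> 0) (at x)"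
    proof (rule LIM_I)
      fix e :: real assume "e > 0"
      then have "e / (N + 1) > 0" using \<open>N \<ge> 0\<close> by simp
      from C1c_uniformly_differentiable[OF \<phi> this] obtain d where d: "d > 0"
        "\<And>x h. norm h < d \<Longrightarrow> norm (\<phi> (x + h) - \<phi> x - fd \<phi> x h) \<le> e / (N + 1) * norm h" by metis
      have "norm ((convolve \<phi> f y - convolve \<phi> f x - convolve (\<lambda>z. fd \<phi> z (y - x)) f x) /\<^sub>R norm (y - x) - 0) < e"
        if y: "y \<noteq> x \<and> norm (y - x) < d" for y
      proof -
        let ?h = "y - x"
        have eq: "convolve \<phi> f y - convolve \<phi> f x - convolve (\<lambda>z. fd \<phi> z ?h) f x
            = (LBINT u. f u * \<phi> (y - u) - f u * \<phi> (x - u) - f u * fd \<phi> (x - u) ?h)"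
          unfolding convolve_def
          by (simp only: Bochner_Integration.integral_diff Bochner_Integration.integrable_diff int\<phi> intd)
        have "norm (convolve \<phi> f y - convolve \<phi> f x - convolve (\<lambda>z. fd \<phi> z ?h) f x)
            \<le> (LBINT u. e / (N + 1) * norm ?h * norm (f u))"
          unfolding eq
        proof (rule Bochner_Integration.integral_norm_bound_integral)
          show "integrable lborel (\<lambda>u. f u * \<phi> (y - u) - f u * \<phi> (x - u) - f u * fd \<phi> (x - u) ?h)"
            by (intro Bochner_Integration.integrable_diff int\<phi> intd)
          show "integrable lborel (\<lambda>u. e / (N + 1) * norm ?h * norm (f u))"
            using f by simp
          fix u
          have "norm (f u * \<phi> (y - u) - f u * \<phi> (x - u) - f u * fd \<phi> (x - u) ?h)
              = norm (f u) * norm (\<phi> ((x - u) + ?h) - \<phi> (x - u) - fd \<phi> (x - u) ?h)"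
            by (simp flip: norm_mult add: algebra_simps)
          also have "\<dots> \<le> norm (f u) * (e / (N + 1) * norm ?h)"
            using y by (intro mult_left_mono d(2)) auto
          finally show "norm (f u * \<phi> (y - u) - f u * \<phi> (x - u) - f u * fd \<phi> (x - u) ?h) \<le> e / (N + 1) * norm ?h * norm (f u)"
            by (simp add: mult_ac)
        qed
        also have "\<dots> = norm ?h * (e / (N + 1) * N)" by (simp add: N_def)
        finally have "norm ((convolve \<phi> f y - convolve \<phi> f x - convolve (\<lambda>z. fd \<phi> z ?h) f x) /\<^sub>R norm ?h) \<le> e / (N + 1) * N"
          using y by (simp add: divide_le_eq mult.commute flip: divide_inverse_commute)
        also have "\<dots> < e" using \<open>N \<ge> 0\<close> \<open>e > 0\<close> by (simp add: field_simps)
        finally show ?thesis by simp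
      qed
      with d(1) show "\<exists>s>0. \<forall>y. y \<noteq> x \<and> norm (y - x) < s \<longrightarrow>
          norm ((convolve \<phi> f y - convolve \<phi> f x - convolve (\<lambda>z. fd \<phi> z (y - x)) f x) /\<^sub>R norm (y - x) - 0) < e"
        by blast
    qed
  qed
qed

lemma Ck_convolve:
  assumes f: "integrable lborel f"
  shows "(\<And>j. Ck j \<phi>) \<Longrightarrow> (\<And>x. R < norm x \<Longrightarrow> \<phi> x = 0) \<Longrightarrow> Ck k (convolve \<phi> f)"
proof (induction k arbitrary: \<phi> R)
  case 0
  then have "C1c \<phi>" unfolding C1c_def by blast
  from has_derivative_continuous[OF convolve_has_derivative[OF f this]] show ?case
    unfolding Ck.simps(1) by (intro continuous_at_imp_continuous_on ballI)
next
  case (Suc k)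
  then have C: "C1c \<phi>" unfolding C1c_def by blast
  then obtain R' where R': "\<And>x v. R' < norm x \<Longrightarrow> fd \<phi> x v = 0" using C1cE by metis
  show ?case
  proof (rule CkI[OF convolve_has_derivative[OF f C]])
    fix v
    have "Ck j (\<lambda>y. fd \<phi> y v)" for j using Suc.prems(1)[of "Suc j"] by simp
    then show "Ck k (convolve (\<lambda>y. fd \<phi> y v) f)" by (rule Suc.IH[OF _ R'])
  qed
qed

lemma lborel_integral_reflect:
  fixes f :: "'a::euclidean_space \<Rightarrow> 'b::{banach, second_countable_topology}"
  assumes [measurable]: "f \<in> borel_measurable borel"
  shows "(LBINT u. f u) = (LBINT y. f (a - y))"
proof -
  have "(LBINT u. f u) = (\<integral>u. f u \<partial>density (distr lborel borel (\<lambda>x::'a. a + (- 1) *\<^sub>R x)) (\<lambda>_. 1))"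
    using lborel_affine[of "- 1" a] by simp
  also have "\<dots> = (LBINT y. f (a - y))"
    by (simp add: density_1 integral_distr)
  finally show ?thesis .
qed

lemma convolve_alt:
  assumes [measurable]: "f \<in> borel_measurable borel" "\<phi> \<in> borel_measurable borel"
  shows "convolve \<phi> f x = (LBINT y. f (x - y) * \<phi> y)"
  unfolding convolve_def by (subst lborel_integral_reflect[where a = x]) simp_all

text \<open>The function $\exp(-1/(\tau^2 - |y|^2))$ on the ball of radius \<open>\<tau>\<close>, normalized.\<close>

lemma mollifier_exists:
  assumes "\<tau> > 0"
  obtains k :: "'a::euclidean_space \<Rightarrow> real" where
    "\<And>y. 0 \<le> k y" "\<And>y. \<tau> < norm y \<Longrightarrow> k y = 0" "(\<integral>\<^sup>+ y. ennreal (k y) \<partial>lborel) = 1"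
    "\<And>j. Ck j (\<lambda>y. complex_of_real (k y))"
proof -
  define q where "q y = \<tau>\<^sup>2 - y \<bullet> y" for y :: 'a
  define b where "b y = flat 0 (q y)" for y
  have qd: "(q has_derivative (\<lambda>v. - (2 * (x \<bullet> v)))) (at x)" for x
    unfolding q_def by (auto intro!: derivative_eq_intros simp: inner_commute)
  have Cb: "Ck j (\<lambda>y. complex_of_real (b y))" for j
    unfolding b_def
  proof (rule Ck_flat_compose[OF qd])
    fix v :: 'a and j
    have "bounded_linear (\<lambda>x. - 2 * (x \<bullet> v))"
      by (rule bounded_linear_const_mult[OF bounded_linear_inner_left])
    from bounded_linear_compose[OF bounded_linear_of_real this]
    have "bounded_linear (\<lambda>x. complex_of_real (- (2 * (x \<bullet> v))))" by simp
    then show "Ck j (\<lambda>x. complex_of_real (- (2 * (x \<bullet> v))))" by (rule Ck_linear)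
  qed
  have b0: "b y = 0" if "\<tau> < norm y" for y
  proof -
    have "\<tau>\<^sup>2 \<le> (norm y)\<^sup>2" using that assms by (intro power_mono) auto
    then show ?thesis by (simp add: b_def q_def flat_def dot_square_norm)
  qed
  have bpos: "b y > 0" if "norm y < \<tau>" for y
  proof -
    have "(norm y)\<^sup>2 < \<tau>\<^sup>2" using that by (intro power_strict_mono) auto
    then show ?thesis by (simp add: b_def q_def flat_def dot_square_norm)
  qed
  have bnn: "b y \<ge> 0" for y by (simp add: b_def flat_nonneg)
  have "continuous_on UNIV (\<lambda>y. Re (complex_of_real (b y)))"
    using Cb[of 0] by (intro continuous_intros) simp
  then have bc: "continuous_on UNIV b" by simp
  then have [measurable]: "b \<in> borel_measurable borel" using borel_measurable_continuous by blast
  obtain B where B: "\<And>y. norm (b y) \<le> B" using bounded_bounded_support[OF bc b0] by metis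
  have int: "integrable lborel b" by (rule integrable_bounded_support[OF _ B b0]) measurable
  define I where "I = (LBINT y. b y)"
  have "I \<noteq> 0"
  proof
    assume "I = 0"
    then have "AE y in lborel. b y = 0"
      using integral_nonneg_eq_0_iff_AE[OF int] bnn by (auto simp: I_def)
    then have "AE y in lborel. y \<notin> ball (0::'a) \<tau>"
    proof eventually_elim
      case (elim y)
      then show ?case using bpos[of y] by auto
    qed
    then have "emeasure lborel (ball (0::'a) \<tau>) = 0"
      by (subst (asm) AE_iff_measurable[of "ball 0 \<tau>"]) auto
    then have "negligible (ball (0::'a) \<tau>)"
      unfolding negligible_iff_null_sets by (intro null_sets_completionI) (auto simp: null_sets_def)
    then show False
      using open_not_negligible[of "ball (0::'a) \<tau>"] assms by simp
  qed
  then have "I > 0" using integral_nonneg_AE[of b lborel] bnn by (auto simp: I_def less_le)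
  show ?thesis
  proof (rule that[of "\<lambda>y. b y / I"])
    show "0 \<le> b y / I" for y using bnn \<open>I > 0\<close> by simp
    show "b y / I = 0" if "\<tau> < norm y" for y using b0[OF that] by simp
    have "(\<integral>\<^sup>+ y. ennreal (b y / I) \<partial>lborel) = ennreal (LBINT y. b y / I)"
      using int bnn \<open>I > 0\<close> by (intro nn_integral_eq_integral) auto
    then show "(\<integral>\<^sup>+ y. ennreal (b y / I) \<partial>lborel) = 1" using \<open>I > 0\<close> by (simp add: I_def)
    have "Ck j (\<lambda>y. complex_of_real (1 / I) * complex_of_real (b y))" for j
      by (intro Ck_mult Ck_const Cb)
    then show "Ck j (\<lambda>y. complex_of_real (b y / I))" for j by simp
  qed
qed

section \<open>Dilations of the Hartogs triangle and approximation away from the origin\<close>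

text \<open>The different exponents are essential: the factor \<open>a\<close> of \<open>w\<close> contracts the support away from
  $|w| = 1$ after composition, and the larger factor of \<open>z\<close> contracts it away from
  $|z| = |w|$.\<close>

definition dilate :: "real \<Rightarrow> C2 \<Rightarrow> C2" where
  "dilate a p = (a\<^sup>2 *\<^sub>R fst p, a *\<^sub>R snd p)"

lemma bounded_linear_dilate: "bounded_linear (dilate a)"
  unfolding dilate_def
  by (intro bounded_linear_Pair bounded_linear_compose[OF bounded_linear_scaleR_right] bounded_linear_fst bounded_linear_snd)

lemma continuous_dilate: "continuous_on UNIV (dilate a)"
  by (rule linear_continuous_on[OF bounded_linear_dilate])

lemma measurable_dilate[measurable]: "dilate a \<in> borel_measurable borel"
  by (rule borel_measurable_continuous[OF continuous_dilate])

lemma norm_prod_sq: "(norm (p :: 'a::real_normed_vector \<times> 'b::real_normed_vector))\<^sup>2 = (norm (fst p))\<^sup>2 + (norm (snd p))\<^sup>2"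
  by (cases p) (simp add: norm_Pair)

lemma norm_le_dilate:
  assumes "1 \<le> a"
  shows "norm p \<le> norm (dilate a p)"
proof -
  have "1 \<le> a\<^sup>2" using assms by simp
  then have "norm (fst p) \<le> norm (fst (dilate a p))" "norm (snd p) \<le> norm (snd (dilate a p))"
    using assms mult_right_mono[of 1 "a\<^sup>2" "norm (fst p)"] mult_right_mono[of 1 a "norm (snd p)"]
    by (auto simp: dilate_def)
  then have "(norm p)\<^sup>2 \<le> (norm (dilate a p))\<^sup>2"
    unfolding norm_prod_sq by (intro add_mono power_mono) auto
  then show ?thesis by (rule power2_le_imp_le) simp
qed

lemma norm_dilate_diff:
  assumes "1 \<le> a"
  shows "norm (dilate a p - p) \<le> (a\<^sup>2 - 1) * norm p"
proof -
  have 1: "1 \<le> a\<^sup>2" using assms by simp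
  have 2: "a \<le> a\<^sup>2" using assms by (simp add: power2_eq_square)
  have n: "norm (fst (dilate a p - p)) \<le> (a\<^sup>2 - 1) * norm (fst p)" "norm (snd (dilate a p - p)) \<le> (a\<^sup>2 - 1) * norm (snd p)"
  proof -
    have "fst (dilate a p - p) = (a\<^sup>2 - 1) *\<^sub>R fst p" "snd (dilate a p - p) = (a - 1) *\<^sub>R snd p"
      by (simp_all add: dilate_def scaleR_diff_left)
    then have "norm (fst (dilate a p - p)) = \<bar>a\<^sup>2 - 1\<bar> * norm (fst p)" "norm (snd (dilate a p - p)) = \<bar>a - 1\<bar> * norm (snd p)"
      by (simp_all only: norm_scaleR)
    moreover have "\<bar>a - 1\<bar> * norm (snd p) \<le> (a\<^sup>2 - 1) * norm (snd p)"
      using assms 2 by (intro mult_right_mono) auto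
    ultimately show "norm (fst (dilate a p - p)) \<le> (a\<^sup>2 - 1) * norm (fst p)" "norm (snd (dilate a p - p)) \<le> (a\<^sup>2 - 1) * norm (snd p)"
      using 1 by auto
  qed
  have "(norm (dilate a p - p))\<^sup>2 \<le> ((a\<^sup>2 - 1) * norm (fst p))\<^sup>2 + ((a\<^sup>2 - 1) * norm (snd p))\<^sup>2"
    unfolding norm_prod_sq[of "dilate a p - p"] by (intro add_mono power_mono n norm_ge_zero)
  also have "\<dots> = ((a\<^sup>2 - 1) * norm p)\<^sup>2"
    unfolding power_mult_distrib norm_prod_sq[of p] by (rule distrib_left[symmetric])
  finally show ?thesis using 1 by (intro power2_le_imp_le[of "norm (dilate a p - p)"]) auto
qed

text \<open>The Jacobian determinant of the dilation is at least \<open>1\<close>.\<close>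

lemma nn_integral_dilate_le:
  assumes [measurable]: "G \<in> borel_measurable borel" and a: "1 \<le> a"
  shows "(\<integral>\<^sup>+ x. G (dilate a x - y) \<partial>lborel) \<le> (\<integral>\<^sup>+ x. G x \<partial>lborel)"
proof -
  define c where "c j = (if fst j \<noteq> 0 then a\<^sup>2 else a)" for j :: "C2"
  have c1: "1 \<le> c j" for j using a by (simp add: c_def)
  have eq: "- y + (\<Sum>j\<in>Basis. (c j * (x \<bullet> j)) *\<^sub>R j) = dilate a x - y" for x
  proof -
    have "(\<Sum>j\<in>Basis. (c j * (x \<bullet> j)) *\<^sub>R j) = dilate a x"
    proof (rule euclidean_eqI)
      fix i :: "C2" assume i: "i \<in> Basis"
      have "(\<Sum>j\<in>Basis. (c j * (x \<bullet> j)) *\<^sub>R j) \<bullet> i = c i * (x \<bullet> i)"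
        using i by (simp add: inner_sum_left inner_Basis if_distrib cong: if_cong)
      also have "\<dots> = dilate a x \<bullet> i"
        using i by (auto simp: Basis_prod_def dilate_def c_def inner_prod_def)
      finally show "(\<Sum>j\<in>Basis. (c j * (x \<bullet> j)) *\<^sub>R j) \<bullet> i = dilate a x \<bullet> i" .
    qed
    then show ?thesis by simp
  qed
  define M where "M = (\<Prod>j\<in>(Basis::C2 set). \<bar>c j\<bar>)"
  have "1 \<le> M" unfolding M_def by (intro prod_ge_1 order.trans[OF c1 abs_ge_self])
  have lb: "lborel = density (distr lborel borel (\<lambda>x. dilate a x - y)) (\<lambda>_. ennreal M)"
  proof -
    have "c j \<noteq> 0" for j using c1[of j] by auto
    then show ?thesis using lborel_affine_euclidean[of c "- y"] unfolding eq M_def by simp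
  qed
  have "(\<integral>\<^sup>+ x. G (dilate a x - y) \<partial>lborel) = 1 * (\<integral>\<^sup>+ x. G (dilate a x - y) \<partial>lborel)" by simp
  also have "\<dots> \<le> ennreal M * (\<integral>\<^sup>+ x. G (dilate a x - y) \<partial>lborel)"
    using \<open>1 \<le> M\<close> by (intro mult_right_mono) (auto simp flip: ennreal_1 intro: ennreal_leI)
  also have "\<dots> = (\<integral>\<^sup>+ x. G x \<partial>density (distr lborel borel (\<lambda>x. dilate a x - y)) (\<lambda>_. ennreal M))"
    by (simp add: nn_integral_density nn_integral_distr nn_integral_cmult)
  also have "\<dots> = (\<integral>\<^sup>+ x. G x \<partial>lborel)" by (simp flip: lb)
  finally show ?thesis .
qed

lemma sqL2_dilate_le:
  assumes [measurable]: "f \<in> borel_measurable borel" and a: "1 \<le> a"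
  shows "sqL2 (\<lambda>x. f (dilate a x - y)) \<le> sqL2 f"
  unfolding sqL2_def using nn_integral_dilate_le[of "\<lambda>x. ennreal ((norm (f x))\<^sup>2)" a y] a by simp

text \<open>Continuity in \<open>L\<^sup>2\<close> of translations and dilations simultaneously. For continuous compactly
  supported functions it is uniform continuity; the general case follows by density, since the
  operators are contractions.\<close>

lemma sqL2_dilate_translate_small:
  fixes f :: "C2 \<Rightarrow> complex"
  assumes f[measurable]: "f \<in> borel_measurable borel" and fin: "sqL2 f < \<infinity>" and "(e::real) > 0"
  obtains r where "r > 0"
    "\<And>a y. 1 \<le> a \<Longrightarrow> a \<le> 1 + r \<Longrightarrow> norm y \<le> r \<Longrightarrow> sqL2 (\<lambda>x. f (dilate a x - y) - f x) < ennreal e"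
proof -
  have "e / 16 > 0" using \<open>e > 0\<close> by simp
  from sqL2_approx_continuous[OF f fin this] obtain g R where g: "continuous_on UNIV g"
    "\<And>x. R < norm x \<Longrightarrow> g x = 0" "sqL2 (\<lambda>x. f x - g x) < ennreal (e / 16)" by metis
  \<comment> \<open>the difference for \<open>g\<close> vanishes outside the ball of radius \<open>R'\<close>, and \<open>s\<close> is a bound for it
    whose square has integral below \<open>e / 16\<close> over that ball\<close>
  define R' where "R' = max R 0 + 1"
  have [measurable]: "g \<in> borel_measurable borel" using g(1) borel_measurable_continuous by blast
  define m where "m = measure lborel (cball (0::C2) R')"
  have "m \<ge> 0" by (simp add: m_def)
  define s where "s = sqrt (e / 16 / (m + 1))"
  have "s > 0" using \<open>e > 0\<close> \<open>m \<ge> 0\<close> by (simp add: s_def)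
  have sm: "s\<^sup>2 * m < e / 16"
  proof -
    have "s\<^sup>2 * m = e / 16 * (m / (m + 1))" using \<open>e > 0\<close> \<open>m \<ge> 0\<close> by (simp add: s_def)
    also have "\<dots> < e / 16 * 1" using \<open>e > 0\<close> \<open>m \<ge> 0\<close> by (intro mult_strict_left_mono) auto
    finally show ?thesis by simp
  qed
  have "uniformly_continuous_on UNIV g" by (rule uniformly_continuous_bounded_support[OF g(1,2)])
  then obtain d where d: "d > 0" "\<And>x y. dist y x < d \<Longrightarrow> dist (g y) (g x) < s"
    unfolding uniformly_continuous_on_def using \<open>s > 0\<close> by auto
  define r where "r = min 1 (d / (2 * (3 * R' + 1)))"
  have R'1: "R' \<ge> 1" by (simp add: R'_def)
  have "r > 0" using d(1) R'1 by (simp add: r_def)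
  have rd: "3 * r * R' + r < d"
  proof -
    have "r * (3 * R' + 1) \<le> d / (2 * (3 * R' + 1)) * (3 * R' + 1)"
      using R'1 by (intro mult_right_mono) (auto simp: r_def)
    also have "\<dots> = d / 2" using R'1 by (simp add: field_simps)
    finally show ?thesis using d(1) by (simp add: algebra_simps)
  qed
  have "sqL2 (\<lambda>x. f (dilate a x - y) - f x) < ennreal e" if a: "1 \<le> a" "a \<le> 1 + r" and y: "norm y \<le> r" for a y
  proof -
    have a2: "a\<^sup>2 - 1 \<le> 3 * r"
    proof -
      have "a\<^sup>2 \<le> (1 + r)\<^sup>2" using a by (intro power_mono) auto
      also have "\<dots> = 1 + 2 * r + r * r" by (simp add: power2_eq_square algebra_simps)
      also have "r * r \<le> 1 * r" using \<open>r > 0\<close> by (intro mult_right_mono) (auto simp: r_def)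
      finally show ?thesis by simp
    qed
    have gd: "norm (g (dilate a x - y) - g x) \<le> s * indicator (cball 0 R') x" for x
    proof (cases "norm x \<le> R'")
      case True
      have "dist (dilate a x - y) x \<le> norm (dilate a x - x) + norm y"
        using norm_triangle_ineq4[of "dilate a x - x" y] by (simp add: dist_norm algebra_simps)
      also have "\<dots> \<le> (a\<^sup>2 - 1) * norm x + r" by (intro add_mono norm_dilate_diff a y)
      also have "\<dots> \<le> 3 * r * R' + r"
        using a2 True \<open>r > 0\<close> by (intro add_mono mult_mono) auto
      finally have "dist (dilate a x - y) x < d" using rd by linarith
      from d(2)[OF this] True show ?thesis by (simp add: dist_norm)
    next
      case False
      have "norm (dilate a x) - norm y \<le> norm (dilate a x - y)" by (rule norm_triangle_ineq2)
      with False norm_le_dilate[OF a(1), of x] y have "R < norm x" "R < norm (dilate a x - y)"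
        unfolding r_def R'_def by auto
      then show ?thesis using \<open>s > 0\<close> by (simp add: g(2) indicator_def)
    qed
    have G: "sqL2 (\<lambda>x. g (dilate a x - y) - g x) < ennreal (e / 16)"
    proof -
      have "sqL2 (\<lambda>x. g (dilate a x - y) - g x) \<le> (\<integral>\<^sup>+ x. ennreal (s\<^sup>2) * indicator (cball (0::C2) R') x \<partial>lborel)"
        unfolding sqL2_def
      proof (rule nn_integral_mono)
        fix x
        have "(norm (g (dilate a x - y) - g x))\<^sup>2 \<le> (s * indicator (cball 0 R') x)\<^sup>2"
          by (intro power_mono gd) auto
        from ennreal_leI[OF this]
        show "ennreal ((norm (g (dilate a x - y) - g x))\<^sup>2) \<le> ennreal (s\<^sup>2) * indicator (cball (0::C2) R') x"
          by (auto simp: indicator_def split: if_splits)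
      qed
      also have "\<dots> = ennreal (s\<^sup>2) * emeasure lborel (cball (0::C2) R')"
        by (rule nn_integral_cmult_indicator) auto
      also have "\<dots> = ennreal (s\<^sup>2 * m)"
        unfolding m_def using emeasure_lborel_cball_finite[of "0::C2" R']
        by (subst emeasure_eq_ennreal_measure) (auto simp: ennreal_mult)
      also have "\<dots> < ennreal (e / 16)" using sm \<open>e > 0\<close> by (intro ennreal_lessI) auto
      finally show ?thesis .
    qed
    have A: "sqL2 (\<lambda>x. f (dilate a x - y) - g (dilate a x - y)) < ennreal (e / 16)"
      using sqL2_dilate_le[of "\<lambda>x. f x - g x" a y] a g(3) by (auto intro: order.strict_trans1)
    have B: "sqL2 (\<lambda>x. g x - f x) < ennreal (e / 16)"
      using g(3) by (simp add: sqL2_minus_commute[of g f])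
    have "sqL2 (\<lambda>x. g (dilate a x - y) - f x) \<le> 2 * sqL2 (\<lambda>x. g (dilate a x - y) - g x) + 2 * sqL2 (\<lambda>x. g x - f x)"
      by (rule sqL2_diff_triangle) measurable
    also have "\<dots> < ennreal (e / 4)"
      by (rule ennreal_add_lt_quarters) (use G B in simp_all)
    finally have C: "sqL2 (\<lambda>x. g (dilate a x - y) - f x) < ennreal (e / 4)" .
    have "ennreal (e / 16) \<le> ennreal (e / 4)" using \<open>e > 0\<close> by (intro ennreal_leI) auto
    with A have A': "sqL2 (\<lambda>x. f (dilate a x - y) - g (dilate a x - y)) < ennreal (e / 4)" by (rule order.strict_trans2)
    have "sqL2 (\<lambda>x. f (dilate a x - y) - f x) \<le> 2 * sqL2 (\<lambda>x. f (dilate a x - y) - g (dilate a x - y)) + 2 * sqL2 (\<lambda>x. g (dilate a x - y) - f x)"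
      by (rule sqL2_diff_triangle) measurable
    also have "\<dots> < ennreal e" by (rule ennreal_add_lt_quarters[OF A' C])
    finally show ?thesis .
  qed
  with \<open>r > 0\<close> that show ?thesis by blast
qed

text \<open>A mollified function is an average of translates, so by Jensen's inequality and Tonelli's theorem
  the bound \<open>c\<close> for all small translates carries over.\<close>

lemma sqL2_mollify_dilate:
  fixes f :: "C2 \<Rightarrow> complex"
  assumes f[measurable]: "f \<in> borel_measurable borel" and fin: "sqL2 f < \<infinity>"
    and k: "\<And>y. 0 \<le> k y" "\<And>y. \<tau> < norm y \<Longrightarrow> k y = 0" "(\<integral>\<^sup>+ y. ennreal (k y) \<partial>lborel) = 1"
      "continuous_on UNIV k"
    and small: "\<And>y. norm y \<le> \<tau> \<Longrightarrow> sqL2 (\<lambda>x. f (dilate a x - y) - f x) \<le> c"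
  shows "sqL2 (\<lambda>x. convolve (\<lambda>y. of_real (k y)) f (dilate a x) - f x) \<le> c"
proof -
  have k_meas[measurable]: "k \<in> borel_measurable borel" using k(4) borel_measurable_continuous by blast
  obtain B where B: "\<And>y. norm (k y) \<le> B" using bounded_bounded_support[OF k(4,2)] by metis
  have ik: "integrable lborel k" by (rule integrable_bounded_support[OF _ B k(2)]) measurable
  have "ennreal (LBINT y. k y) = 1" using nn_integral_eq_integral[OF ik] k(1,3) by simp
  then have Ik: "(LBINT y. k y) = 1" by simp
  have n2k: "sqL2 (\<lambda>y. complex_of_real (k y)) < \<infinity>"
    by (rule sqL2_bounded_support_finite[of _ B \<tau>]) (use B k(2) in auto)
  have eq: "convolve (\<lambda>y. of_real (k y)) f (dilate a x) - f x
      = (LBINT y. (f (dilate a x - y) - f x) * of_real (k y))" for x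
  proof -
    have "integrable lborel (\<lambda>y. f (dilate a x - y) * complex_of_real (k y))"
    proof (rule L2_mult_integrable[OF _ _ _ n2k])
      have "sqL2 (\<lambda>y. f (dilate a x - y)) = sqL2 f"
      proof -
        have "sqL2 f = (\<integral>\<^sup>+ u. ennreal ((norm (f u))\<^sup>2) \<partial>density (distr lborel borel (\<lambda>y. dilate a x + (- 1) *\<^sub>R y)) (\<lambda>_. 1))"
          unfolding sqL2_def using lborel_affine[of "- 1" "dilate a x"] by simp
        also have "\<dots> = sqL2 (\<lambda>y. f (dilate a x - y))"
          unfolding sqL2_def by (simp add: density_1 nn_integral_distr)
        finally show ?thesis by simp
      qed
      then show "sqL2 (\<lambda>y. f (dilate a x - y)) < \<infinity>" using fin by simp
    qed measurable
    moreover have "integrable lborel (\<lambda>y. f x * complex_of_real (k y))"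
      using ik by simp
    ultimately have "(LBINT y. (f (dilate a x - y) - f x) * of_real (k y))
        = (LBINT y. f (dilate a x - y) * of_real (k y)) - (LBINT y. f x * complex_of_real (k y))"
      by (simp add: left_diff_distrib)
    also have "(LBINT y. f x * complex_of_real (k y)) = f x" using Ik by simp
    also have "(LBINT y. f (dilate a x - y) * of_real (k y)) = convolve (\<lambda>y. of_real (k y)) f (dilate a x)"
      by (rule convolve_alt[symmetric]) measurable
    finally show ?thesis by simp
  qed
  have "sqL2 (\<lambda>x. convolve (\<lambda>y. of_real (k y)) f (dilate a x) - f x)
      \<le> (\<integral>\<^sup>+ x. \<integral>\<^sup>+ y. ennreal ((norm (f (dilate a x - y) - f x))\<^sup>2) * ennreal (k y) \<partial>lborel \<partial>lborel)"
    unfolding sqL2_def eq by (intro nn_integral_mono norm_average_sq_le k) measurable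
  also have "\<dots> = (\<integral>\<^sup>+ y. \<integral>\<^sup>+ x. ennreal ((norm (f (dilate a x - y) - f x))\<^sup>2) * ennreal (k y) \<partial>lborel \<partial>lborel)"
    by (rule lborel_pair.Fubini') measurable
  also have "\<dots> = (\<integral>\<^sup>+ y. sqL2 (\<lambda>x. f (dilate a x - y) - f x) * ennreal (k y) \<partial>lborel)"
    unfolding sqL2_def by (intro nn_integral_cong nn_integral_multc) measurable
  also have "\<dots> \<le> (\<integral>\<^sup>+ y. c * ennreal (k y) \<partial>lborel)"
  proof (rule nn_integral_mono)
    fix y show "sqL2 (\<lambda>x. f (dilate a x - y) - f x) * ennreal (k y) \<le> c * ennreal (k y)"
      using small[of y] k(2)[of y] by (cases "norm y \<le> \<tau>") (auto intro!: mult_right_mono)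
  qed
  also have "\<dots> = c" using k(3) by (subst nn_integral_cmult) auto
  finally show ?thesis .
qed

lemma test_functionsI:
  assumes "\<And>k. Ck k \<phi>" "compact K" "K \<subseteq> \<Omega>" "\<And>x. \<phi> x \<noteq> 0 \<Longrightarrow> x \<in> K"
  shows "\<phi> \<in> test_functions \<Omega>"
proof -
  have "closure {x. \<phi> x \<noteq> 0} \<subseteq> K"
    using assms(2,4) by (intro closure_minimal compact_imp_closed) auto
  moreover have "compact (closure {x. \<phi> x \<noteq> 0})"
    using bounded_subset[OF compact_imp_bounded[OF assms(2)], of "{x. \<phi> x \<noteq> 0}"] assms(4)
    by (auto simp: compact_closure)
  ultimately show ?thesis using assms(1,3) by (auto simp: test_functions_def)
qed

lemma test_functionsD:
  assumes "\<phi> \<in> test_functions \<Omega>"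
  shows "Ck k \<phi>" "C1c \<phi>" "\<phi> x \<noteq> 0 \<Longrightarrow> x \<in> \<Omega>"
proof -
  show "Ck k \<phi>" using assms by (auto simp: test_functions_def)
  have "bounded (closure {x. \<phi> x \<noteq> 0})"
    using assms by (auto simp: test_functions_def intro: compact_imp_bounded)
  then obtain R where "\<forall>x\<in>closure {x. \<phi> x \<noteq> 0}. norm x \<le> R" unfolding bounded_iff by blast
  then have "\<forall>x. R < norm x \<longrightarrow> \<phi> x = 0"
    using closure_subset[of "{x. \<phi> x \<noteq> 0}"] by fastforce
  then show "C1c \<phi>" using assms unfolding C1c_def test_functions_def by blast
  show "\<phi> x \<noteq> 0 \<Longrightarrow> x \<in> \<Omega>"
    using assms closure_subset[of "{x. \<phi> x \<noteq> 0}"] by (auto simp: test_functions_def)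
qed

lemma test_functions_UNIV_I:
  fixes \<phi> :: "'a::euclidean_space \<Rightarrow> complex"
  assumes "\<And>k. Ck k \<phi>" "\<And>x. R < norm x \<Longrightarrow> \<phi> x = 0"
  shows "\<phi> \<in> test_functions UNIV"
  by (rule test_functionsI[where K = "cball 0 R"]) (use assms in force)+

lemma test_functions_mono: "\<Omega> \<subseteq> \<Omega>' \<Longrightarrow> test_functions \<Omega> \<subseteq> test_functions \<Omega>'"
  by (auto simp: test_functions_def)

lemma continuous_dbar:
  assumes "Ck (Suc 0) \<phi>"
  shows "continuous_on UNIV (dbar \<phi>)"
  using assms unfolding dbar_def by (intro continuous_intros) auto

text \<open>The distributional equation on the whole space, for Borel functions: Lebesgue measure on the Borel
  sets replaces its completion.\<close>

definition weak_dbar :: "(C2 \<Rightarrow> complex) \<Rightarrow> (C2 \<Rightarrow> C2) \<Rightarrow> bool" where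
  "weak_dbar f h \<longleftrightarrow> (\<forall>\<phi> \<in> test_functions UNIV.
     (LBINT p. f p * fst (dbar \<phi> p)) = - (LBINT p. fst (h p) * \<phi> p) \<and>
     (LBINT p. f p * snd (dbar \<phi> p)) = - (LBINT p. snd (h p) * \<phi> p))"

text \<open>The derivative falls on the kernel, whose reflection is a test function, and the weak equation
  moves it to \<open>f\<close>. The dilation is complex linear and diagonal, so it merely contributes its
  diagonal entries.\<close>

lemma dbar_mollify_dilate:
  assumes f: "integrable lborel f" and \<kappa>: "\<kappa> \<in> test_functions UNIV" and wd: "weak_dbar f h"
  shows "dbar (\<lambda>x. convolve \<kappa> f (dilate a x)) x
    = (of_real (a\<^sup>2) * convolve \<kappa> (\<lambda>p. fst (h p)) (dilate a x), of_real a * convolve \<kappa> (\<lambda>p. snd (h p)) (dilate a x))"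
proof -
  have C: "C1c \<kappa>" "\<And>j. Ck j \<kappa>" using test_functionsD(1,2)[OF \<kappa>] by blast+
  obtain R where R: "R > 0" "\<And>x. R < norm x \<Longrightarrow> \<kappa> x = 0" "\<And>x v. R < norm x \<Longrightarrow> fd \<kappa> x v = 0"
    using C1cE[OF C(1)] by blast
  note int = convolve_integrable[OF f C1c_fd_continuous[OF C(1)] R(3)]
  have lin: "linear (fd \<kappa> y)" for y using C1c_linear_fd[OF C(1)] bounded_linear.linear by blast
  let ?X = "dilate a x"
  have fdF: "fd (\<lambda>x. convolve \<kappa> f (dilate a x)) x v = convolve (\<lambda>y. fd \<kappa> y (dilate a v)) f ?X" for v
  proof -
    have "((\<lambda>x. convolve \<kappa> f (dilate a x)) has_derivative (\<lambda>v. convolve (\<lambda>y. fd \<kappa> y (dilate a v)) f ?X)) (at x)"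
      using has_derivative_compose[OF bounded_linear_imp_has_derivative[OF bounded_linear_dilate] convolve_has_derivative[OF f C(1)]] .
    from fun_cong[OF frechet_derivative_at[OF this], of v] show ?thesis by (rule sym)
  qed
  have scale: "convolve (\<lambda>y. fd \<kappa> y (s *\<^sub>R v)) f ?X = of_real s * convolve (\<lambda>y. fd \<kappa> y v) f ?X" for s v
    unfolding convolve_def linear_scale[OF lin] mult_scaleR_right by (simp add: scaleR_conv_of_real)
  define \<psi> where "\<psi> u = \<kappa> (?X - u)" for u
  have bm: "bounded_linear (\<lambda>u::C2. - u)" by (intro bounded_linear_minus bounded_linear_ident)
  have \<psi>eq: "\<psi> = (\<lambda>u. \<kappa> (- u + ?X))" by (simp add: \<psi>_def fun_eq_iff)
  have "\<psi> \<in> test_functions UNIV"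
  proof (rule test_functions_UNIV_I[where R = "R + norm ?X"])
    show "Ck j \<psi>" for j unfolding \<psi>eq by (rule Ck_compose_affine[OF bm C(2)])
    fix u :: "C2" assume "R + norm ?X < norm u"
    then have "R < norm (?X - u)" using norm_triangle_ineq2[of u ?X] by (simp add: norm_minus_commute)
    then show "\<psi> u = 0" by (simp add: \<psi>_def R(2))
  qed
  with wd have w: "(LBINT p. f p * fst (dbar \<psi> p)) = - (LBINT p. fst (h p) * \<psi> p)"
     "(LBINT p. f p * snd (dbar \<psi> p)) = - (LBINT p. snd (h p) * \<psi> p)"
    unfolding weak_dbar_def by auto
  have fd\<psi>: "fd \<psi> u v = - fd \<kappa> (?X - u) v" for u v
    unfolding \<psi>eq using fd_compose_affine[OF C(2) bm, of ?X u v] linear_neg[OF lin] by simp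
  have key: "convolve (\<lambda>y. fd \<kappa> y v) f ?X + \<i> * convolve (\<lambda>y. fd \<kappa> y v') f ?X
      = - (LBINT u. f u * (fd \<psi> u v + \<i> * fd \<psi> u v'))" for v v'
  proof -
    have "(LBINT u. f u * (fd \<psi> u v + \<i> * fd \<psi> u v'))
       = (LBINT u. - (f u * fd \<kappa> (?X - u) v + \<i> * (f u * fd \<kappa> (?X - u) v')))"
      unfolding fd\<psi> by (simp add: algebra_simps)
    also have "\<dots> = - (convolve (\<lambda>y. fd \<kappa> y v) f ?X + \<i> * convolve (\<lambda>y. fd \<kappa> y v') f ?X)"
      unfolding convolve_def using int by simp
    finally show ?thesis by simp
  qed
  have half: "(LBINT u. f u * (A u / 2)) = (LBINT u. f u * A u) / 2" for A :: "C2 \<Rightarrow> complex"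
    by simp
  have d: "dilate a (1, 0) = (a\<^sup>2) *\<^sub>R (1, 0)" "dilate a (\<i>, 0) = (a\<^sup>2) *\<^sub>R (\<i>, 0)"
    "dilate a (0, 1) = a *\<^sub>R (0, 1)" "dilate a (0, \<i>) = a *\<^sub>R (0, \<i>)"
    by (simp_all add: dilate_def)
  have conv: "convolve \<kappa> g ?X = (LBINT p. g p * \<psi> p)" for g by (simp add: convolve_def \<psi>_def)
  have "fst (dbar (\<lambda>x. convolve \<kappa> f (dilate a x)) x)
     = of_real (a\<^sup>2) * ((convolve (\<lambda>y. fd \<kappa> y (1,0)) f ?X + \<i> * convolve (\<lambda>y. fd \<kappa> y (\<i>,0)) f ?X) / 2)"
    unfolding dbar_def fst_conv fdF d scale by (simp add: algebra_simps)
  also have "\<dots> = of_real (a\<^sup>2) * convolve \<kappa> (\<lambda>p. fst (h p)) ?X"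
    using w(1) unfolding key conv dbar_def fst_conv half by simp
  finally have 1: "fst (dbar (\<lambda>x. convolve \<kappa> f (dilate a x)) x) = of_real (a\<^sup>2) * convolve \<kappa> (\<lambda>p. fst (h p)) ?X" .
  have "snd (dbar (\<lambda>x. convolve \<kappa> f (dilate a x)) x)
     = of_real a * ((convolve (\<lambda>y. fd \<kappa> y (0,1)) f ?X + \<i> * convolve (\<lambda>y. fd \<kappa> y (0,\<i>)) f ?X) / 2)"
    unfolding dbar_def snd_conv fdF d scale by (simp add: algebra_simps)
  also have "\<dots> = of_real a * convolve \<kappa> (\<lambda>p. snd (h p)) ?X"
    using w(2) unfolding key conv dbar_def snd_conv half by simp
  finally show ?thesis using 1 by (simp add: prod_eq_iff)
qed

text \<open>Membership in the closure of the graph of \<open>\<partial>\<close>-bar on test functions, for functions given on the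
  whole space. The strong minimal closure consists of the pairs whose extensions by zero have
  this property.\<close>

definition approximable :: "(C2 \<Rightarrow> complex) \<Rightarrow> (C2 \<Rightarrow> C2) \<Rightarrow> bool" where
  "approximable f h \<longleftrightarrow> (\<forall>e>0. \<exists>F \<in> test_functions hartogs_triangle.
      sqL2 (\<lambda>x. F x - f x) < ennreal e \<and> sqL2 (\<lambda>x. dbar F x - h x) < ennreal e)"

lemma sqL2_cmult:
  fixes f :: "'a::euclidean_space \<Rightarrow> complex"
  assumes [measurable]: "f \<in> borel_measurable borel"
  shows "sqL2 (\<lambda>x. c * f x) = ennreal ((norm c)\<^sup>2) * sqL2 f"
  unfolding sqL2_def by (subst nn_integral_cmult[symmetric]) (auto simp: norm_mult power_mult_distrib ennreal_mult)

lemma sqL2_prod: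
  fixes h :: "'a::euclidean_space \<Rightarrow> C2"
  assumes [measurable]: "h \<in> borel_measurable borel"
  shows "sqL2 h = sqL2 (\<lambda>x. fst (h x)) + sqL2 (\<lambda>x. snd (h x))"
proof -
  show ?thesis
    unfolding sqL2_def norm_prod_sq by (subst nn_integral_add[symmetric]) auto
qed

text \<open>Composition with the dilation by \<open>a\<close> creates a gap between the support and the boundary of the
  triangle. The gap is proportional to $(a - 1)|w|$, hence bounded below because $|w| \ge \epsilon$
  on the support, and a mollification on a smaller scale does not close it.\<close>

lemma approximable_if_away_from_origin:
  assumes f[measurable]: "f \<in> borel_measurable borel" and h[measurable]: "h \<in> borel_measurable borel"
    and fin: "sqL2 f < \<infinity>" "sqL2 h < \<infinity>" and wd: "weak_dbar f h" and \<epsilon>: "0 < \<epsilon>" "\<epsilon> \<le> 1"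
    and supp: "\<And>p. f p \<noteq> 0 \<Longrightarrow> cmod (fst p) \<le> cmod (snd p) \<and> cmod (snd p) \<le> 1 \<and> \<epsilon> \<le> cmod (snd p)"
  shows "approximable f h"
  unfolding approximable_def
proof (intro allI impI)
  fix e :: real assume "e > 0"
  have h12[measurable]: "(\<lambda>x. fst (h x)) \<in> borel_measurable borel" "(\<lambda>x. snd (h x)) \<in> borel_measurable borel"
    by measurable
  have fin12: "sqL2 (\<lambda>x. fst (h x)) < \<infinity>" "sqL2 (\<lambda>x. snd (h x)) < \<infinity>"
    using fin(2) unfolding sqL2_prod[OF h] by auto
  define N where "N = enn2real (sqL2 h)"
  have N: "sqL2 h = ennreal N" "N \<ge> 0" using fin(2) by (auto simp: N_def)
  define e' where "e' = e / 256"
  have "e' > 0" using \<open>e > 0\<close> by (simp add: e'_def)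
  obtain r0 where r0: "r0 > 0" "\<And>a y. 1 \<le> a \<Longrightarrow> a \<le> 1 + r0 \<Longrightarrow> norm y \<le> r0 \<Longrightarrow> sqL2 (\<lambda>x. f (dilate a x - y) - f x) < ennreal e'"
    using sqL2_dilate_translate_small[OF f fin(1) \<open>e' > 0\<close>] by blast
  obtain r1 where r1: "r1 > 0" "\<And>a y. 1 \<le> a \<Longrightarrow> a \<le> 1 + r1 \<Longrightarrow> norm y \<le> r1 \<Longrightarrow> sqL2 (\<lambda>x. fst (h (dilate a x - y)) - fst (h x)) < ennreal e'"
    using sqL2_dilate_translate_small[OF h12(1) fin12(1) \<open>e' > 0\<close>] by blast
  obtain r2 where r2: "r2 > 0" "\<And>a y. 1 \<le> a \<Longrightarrow> a \<le> 1 + r2 \<Longrightarrow> norm y \<le> r2 \<Longrightarrow> sqL2 (\<lambda>x. snd (h (dilate a x - y)) - snd (h x)) < ennreal e'"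
    using sqL2_dilate_translate_small[OF h12(2) fin12(2) \<open>e' > 0\<close>] by blast
  \<comment> \<open>\<open>r3\<close> controls the error \<open>(a\<^sup>2 - 1) h\<close> that the rescaling of the components of \<open>\<partial>\<close>-bar causes\<close>
  define r3 where "r3 = sqrt (e / (256 * (N + 1)))"
  have "r3 > 0" using \<open>e > 0\<close> N(2) by (simp add: r3_def)
  define \<delta> where "\<delta> = min (min (min r0 r1) (min r2 r3)) 1"
  have \<delta>: "\<delta> > 0" "\<delta> \<le> 1" "\<delta> \<le> r0" "\<delta> \<le> r1" "\<delta> \<le> r2" "\<delta> \<le> r3"
    using r0(1) r1(1) r2(1) \<open>r3 > 0\<close> by (auto simp: \<delta>_def)
  define a where "a = 1 + \<delta>"
  have a: "1 \<le> a" "1 < a" "a \<le> 2" using \<delta> by (auto simp: a_def)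
  \<comment> \<open>the mollification scale, small compared with the gap of size about \<open>\<delta> \<epsilon>\<close>\<close>
  define \<tau> where "\<tau> = \<delta> * \<epsilon> / 8"
  have \<tau>: "\<tau> > 0" "\<tau> \<le> \<delta> / 8" "8 * \<tau> \<le> \<epsilon>" "\<tau> \<le> \<delta>"
  proof -
    show "\<tau> > 0" using \<delta> \<epsilon> by (simp add: \<tau>_def)
    show le: "\<tau> \<le> \<delta> / 8" using \<delta> \<epsilon> mult_left_le[of \<epsilon> \<delta>] by (simp add: \<tau>_def)
    show "8 * \<tau> \<le> \<epsilon>" using \<delta> \<epsilon> mult_right_mono[of \<delta> 1 \<epsilon>] by (simp add: \<tau>_def)
    show "\<tau> \<le> \<delta>" using le \<delta> by simp
  qed
  obtain k :: "C2 \<Rightarrow> real" where k: "\<And>y. 0 \<le> k y" "\<And>y. \<tau> < norm y \<Longrightarrow> k y = 0" "(\<integral>\<^sup>+ y. ennreal (k y) \<partial>lborel) = 1"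
    and kC: "\<And>j. Ck j (\<lambda>y. complex_of_real (k y))"
    using mollifier_exists[OF \<tau>(1)] by blast
  have "continuous_on UNIV (\<lambda>y. Re (complex_of_real (k y)))"
    using kC[of 0] by (intro continuous_intros) simp
  then have k4: "continuous_on UNIV k" by simp
  define \<kappa> where "\<kappa> y = complex_of_real (k y)" for y
  have \<kappa>T: "\<kappa> \<in> test_functions UNIV"
    unfolding \<kappa>_def by (rule test_functions_UNIV_I[OF kC, of \<tau>]) (simp add: k(2))
  define F where "F x = convolve \<kappa> f (dilate a x)" for x
  have f_int: "integrable lborel f"
  proof -
    have f0: "f p = 0" if "2 < norm p" for p
    proof (rule ccontr)
      assume "f p \<noteq> 0"
      from supp[OF this] have "norm (fst p) \<le> 1" "norm (snd p) \<le> 1" by auto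
      then have "norm p \<le> 2" using norm_Pair_le[of "fst p" "snd p"] by simp
      with that show False by simp
    qed
    have "integrable lborel (\<lambda>x. f x * (indicator (cball 0 2) x :: complex))"
    proof (rule L2_mult_integrable)
      show "sqL2 (indicator (cball 0 2) :: C2 \<Rightarrow> complex) < \<infinity>"
        by (rule sqL2_bounded_support_finite[of _ 1 2]) (auto simp: indicator_def)
    qed (use fin in \<open>auto intro!: borel_measurable_indicator\<close>)
    moreover have "(\<lambda>x. f x * (indicator (cball 0 2) x :: complex)) = f"
      using f0 by (auto simp: fun_eq_iff indicator_def not_le)
    ultimately show ?thesis by simp
  qed
  \<comment> \<open>a compact subset of the triangle that contains the support of the approximation\<close>
  define K where "K = {p :: C2. cmod (fst p) \<le> cmod (snd p) - \<tau> / 4 \<and> a * cmod (snd p) \<le> 1 + \<tau>}"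
  have FT: "F \<in> test_functions hartogs_triangle"
  proof (rule test_functionsI[of F K])
    show "Ck j F" for j
    proof -
      have "Ck j (convolve \<kappa> f)"
        by (rule Ck_convolve[OF f_int test_functionsD(1)[OF \<kappa>T], of \<tau>]) (simp add: \<kappa>_def k(2))
      from Ck_compose_affine[OF bounded_linear_dilate this, of a 0] show ?thesis
        by (simp add: F_def[abs_def])
    qed
    have snd_le: "cmod (snd p) < 1" if "p \<in> K" for p
    proof -
      have "a * cmod (snd p) \<le> 1 + \<tau>" using that by (simp add: K_def)
      also have "\<dots> < a * 1" using \<tau>(2) \<delta>(1) by (simp add: a_def)
      finally show ?thesis using a by simp
    qed
    have "closed K"
      unfolding K_def by (intro closed_Collect_conj closed_Collect_le continuous_intros)
    moreover have "bounded K"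
    proof (rule boundedI[of _ 2])
      fix p assume p: "p \<in> K"
      then have "cmod (fst p) \<le> cmod (snd p)" using \<tau>(1) by (simp add: K_def)
      with snd_le[OF p] show "norm p \<le> 2" using norm_Pair_le[of "fst p" "snd p"] by simp
    qed
    ultimately show "compact K" by (simp add: compact_eq_bounded_closed)
    show "K \<subseteq> hartogs_triangle"
      using snd_le \<tau>(1) by (force simp: hartogs_triangle_def K_def)
    fix p assume "F p \<noteq> 0"
    have "\<exists>u. f u \<noteq> 0 \<and> norm (dilate a p - u) \<le> \<tau>"
    proof (rule ccontr)
      assume "\<not> ?thesis"
      then have "f u * \<kappa> (dilate a p - u) = 0" for u
        using k(2)[of "dilate a p - u"] unfolding \<kappa>_def by (metis mult_eq_0_iff not_le of_real_0)
      then have "(\<lambda>u. f u * \<kappa> (dilate a p - u)) = (\<lambda>_. 0)" by (rule ext)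
      then have "F p = 0" unfolding F_def convolve_def by (simp only: integral_zero)
      with \<open>F p \<noteq> 0\<close> show False by simp
    qed
    then obtain u where u: "f u \<noteq> 0" "norm (dilate a p - u) \<le> \<tau>" by blast
    note su = supp[OF u(1)]
    have q: "norm (fst q) \<le> norm q" "norm (snd q) \<le> norm q" for q :: "C2"
      by (cases q; simp add: norm_fst_le norm_snd_le)+
    have "norm (a\<^sup>2 *\<^sub>R fst p - fst u) \<le> \<tau>" "norm (a *\<^sub>R snd p - snd u) \<le> \<tau>"
      using order.trans[OF q(1) u(2)] order.trans[OF q(2) u(2)] by (simp_all add: dilate_def)
    then have n: "a\<^sup>2 * cmod (fst p) \<le> cmod (fst u) + \<tau>" "a * cmod (snd p) \<le> cmod (snd u) + \<tau>" "cmod (snd u) - \<tau> \<le> a * cmod (snd p)"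
      using norm_triangle_ineq2[of "a\<^sup>2 *\<^sub>R fst p" "fst u"] norm_triangle_ineq2[of "a *\<^sub>R snd p" "snd u"]
        norm_triangle_ineq2[of "snd u" "a *\<^sub>R snd p"] a by (auto simp: norm_minus_commute)
    \<comment> \<open>the gain \<open>(a\<^sup>2 - a) |w|\<close> of the dilation exceeds the loss from mollifying both coordinates\<close>
    have "3 * \<tau> \<le> \<delta> * (7 * \<epsilon> / 8)" using \<delta> \<epsilon> by (simp add: \<tau>_def)
    also have "\<dots> \<le> \<delta> * (a * cmod (snd p))"
      using n(3) su \<tau>(3) \<delta> by (intro mult_left_mono) auto
    also have "\<dots> = a\<^sup>2 * cmod (snd p) - a * cmod (snd p)" by (simp add: a_def power2_eq_square algebra_simps)
    finally have "a\<^sup>2 * cmod (fst p) \<le> a\<^sup>2 * cmod (snd p) - \<tau>" using n su by linarith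
    also have "\<dots> \<le> a\<^sup>2 * (cmod (snd p) - \<tau> / 4)"
    proof -
      have "a\<^sup>2 \<le> 2\<^sup>2" using a by (intro power_mono) auto
      then have "a\<^sup>2 * \<tau> \<le> 4 * \<tau>" using \<tau>(1) by (intro mult_right_mono) auto
      then show ?thesis by (simp add: algebra_simps)
    qed
    finally have "cmod (fst p) \<le> cmod (snd p) - \<tau> / 4" using a by (simp add: mult_le_cancel_left)
    moreover have "a * cmod (snd p) \<le> 1 + \<tau>" using n(2) su by linarith
    ultimately show "p \<in> K" by (simp add: K_def)
  qed
  have CF: "Ck (Suc 0) F" using test_functionsD(1)[OF FT] .
  have mol: "sqL2 (\<lambda>x. convolve \<kappa> g (dilate a x) - g x) \<le> ennreal e'"
    if "g \<in> borel_measurable borel" "sqL2 g < \<infinity>" "r > 0" "\<delta> \<le> r"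
      "\<And>a y. 1 \<le> a \<Longrightarrow> a \<le> 1 + r \<Longrightarrow> norm y \<le> r \<Longrightarrow> sqL2 (\<lambda>x. g (dilate a x - y) - g x) < ennreal e'" for g r
    unfolding \<kappa>_def
    by (rule sqL2_mollify_dilate[OF that(1,2) k k4]) (use that(4,5) \<tau>(4) a a_def in \<open>auto intro!: less_imp_le\<close>)
  have "continuous_on UNIV (dbar F)" by (rule continuous_dbar[OF CF])
  then have [measurable]: "(\<lambda>x. fst (dbar F x)) \<in> borel_measurable borel" "(\<lambda>x. snd (dbar F x)) \<in> borel_measurable borel"
    and dF_meas: "dbar F \<in> borel_measurable borel"
    by (auto intro!: borel_measurable_continuous continuous_intros)
  have dF: "dbar F x = (of_real (a\<^sup>2) * convolve \<kappa> (\<lambda>p. fst (h p)) (dilate a x), of_real a * convolve \<kappa> (\<lambda>p. snd (h p)) (dilate a x))" for x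
    unfolding F_def[abs_def] by (rule dbar_mollify_dilate[OF f_int \<kappa>T wd])
  have \<delta>2: "\<delta>\<^sup>2 * N \<le> e / 256"
  proof -
    have "\<delta>\<^sup>2 \<le> r3\<^sup>2" using \<delta> by (intro power_mono) auto
    then have "\<delta>\<^sup>2 * N \<le> e / (256 * (N + 1)) * N"
      using \<open>e > 0\<close> N(2) by (intro mult_right_mono) (auto simp: r3_def)
    also have "\<dots> = e / 256 * (N / (N + 1))" by simp
    also have "\<dots> \<le> e / 256 * 1" using \<open>e > 0\<close> N(2) by (intro mult_left_mono) auto
    finally show ?thesis by simp
  qed
  have comp: "sqL2 (\<lambda>x. of_real c * C x - g x) \<le> ennreal (50 * e / 256)"
    if c: "1 \<le> c" "c \<le> 1 + 3 * \<delta>" and "(\<lambda>x. of_real c * C x) \<in> borel_measurable borel"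
      and g[measurable]: "g \<in> borel_measurable borel" and Cg: "sqL2 (\<lambda>x. C x - g x) \<le> ennreal e'" and gN: "sqL2 g \<le> sqL2 h"
    for c and C g :: "C2 \<Rightarrow> complex"
  proof -
    have "(\<lambda>x. inverse (of_real c) * (of_real c * C x)) \<in> borel_measurable borel"
      using that(3) by measurable
    then have [measurable]: "C \<in> borel_measurable borel" using c by (simp flip: mult.assoc)
    have c4: "c\<^sup>2 \<le> 4\<^sup>2" using c \<delta> by (intro power_mono) auto
    have c3: "(c - 1)\<^sup>2 \<le> (3 * \<delta>)\<^sup>2" using c by (intro power_mono) auto
    have "sqL2 (\<lambda>x. of_real c * C x - g x) = sqL2 (\<lambda>x. of_real c * (C x - g x) + of_real (c - 1) * g x)"
      by (simp add: algebra_simps)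
    also have "\<dots> \<le> 2 * sqL2 (\<lambda>x. of_real c * (C x - g x)) + 2 * sqL2 (\<lambda>x. of_real (c - 1) * g x)"
      by (rule sqL2_add) measurable
    also have "\<dots> = 2 * (ennreal (c\<^sup>2) * sqL2 (\<lambda>x. C x - g x)) + 2 * (ennreal ((c - 1)\<^sup>2) * sqL2 g)"
      by (subst (1 2) sqL2_cmult) (simp_all del: of_real_diff)
    also have "\<dots> \<le> 2 * (ennreal (4\<^sup>2) * ennreal e') + 2 * (ennreal ((3 * \<delta>)\<^sup>2) * ennreal N)"
      using Cg gN N(1) by (intro add_mono mult_left_mono mult_mono ennreal_leI c4 c3) auto
    also have "\<dots> = ennreal (2 * (4\<^sup>2 * e') + 2 * ((3 * \<delta>)\<^sup>2 * N))"
    proof -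
      have "2 * (ennreal x * ennreal y) + 2 * (ennreal z * ennreal w) = ennreal (2 * (x * y) + 2 * (z * w))"
        if "0 \<le> x" "0 \<le> y" "0 \<le> z" "0 \<le> w" for x y z w
        using that by (simp add: ennreal_mult)
      then show ?thesis using \<open>e' > 0\<close> N(2) zero_le_power2 by (meson less_imp_le)
    qed
    also have "\<dots> \<le> ennreal (50 * e / 256)"
      using \<delta>2 by (intro ennreal_leI) (simp add: e'_def power_mult_distrib mult_ac)
    finally show ?thesis .
  qed
  have a2: "a\<^sup>2 \<le> 1 + 3 * \<delta>"
    using \<delta>(1,2) mult_left_le[of \<delta> \<delta>] by (simp add: a_def power2_eq_square algebra_simps)
  have le1: "sqL2 (\<lambda>x. fst (h x)) \<le> sqL2 h" "sqL2 (\<lambda>x. snd (h x)) \<le> sqL2 h"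
    unfolding sqL2_prod[OF h] by auto
  have "sqL2 (\<lambda>x. dbar F x - h x) = sqL2 (\<lambda>x. fst (dbar F x - h x)) + sqL2 (\<lambda>x. snd (dbar F x - h x))"
    by (rule sqL2_prod) (use dF_meas in measurable)
  also have "\<dots> = sqL2 (\<lambda>x. of_real (a\<^sup>2) * convolve \<kappa> (\<lambda>p. fst (h p)) (dilate a x) - fst (h x))
      + sqL2 (\<lambda>x. of_real a * convolve \<kappa> (\<lambda>p. snd (h p)) (dilate a x) - snd (h x))"
    unfolding dF by simp
  also have "\<dots> \<le> ennreal (50 * e / 256) + ennreal (50 * e / 256)"
  proof (intro add_mono comp)
    show "1 \<le> a\<^sup>2" "1 \<le> a" "a \<le> 1 + 3 * \<delta>" using a \<delta> by (auto simp: a_def)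
    show "a\<^sup>2 \<le> 1 + 3 * \<delta>" by fact
    show "(\<lambda>x. of_real (a\<^sup>2) * convolve \<kappa> (\<lambda>p. fst (h p)) (dilate a x)) \<in> borel_measurable borel"
      using \<open>(\<lambda>x. fst (dbar F x)) \<in> borel_measurable borel\<close> unfolding dF by simp
    show "(\<lambda>x. of_real a * convolve \<kappa> (\<lambda>p. snd (h p)) (dilate a x)) \<in> borel_measurable borel"
      using \<open>(\<lambda>x. snd (dbar F x)) \<in> borel_measurable borel\<close> unfolding dF by simp
    show "sqL2 (\<lambda>x. convolve \<kappa> (\<lambda>p. fst (h p)) (dilate a x) - fst (h x)) \<le> ennreal e'"
      by (rule mol[OF _ fin12(1) r1(1) \<delta>(4) r1(2)]) measurable
    show "sqL2 (\<lambda>x. convolve \<kappa> (\<lambda>p. snd (h p)) (dilate a x) - snd (h x)) \<le> ennreal e'"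
      by (rule mol[OF _ fin12(2) r2(1) \<delta>(5) r2(2)]) measurable
  qed (use le1 in simp_all)
  also have "\<dots> = ennreal (100 * e / 256)" using \<open>e > 0\<close> by (simp flip: ennreal_plus)
  also have "\<dots> < ennreal e" using \<open>e > 0\<close> by (intro ennreal_lessI) auto
  finally have B: "sqL2 (\<lambda>x. dbar F x - h x) < ennreal e" .
  have "sqL2 (\<lambda>x. F x - f x) \<le> ennreal e'"
    unfolding F_def by (rule mol[OF f fin(1) r0(1) \<delta>(3) r0(2)])
  also have "\<dots> < ennreal e" using \<open>e > 0\<close> by (intro ennreal_lessI) (auto simp: e'_def)
  finally show "\<exists>F\<in>test_functions hartogs_triangle. sqL2 (\<lambda>x. F x - f x) < ennreal e \<and> sqL2 (\<lambda>x. dbar F x - h x) < ennreal e"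
    using FT B by blast
qed

section \<open>A Hardy inequality on the Hartogs triangle\<close>

lemma integrable_continuous_bounded_support:
  fixes g K :: "'a::euclidean_space \<Rightarrow> complex"
  assumes g: "continuous_on UNIV g" "\<And>x. R < norm x \<Longrightarrow> g x = 0"
    and K[measurable]: "K \<in> borel_measurable borel" and KM: "\<And>x. norm (K x) \<le> M"
  shows "integrable lborel (\<lambda>x. g x * K x)"
proof -
  have [measurable]: "g \<in> borel_measurable borel" using g(1) borel_measurable_continuous by blast
  obtain B where B: "B > 0" "\<And>x. norm (g x) \<le> B" using bounded_bounded_support[OF g] by blast
  show ?thesis
    by (rule integrable_bounded_support[where M = "B * M" and R = R])
      (use B g(2) KM in \<open>auto simp: norm_mult intro!: mult_mono order.trans[OF norm_ge_zero KM]\<close>)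
qed

text \<open>Expanding $4|\partial F/\partial\bar z|^2 = |F_x + i F_y|^2$ gives $|F_x|^2 + |F_y|^2$ and the cross
  term $2\,\mathrm{Im}(F_x \overline{F_y})$, which integrates to zero by the symmetry of mixed
  derivatives. Thus $\partial F/\partial\bar z$ controls all first derivatives in \<open>z\<close>.\<close>

lemma integral_dx_le_dbar:
  fixes F :: "C2 \<Rightarrow> complex"
  assumes F: "C1c F"
  shows "(LBINT p. (norm (fd F p (1, 0)))\<^sup>2) \<le> 4 * (LBINT p. (norm (fst (dbar F p)))\<^sup>2)"
    and "integrable lborel (\<lambda>p. (norm (fd F p (1, 0)))\<^sup>2)"
    and "integrable lborel (\<lambda>p. (norm (fst (dbar F p)))\<^sup>2)"
proof -
  define X where "X p = fd F p (1, 0)" for p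
  define Y where "Y p = fd F p (\<i>, 0)" for p
  obtain R where R: "R > 0" "\<And>x. R < norm x \<Longrightarrow> F x = 0" "\<And>x v. R < norm x \<Longrightarrow> fd F x v = 0"
    using C1cE[OF F] by blast
  have cont: "continuous_on UNIV X" "continuous_on UNIV Y"
    unfolding X_def Y_def by (rule C1c_fd_continuous[OF F])+
  have int: "integrable lborel g" if "continuous_on UNIV g" "\<And>p. R < norm p \<Longrightarrow> g p = 0"
    for g :: "C2 \<Rightarrow> complex"
    using integrable_continuous_bounded_support[OF that, where K = "\<lambda>_. 1" and M = 1] by simp
  have intr: "integrable lborel g" if g: "continuous_on UNIV g" "\<And>p. R < norm p \<Longrightarrow> g p = 0"
    for g :: "C2 \<Rightarrow> real"
  proof -
    obtain B where "B > 0" "\<And>x. norm (g x) \<le> B" using bounded_bounded_support[OF g] by blast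
    then show ?thesis
      by (intro integrable_bounded_support[of _ B R] borel_measurable_continuous g) auto
  qed
  have dz: "fst (dbar F p) = (X p + \<i> * Y p) / 2" for p by (simp add: dbar_def X_def Y_def)
  have zero: "X p = 0" "Y p = 0" if "R < norm p" for p using R(3)[OF that] by (simp_all add: X_def Y_def)
  have iX: "integrable lborel (\<lambda>p. (norm (X p))\<^sup>2)"
    by (rule intr) (intro continuous_intros cont, simp add: zero)
  have iY: "integrable lborel (\<lambda>p. (norm (Y p))\<^sup>2)"
    by (rule intr) (intro continuous_intros cont, simp add: zero)
  have iZ: "integrable lborel (\<lambda>p. (norm (fst (dbar F p)))\<^sup>2)"
    unfolding dz by (rule intr) (intro continuous_intros cont, simp_all add: zero)
  have iXY: "integrable lborel (\<lambda>p. X p * cnj (Y p))"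
    by (rule int) (intro continuous_intros cont, simp add: zero)
  have FC: "Ck (Suc 0) F" using F by (simp add: C1c_def del: Ck.simps)
  have "(LBINT p. X p * cnj (Y p)) = (LBINT p. Y p * cnj (X p))"
    using integral_mixed_derivatives_symmetric[OF F C1c_cnj[OF F], of "(1,0)" "(\<i>,0)"]
    unfolding fd_cnj[OF FC] X_def Y_def .
  also have "\<dots> = (LBINT p. cnj (X p * cnj (Y p)))" by (simp add: mult.commute)
  also have "\<dots> = cnj (LBINT p. X p * cnj (Y p))" by (rule Bochner_Integration.integral_cnj)
  finally have "Im (LBINT p. X p * cnj (Y p)) = 0" by (metis cnj.sel(2) neg_equal_zero)
  then have Im0: "(LBINT p. Im (X p * cnj (Y p))) = 0" using integral_Im[OF iXY] by (simp only:)
  have pt: "4 * (norm (fst (dbar F p)))\<^sup>2 = (norm (X p))\<^sup>2 + (norm (Y p))\<^sup>2 + 2 * Im (X p * cnj (Y p))" for p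
    unfolding dz norm_divide power_divide cmod_power2 by (simp add: power2_eq_square field_simps)
  have "4 * (LBINT p. (norm (fst (dbar F p)))\<^sup>2) = (LBINT p. (norm (X p))\<^sup>2 + (norm (Y p))\<^sup>2 + 2 * Im (X p * cnj (Y p)))"
    unfolding pt[symmetric] by simp
  also have "\<dots> = (LBINT p. (norm (X p))\<^sup>2) + (LBINT p. (norm (Y p))\<^sup>2) + 2 * (LBINT p. Im (X p * cnj (Y p)))"
    using iX iY integrable_Im[OF iXY] by (simp del: times_complex.simps)
  also have "\<dots> \<ge> (LBINT p. (norm (X p))\<^sup>2)" unfolding Im0 by simp
  finally show "(LBINT p. (norm (fd F p (1, 0)))\<^sup>2) \<le> 4 * (LBINT p. (norm (fst (dbar F p)))\<^sup>2)"
    by (simp add: X_def)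
  show "integrable lborel (\<lambda>p. (norm (fd F p (1, 0)))\<^sup>2)" using iX by (simp add: X_def)
  show "integrable lborel (\<lambda>p. (norm (fst (dbar F p)))\<^sup>2)" by (rule iZ)
qed

text \<open>The weight $1/|w|^2$, truncated to be bounded. It does not depend on \<open>z\<close>, so it behaves like a
  constant when integrating by parts in \<open>z\<close>.\<close>

definition hardy_weight :: "real \<Rightarrow> C2 \<Rightarrow> real" where
  "hardy_weight \<eta> p = (if \<eta> \<le> cmod (snd p) then 1 / (cmod (snd p))\<^sup>2 else 0)"

lemma hardy_weight_measurable[measurable]: "hardy_weight \<eta> \<in> borel_measurable borel"
  unfolding hardy_weight_def by measurable

lemma hardy_weight_bounds:
  assumes "0 < \<eta>"
  shows "0 \<le> hardy_weight \<eta> p" "hardy_weight \<eta> p \<le> 1 / \<eta>\<^sup>2"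
proof -
  show "0 \<le> hardy_weight \<eta> p" by (simp add: hardy_weight_def)
  have "1 / (cmod (snd p))\<^sup>2 \<le> 1 / \<eta>\<^sup>2" if "\<eta> \<le> cmod (snd p)"
    using assms that by (intro divide_left_mono power_mono mult_pos_pos zero_less_power) auto
  then show "hardy_weight \<eta> p \<le> 1 / \<eta>\<^sup>2" by (simp add: hardy_weight_def)
qed

text \<open>Integrating the \<open>x\<close>-derivative of $x |F|^2$, with $x = \mathrm{Re}\,z$, against the weight gives
  $\int W|F|^2 = - 2 \int W x\, \mathrm{Re}(F_x \overline F)$. On the triangle $|x| \le |w|$, so
  $W|x| \le \sqrt W$ and the right-hand side is absorbed by the arithmetic-geometric mean
  inequality.\<close>

lemma hardy_test_function:
  assumes FT: "F \<in> test_functions hartogs_triangle" and \<eta>: "0 < \<eta>"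
  shows "(\<integral>\<^sup>+ p. ennreal (hardy_weight \<eta> p * (norm (F p))\<^sup>2) \<partial>lborel) \<le> 16 * sqL2 (\<lambda>p. fst (dbar F p))"
proof -
  have F: "C1c F" using test_functionsD(2)[OF FT] .
  have FC: "Ck (Suc 0) F" using F by (simp add: C1c_def del: Ck.simps)
  let ?W = "hardy_weight \<eta>"
  note W = hardy_weight_bounds[OF \<eta>]
  define X where "X p = fd F p (1, 0)" for p
  obtain R where R: "R > 0" "\<And>x. R < norm x \<Longrightarrow> F x = 0" "\<And>x v. R < norm x \<Longrightarrow> fd F x v = 0"
    using C1cE[OF F] by blast
  have Re_lin: "bounded_linear (\<lambda>p::C2. complex_of_real (Re (fst p)))"
    by (intro bounded_linear_compose[OF bounded_linear_of_real] bounded_linear_compose[OF bounded_linear_Re] bounded_linear_fst)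
  define G where "G p = complex_of_real (Re (fst p)) * (F p * cnj (F p))" for p
  have FFC: "C1c (\<lambda>p. F p * cnj (F p))" by (rule C1c_mult[OF F C1c_cnj[OF F]])
  then have FF1: "Ck (Suc 0) (\<lambda>p. F p * cnj (F p))" by (simp add: C1c_def del: Ck.simps)
  have G: "C1c G" unfolding G_def by (rule C1c_mult_Ck[OF FFC Ck_linear[OF Re_lin]])
  have cnjF1: "Ck (Suc 0) (\<lambda>p. cnj (F p))" using C1c_cnj[OF F] by (simp add: C1c_def del: Ck.simps)
  have fdG: "fd G p (1, 0) = of_real ((norm (F p))\<^sup>2 + 2 * Re (fst p) * Re (X p * cnj (F p)))" for p
  proof -
    have "fd (\<lambda>p. complex_of_real (Re (fst p))) p (1, 0) = 1"
      using frechet_derivative_at[OF bounded_linear_imp_has_derivative[OF Re_lin], of p] by (simp add: fun_eq_iff)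
    moreover have "fd (\<lambda>p. F p * cnj (F p)) p (1, 0) = F p * cnj (X p) + X p * cnj (F p)"
      unfolding fd_mult[OF FC cnjF1] fd_cnj[OF FC] X_def ..
    ultimately have eq: "fd G p (1, 0) = complex_of_real (Re (fst p)) * (F p * cnj (X p) + X p * cnj (F p)) + F p * cnj (F p)"
      unfolding G_def fd_mult[OF Ck_linear[OF Re_lin, of "Suc 0"] FF1] by simp
    show ?thesis
      unfolding eq complex_eq_iff cmod_power2 by (simp add: power2_eq_square algebra_simps)
  qed
  have "(LBINT p. fd G p (1, 0) * complex_of_real (?W p)) = 0"
  proof (rule integral_weight_derivative_zero[OF G])
    show "(\<lambda>p. complex_of_real (?W p)) \<in> borel_measurable borel" by measurable
    show "norm (complex_of_real (?W p)) \<le> 1 / \<eta>\<^sup>2" for p using W[of p] by simp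
    show "complex_of_real (?W (x + t *\<^sub>R (1, 0))) = complex_of_real (?W x)" for x t
      by (simp add: hardy_weight_def)
  qed
  moreover have GW: "fd G p (1, 0) * complex_of_real (?W p)
      = of_real (?W p * (norm (F p))\<^sup>2 + ?W p * (2 * Re (fst p) * Re (X p * cnj (F p))))" for p
    unfolding fdG by (simp add: algebra_simps)
  ultimately have "complex_of_real (LBINT p. ?W p * (norm (F p))\<^sup>2 + ?W p * (2 * Re (fst p) * Re (X p * cnj (F p)))) = 0"
    by (simp only: integral_complex_of_real)
  then have z: "(LBINT p. ?W p * (norm (F p))\<^sup>2 + ?W p * (2 * Re (fst p) * Re (X p * cnj (F p)))) = 0"
    by (simp only: of_real_eq_0_iff)
  have Wc: "(\<lambda>p. complex_of_real (?W p)) \<in> borel_measurable borel" by measurable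
  have Wb: "norm (complex_of_real (?W p)) \<le> 1 / \<eta>\<^sup>2" for p using W[of p] by simp
  have iG: "integrable lborel (\<lambda>p. ?W p * (norm (F p))\<^sup>2 + ?W p * (2 * Re (fst p) * Re (X p * cnj (F p))))"
  proof -
    obtain R' where R': "\<And>x v. R' < norm x \<Longrightarrow> fd G x v = 0" using C1cE[OF G] by metis
    have "integrable lborel (\<lambda>p. fd G p (1, 0) * complex_of_real (?W p))"
      by (rule integrable_continuous_bounded_support[OF C1c_fd_continuous[OF G] R' Wc Wb])
    from integrable_Re[OF this] show ?thesis unfolding GW Re_complex_of_real .
  qed
  have iF: "integrable lborel (\<lambda>p. ?W p * (norm (F p))\<^sup>2)"
  proof -
    have R2: "F p * cnj (F p) = 0" if "R < norm p" for p using R(2)[OF that] by simp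
    have eq: "Re ((F p * cnj (F p)) * complex_of_real (?W p)) = ?W p * (norm (F p))\<^sup>2" for p
      unfolding cmod_power2 by (simp add: power2_eq_square algebra_simps)
    have "integrable lborel (\<lambda>p. (F p * cnj (F p)) * complex_of_real (?W p))"
      by (rule integrable_continuous_bounded_support[OF C1c_continuous[OF FFC] R2 Wc Wb])
    from integrable_Re[OF this] show ?thesis unfolding eq .
  qed
  note J = integral_dx_le_dbar[OF F]
  \<comment> \<open>the absorption, pointwise: \<open>2 W |x| |F\<^sub>x| |F| \<le> W |F|\<^sup>2 / 2 + 2 |F\<^sub>x|\<^sup>2\<close>\<close>
  have pt: "?W p * (norm (F p))\<^sup>2 / 2 - 2 * (norm (X p))\<^sup>2
      \<le> ?W p * (norm (F p))\<^sup>2 + ?W p * (2 * Re (fst p) * Re (X p * cnj (F p)))" for p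
  proof (cases "F p = 0 \<or> ?W p = 0")
    case False
    then have "p \<in> hartogs_triangle" using test_functionsD(3)[OF FT] by blast
    then have zw: "cmod (fst p) < cmod (snd p)" by (auto simp: hartogs_triangle_def)
    define s where "s = 1 / cmod (snd p)"
    have s: "?W p = s\<^sup>2" "s > 0" using False zw le_less_trans[OF norm_ge_zero zw]
      by (auto simp: hardy_weight_def s_def power_divide split: if_splits)
    have "\<bar>Re (fst p)\<bar> \<le> cmod (snd p)" using abs_Re_le_cmod[of "fst p"] zw by linarith
    then have "s * \<bar>Re (fst p)\<bar> \<le> 1" using s(2) by (simp add: s_def divide_le_eq)
    then have "s * (s * \<bar>Re (fst p)\<bar>) \<le> s * 1" using s(2) by (intro mult_left_mono) auto
    then have "?W p * \<bar>Re (fst p)\<bar> \<le> s" using s by (simp add: power2_eq_square)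
    moreover have "\<bar>Re (X p * cnj (F p))\<bar> \<le> norm (X p) * norm (F p)"
      using abs_Re_le_cmod[of "X p * cnj (F p)"] by (simp add: norm_mult)
    ultimately have key: "(?W p * \<bar>Re (fst p)\<bar>) * \<bar>Re (X p * cnj (F p))\<bar> \<le> s * (norm (X p) * norm (F p))"
      using s by (intro mult_mono) auto
    have "\<bar>?W p * (2 * Re (fst p) * Re (X p * cnj (F p)))\<bar> \<le> 2 * (s * norm (F p)) * norm (X p)"
    proof -
      have "\<bar>?W p * (2 * Re (fst p) * r)\<bar> = 2 * ((?W p * \<bar>Re (fst p)\<bar>) * \<bar>r\<bar>)" for r
        using W(1)[of p] by (simp add: abs_mult)
      then have "\<bar>?W p * (2 * Re (fst p) * Re (X p * cnj (F p)))\<bar>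
          = 2 * ((?W p * \<bar>Re (fst p)\<bar>) * \<bar>Re (X p * cnj (F p))\<bar>)" .
      also have "\<dots> \<le> 2 * (s * (norm (X p) * norm (F p)))" using key by linarith
      finally show ?thesis by (simp only: mult_ac)
    qed
    also have "\<dots> \<le> (s * norm (F p))\<^sup>2 / 2 + 2 * (norm (X p))\<^sup>2"
      using sum_squares_bound[of "s * norm (F p)" "2 * norm (X p)"] by (simp add: power_mult_distrib)
    finally show ?thesis using s(1) by (simp add: power_mult_distrib abs_le_iff)
  qed auto
  have "(LBINT p. ?W p * (norm (F p))\<^sup>2 / 2 - 2 * (norm (X p))\<^sup>2) \<le> 0"
    unfolding z[symmetric]
    by (rule integral_mono[OF _ iG pt]) (use iF J(2) in \<open>simp add: X_def\<close>)
  then have "(LBINT p. ?W p * (norm (F p))\<^sup>2) \<le> 4 * (LBINT p. (norm (X p))\<^sup>2)"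
    using iF J(2) by (simp add: X_def)
  also have "\<dots> \<le> 4 * (4 * (LBINT p. (norm (fst (dbar F p)))\<^sup>2))"
    using J(1) by (simp add: X_def)
  finally have "ennreal (LBINT p. ?W p * (norm (F p))\<^sup>2) \<le> ennreal (16 * (LBINT p. (norm (fst (dbar F p)))\<^sup>2))"
    by (intro ennreal_leI) simp
  also have "\<dots> = 16 * sqL2 (\<lambda>p. fst (dbar F p))"
    unfolding sqL2_def using nn_integral_eq_integral[OF J(3)] by (simp add: ennreal_mult)
  also have "ennreal (LBINT p. ?W p * (norm (F p))\<^sup>2) = (\<integral>\<^sup>+ p. ennreal (?W p * (norm (F p))\<^sup>2) \<partial>lborel)"
    by (rule nn_integral_eq_integral[OF iF, symmetric]) (intro AE_I2 mult_nonneg_nonneg W zero_le_power2)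
  finally show ?thesis .
qed

text \<open>The truncated weight is bounded, so the inequality for test functions is stable under limits in
  the graph norm. The constant grows because of the factors \<open>2\<close> in the triangle inequality;
  what matters is that it does not depend on \<open>\<eta>\<close>.\<close>

lemma hardy_approximable:
  assumes f[measurable]: "f \<in> borel_measurable borel" and h[measurable]: "h \<in> borel_measurable borel"
    and ap: "approximable f h" and \<eta>: "0 < \<eta>"
  shows "(\<integral>\<^sup>+ p. ennreal (hardy_weight \<eta> p * (norm (f p))\<^sup>2) \<partial>lborel) \<le> 64 * sqL2 (\<lambda>p. fst (h p))"
proof (rule ennreal_le_epsilon)
  let ?W = "hardy_weight \<eta>"
  note W = hardy_weight_bounds[OF \<eta>]
  fix d :: real assume "0 < d"
  define c where "c = 2 / \<eta>\<^sup>2 + 64"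
  have "c > 0" using \<eta> by (simp add: c_def add_pos_pos)
  define e where "e = d / c"
  have "e > 0" using \<open>0 < d\<close> \<open>c > 0\<close> by (simp add: e_def)
  obtain F where F: "F \<in> test_functions hartogs_triangle" "sqL2 (\<lambda>x. F x - f x) < ennreal e" "sqL2 (\<lambda>x. dbar F x - h x) < ennreal e"
    using ap \<open>e > 0\<close> unfolding approximable_def by blast
  have FC: "C1c F" "Ck (Suc 0) F" using test_functionsD(1,2)[OF F(1)] by blast+
  have [measurable]: "F \<in> borel_measurable borel" "dbar F \<in> borel_measurable borel"
    by (intro borel_measurable_continuous C1c_continuous continuous_dbar FC)+
  have "(\<integral>\<^sup>+ p. ennreal (?W p * (norm (f p))\<^sup>2) \<partial>lborel)
      \<le> (\<integral>\<^sup>+ p. ennreal (2 / \<eta>\<^sup>2) * ennreal ((norm (F p - f p))\<^sup>2) + 2 * ennreal (?W p * (norm (F p))\<^sup>2) \<partial>lborel)"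
  proof (rule nn_integral_mono)
    fix p
    have "?W p * (norm (f p))\<^sup>2 \<le> ?W p * (2 * (norm (f p - F p))\<^sup>2 + 2 * (norm (F p))\<^sup>2)"
      using norm_add_sq_le[of "f p - F p" "F p"] W(1) by (intro mult_left_mono) auto
    also have "\<dots> = ?W p * (2 * (norm (F p - f p))\<^sup>2) + 2 * (?W p * (norm (F p))\<^sup>2)"
      by (simp add: norm_minus_commute algebra_simps)
    also have "\<dots> \<le> 1 / \<eta>\<^sup>2 * (2 * (norm (F p - f p))\<^sup>2) + 2 * (?W p * (norm (F p))\<^sup>2)"
      by (intro add_mono[OF mult_right_mono[OF W(2)] order.refl]) simp
    finally have "ennreal (?W p * (norm (f p))\<^sup>2) \<le> ennreal (2 / \<eta>\<^sup>2 * (norm (F p - f p))\<^sup>2 + 2 * (?W p * (norm (F p))\<^sup>2))"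
      by (intro ennreal_leI) simp
    also have "\<dots> = ennreal (2 / \<eta>\<^sup>2) * ennreal ((norm (F p - f p))\<^sup>2) + 2 * ennreal (?W p * (norm (F p))\<^sup>2)"
    proof -
      have eq: "ennreal (x * y + 2 * z) = ennreal x * ennreal y + 2 * ennreal z" if "0 \<le> x" "0 \<le> y" "0 \<le> z" for x y z
        using that by (simp add: ennreal_mult)
      show ?thesis by (rule eq) (use W(1)[of p] \<eta> in auto)
    qed
    finally show "ennreal (?W p * (norm (f p))\<^sup>2) \<le> \<dots>" .
  qed
  also have "\<dots> = ennreal (2 / \<eta>\<^sup>2) * sqL2 (\<lambda>p. F p - f p) + 2 * (\<integral>\<^sup>+ p. ennreal (?W p * (norm (F p))\<^sup>2) \<partial>lborel)"
    unfolding sqL2_def by (subst nn_integral_add) (auto simp: nn_integral_cmult)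
  also have "\<dots> \<le> ennreal (2 / \<eta>\<^sup>2) * ennreal e + 2 * (16 * sqL2 (\<lambda>p. fst (dbar F p)))"
    by (intro add_mono mult_left_mono hardy_test_function F(1) \<eta> less_imp_le[OF F(2)]) auto
  also have "sqL2 (\<lambda>p. fst (dbar F p)) \<le> 2 * sqL2 (\<lambda>p. fst (dbar F p) - fst (h p)) + 2 * sqL2 (\<lambda>p. fst (h p))"
    using sqL2_add[of "\<lambda>p. fst (dbar F p) - fst (h p)" "\<lambda>p. fst (h p)"] by simp
  also have "sqL2 (\<lambda>p. fst (dbar F p) - fst (h p)) \<le> sqL2 (\<lambda>p. dbar F p - h p)"
    using sqL2_prod[of "\<lambda>p. dbar F p - h p"] by simp
  also have "sqL2 (\<lambda>p. dbar F p - h p) \<le> ennreal e" using F(3) by simp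
  also have "ennreal (2 / \<eta>\<^sup>2) * ennreal e + 2 * (16 * (2 * ennreal e + 2 * sqL2 (\<lambda>p. fst (h p))))
      = 64 * sqL2 (\<lambda>p. fst (h p)) + ennreal ((2 / \<eta>\<^sup>2) * e + 64 * e)"
  proof -
    have "ennreal ((2 / \<eta>\<^sup>2) * e + 64 * e) = ennreal (2 / \<eta>\<^sup>2) * ennreal e + 64 * ennreal e"
    proof -
      have eq: "ennreal (x * y + 64 * y) = ennreal x * ennreal y + 64 * ennreal y" if "0 \<le> x" "0 \<le> y" for x y
        using that by (simp add: ennreal_mult)
      show ?thesis by (rule eq) (use \<open>e > 0\<close> \<eta> in auto)
    qed
    moreover have "2 * (16 * (2 * ennreal e + 2 * sqL2 (\<lambda>p. fst (h p)))) = 64 * ennreal e + 64 * sqL2 (\<lambda>p. fst (h p))"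
      by (simp add: distrib_left flip: mult.assoc)
    ultimately show ?thesis by (simp add: add_ac)
  qed
  also have "(2 / \<eta>\<^sup>2) * e + 64 * e = d"
  proof -
    have "(2 / \<eta>\<^sup>2) * e + 64 * e = c * e" by (simp add: c_def distrib_right)
    then show ?thesis using \<open>c > 0\<close> by (simp add: e_def)
  qed
  finally show "(\<integral>\<^sup>+ p. ennreal (?W p * (norm (f p))\<^sup>2) \<partial>lborel) \<le> 64 * sqL2 (\<lambda>p. fst (h p)) + ennreal d"
    by (simp add: add_mono mult_left_mono)
qed

section \<open>Cutting off the origin\<close>

lemma weak_dbar_mult:
  assumes f[measurable]: "f \<in> borel_measurable borel" and h[measurable]: "h \<in> borel_measurable borel"
    and fin: "sqL2 f < \<infinity>" "sqL2 h < \<infinity>" and wd: "weak_dbar f h" and \<rho>: "\<And>k. Ck k \<rho>"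
  shows "weak_dbar (\<lambda>p. \<rho> p * f p)
    (\<lambda>p. (\<rho> p * fst (h p) + f p * fst (dbar \<rho> p), \<rho> p * snd (h p) + f p * snd (dbar \<rho> p)))"
  unfolding weak_dbar_def
proof
  fix \<phi> :: "C2 \<Rightarrow> complex" assume \<phi>: "\<phi> \<in> test_functions UNIV"
  have C: "C1c \<phi>" "\<And>k. Ck k \<phi>" using test_functionsD(1,2)[OF \<phi>] by blast+
  obtain R where R: "R > 0" "\<And>x. R < norm x \<Longrightarrow> \<phi> x = 0" "\<And>x v. R < norm x \<Longrightarrow> fd \<phi> x v = 0"
    using C1cE[OF C(1)] by blast
  have dR: "dbar \<phi> p = 0" if "R < norm p" for p using R(3)[OF that] by (simp add: dbar_def prod_eq_iff)
  have c\<rho>: "continuous_on UNIV \<rho>" "continuous_on UNIV (dbar \<rho>)"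
    using \<rho>[of 0] continuous_dbar[OF \<rho>] by auto
  have c\<phi>: "continuous_on UNIV \<phi>" "continuous_on UNIV (dbar \<phi>)"
    using C1c_continuous[OF C(1)] continuous_dbar[OF C(2)] by auto
  have T: "(\<lambda>p. \<rho> p * \<phi> p) \<in> test_functions UNIV"
    by (rule test_functions_UNIV_I[of _ R]) (auto intro: Ck_mult \<rho> C(2) simp: R(2))
  have d: "dbar (\<lambda>p. \<rho> p * \<phi> p) p = (\<rho> p * fst (dbar \<phi> p) + fst (dbar \<rho> p) * \<phi> p, \<rho> p * snd (dbar \<phi> p) + snd (dbar \<rho> p) * \<phi> p)" for p
    unfolding dbar_def fst_conv snd_conv fd_mult[OF \<rho>[of "Suc 0"] C(2)[of "Suc 0"]]
    by (simp add: field_simps)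
  have n2h: "sqL2 (\<lambda>p. fst (h p)) < \<infinity>" "sqL2 (\<lambda>p. snd (h p)) < \<infinity>"
    using fin(2) unfolding sqL2_prod[OF h] by auto
  have int: "integrable lborel (\<lambda>p. u p * g p)"
    if u: "u \<in> borel_measurable borel" "sqL2 u < \<infinity>" and g: "continuous_on UNIV g" "\<And>p. R < norm p \<Longrightarrow> g p = 0"
    for u g :: "C2 \<Rightarrow> complex"
  proof -
    obtain B where B: "B > 0" "\<And>x. norm (g x) \<le> B" using bounded_bounded_support[OF g] by blast
    show ?thesis
      by (rule L2_mult_integrable[OF u(1) borel_measurable_continuous[OF g(1)] u(2) sqL2_bounded_support_finite[OF B(2) g(2)]])
  qed
  have main: "(LBINT p. \<rho> p * f p * A p) = - (LBINT p. (\<rho> p * H p + f p * E p) * \<phi> p)"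
    if w: "(LBINT p. f p * (\<rho> p * A p + E p * \<phi> p)) = - (LBINT p. H p * (\<rho> p * \<phi> p))"
      and H: "H \<in> borel_measurable borel" "sqL2 H < \<infinity>"
      and A: "continuous_on UNIV A" "\<And>p. R < norm p \<Longrightarrow> A p = 0" and E: "continuous_on UNIV E" for A E H
  proof -
    have i1: "integrable lborel (\<lambda>p. f p * (\<rho> p * A p))"
      by (rule int[OF f fin(1)]) (auto intro!: continuous_intros c\<rho> A(1) simp: A(2))
    have i2: "integrable lborel (\<lambda>p. f p * (E p * \<phi> p))"
      by (rule int[OF f fin(1)]) (auto intro!: continuous_intros c\<phi> E simp: R(2))
    have i3: "integrable lborel (\<lambda>p. H p * (\<rho> p * \<phi> p))"
      by (rule int[OF H]) (auto intro!: continuous_intros c\<phi> c\<rho> simp: R(2))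
    have "(LBINT p. f p * (\<rho> p * A p)) + (LBINT p. f p * (E p * \<phi> p)) = - (LBINT p. H p * (\<rho> p * \<phi> p))"
      using w Bochner_Integration.integral_add[OF i1 i2] by (simp add: distrib_left)
    moreover have "(LBINT p. (\<rho> p * H p + f p * E p) * \<phi> p)
        = (LBINT p. H p * (\<rho> p * \<phi> p)) + (LBINT p. f p * (E p * \<phi> p))"
      using Bochner_Integration.integral_add[OF i3 i2] by (simp add: algebra_simps)
    moreover have "(LBINT p. \<rho> p * f p * A p) = (LBINT p. f p * (\<rho> p * A p))"
      by (simp add: mult_ac)
    moreover have "l = - r" if "a + b = - c" "r = c + b" "l = a" for a b c l r :: complex
      using that by algebra
    ultimately show ?thesis by blast
  qed
  have w: "(LBINT p. f p * fst (dbar (\<lambda>p. \<rho> p * \<phi> p) p)) = - (LBINT p. fst (h p) * (\<rho> p * \<phi> p))"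
     "(LBINT p. f p * snd (dbar (\<lambda>p. \<rho> p * \<phi> p) p)) = - (LBINT p. snd (h p) * (\<rho> p * \<phi> p))"
    using wd T unfolding weak_dbar_def by blast+
  note w' = w[unfolded d fst_conv snd_conv]
  have "(LBINT p. \<rho> p * f p * fst (dbar \<phi> p)) = - (LBINT p. (\<rho> p * fst (h p) + f p * fst (dbar \<rho> p)) * \<phi> p)"
    by (rule main[OF w'(1) _ n2h(1)]) (auto intro!: continuous_intros c\<phi> c\<rho> simp: dR)
  moreover have "(LBINT p. \<rho> p * f p * snd (dbar \<phi> p)) = - (LBINT p. (\<rho> p * snd (h p) + f p * snd (dbar \<rho> p)) * \<phi> p)"
    by (rule main[OF w'(2) _ n2h(2)]) (auto intro!: continuous_intros c\<phi> c\<rho> simp: dR)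
  ultimately show "(LBINT p. \<rho> p * f p * fst (dbar \<phi> p))
      = - (LBINT p. fst (\<rho> p * fst (h p) + f p * fst (dbar \<rho> p), \<rho> p * snd (h p) + f p * snd (dbar \<rho> p)) * \<phi> p)
    \<and> (LBINT p. \<rho> p * f p * snd (dbar \<phi> p))
      = - (LBINT p. snd (\<rho> p * fst (h p) + f p * fst (dbar \<rho> p), \<rho> p * snd (h p) + f p * snd (dbar \<rho> p)) * \<phi> p)"
    by simp
qed

text \<open>The function $\exp(-1/(c|w|^2 - 1))$, which for $c > 0$ vanishes where $|w| \le c^{-1/2}$ and tends to \<open>1\<close> for
  $w \ne 0$ as \<open>c\<close> tends to infinity.\<close>

definition cutoff :: "real \<Rightarrow> C2 \<Rightarrow> complex" where
  "cutoff c p = of_real (flat 0 (c * (cmod (snd p))\<^sup>2 - 1))"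

lemma cutoff_quadratic_derivative:
  "((\<lambda>p::C2. c * (cmod (snd p))\<^sup>2 - 1) has_derivative (\<lambda>v. c * (2 * (snd p \<bullet> snd v)))) (at p)"
  unfolding power2_norm_eq_inner
  by (auto intro!: derivative_eq_intros simp: inner_commute)

lemma Ck_cutoff: "Ck k (cutoff c)"
  unfolding cutoff_def
proof (rule Ck_flat_compose[OF cutoff_quadratic_derivative])
  fix v :: "C2" and j
  have "bounded_linear (\<lambda>p::C2. c * (2 * (snd p \<bullet> snd v)))"
    by (intro bounded_linear_const_mult bounded_linear_inner_left_comp bounded_linear_snd)
  from bounded_linear_compose[OF bounded_linear_of_real this]
  show "Ck j (\<lambda>p :: C2. complex_of_real (c * (2 * (snd p \<bullet> snd v))))" by (rule Ck_linear)
qed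

text \<open>With $t = c|w|^2 - 1$ the second component has modulus $c |w|\,e^{-1/t}/t^2 = (t+1)e^{-1/t}/(t^2|w|)$.
  Bounding $(t+1)e^{-1/t}/t^2$ by a constant is what makes the cutoff cost at most
  $2/|w|$, at every scale.\<close>

lemma dbar_cutoff: "dbar (cutoff c) p = (0, of_real (c * flat 2 (c * (cmod (snd p))\<^sup>2 - 1)) * snd p)"
proof -
  have "fd (cutoff c) p v = of_real (flat 2 (c * (cmod (snd p))\<^sup>2 - 1)) * of_real (c * (2 * (snd p \<bullet> snd v)))" for v
    using fun_cong[OF frechet_derivative_at[OF flat_compose_has_derivative[OF cutoff_quadratic_derivative[of c p], of 0]], of v]
    unfolding cutoff_def[abs_def] by (simp add: numeral_2_eq_2)
  then show ?thesis
    unfolding dbar_def by (simp add: complex_eq_iff inner_complex_def)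
qed

lemma flat_0_bounds: "0 \<le> flat 0 t" "flat 0 t \<le> 1"
  by (auto simp: flat_def)

lemma flat_2_eq:
  assumes "0 < t"
  shows "flat 2 t * (t + 1) = (inverse t + (inverse t)\<^sup>2) * exp (- inverse t)"
proof -
  have f: "flat 2 t = inverse t * inverse t * exp (- inverse t)"
    using assms by (simp add: flat_def power2_eq_square)
  have "flat 2 t * (t + 1) = (inverse t * (inverse t * t) + (inverse t)\<^sup>2) * exp (- inverse t)"
    unfolding f power2_eq_square by (simp only: algebra_simps mult_1 mult_1_right)
  also have "inverse t * t = 1" using assms by simp
  finally show ?thesis by simp
qed

lemma flat_2_bound: "flat 2 t * (t + 1) \<le> 2"
proof (cases "t > 0")
  case True
  have "(inverse t + (inverse t)\<^sup>2) * exp (- inverse t) \<le> (2 * exp (inverse t)) * exp (- inverse t)"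
  proof (rule mult_right_mono)
    have "inverse t > 0" using True by simp
    then show "inverse t + (inverse t)\<^sup>2 \<le> 2 * exp (inverse t)"
      using exp_lower_Taylor_quadratic[of "inverse t"] by linarith
  qed simp
  also have "\<dots> = 2" by (simp add: exp_minus)
  finally show ?thesis using flat_2_eq[OF True] by simp
qed (simp add: flat_def)

lemma flat_2_bound':
  assumes "0 < t"
  shows "flat 2 t * (t + 1) \<le> inverse t + (inverse t)\<^sup>2"
  unfolding flat_2_eq[OF assms] using assms by (intro mult_right_le_one_le) auto

lemma norm_cutoff: "norm (cutoff c p) \<le> 1" "norm (cutoff c p - 1) \<le> 1"
proof -
  have "cutoff c p - 1 = of_real (flat 0 (c * (cmod (snd p))\<^sup>2 - 1) - 1)" by (simp add: cutoff_def)
  then show "norm (cutoff c p) \<le> 1" "norm (cutoff c p - 1) \<le> 1"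
    using flat_0_bounds[of "c * (cmod (snd p))\<^sup>2 - 1"] unfolding cutoff_def by (simp_all only: norm_of_real)
qed

lemma norm_dbar_cutoff:
  assumes "0 < c"
  shows "norm (snd (dbar (cutoff c) p)) * cmod (snd p) = flat 2 (c * (cmod (snd p))\<^sup>2 - 1) * ((c * (cmod (snd p))\<^sup>2 - 1) + 1)"
  unfolding dbar_cutoff using assms flat_nonneg[of 2]
  by (simp add: norm_mult power2_eq_square)

lemma quadratic_at_top:
  assumes "a > (0::real)"
  shows "filterlim (\<lambda>n. (real (Suc n))\<^sup>2 * a - 1) at_top sequentially"
proof -
  have "filterlim (\<lambda>n. real (Suc n)) at_top sequentially"
    using filterlim_Suc filterlim_real_sequentially by (rule filterlim_compose[rotated])
  then have "filterlim (\<lambda>n. real (Suc n) ^ 2) at_top sequentially" by (intro filterlim_pow_at_top) auto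
  then have "filterlim (\<lambda>n. (real (Suc n))\<^sup>2 * a) at_top sequentially"
    using assms by (intro filterlim_at_top_mult_tendsto_pos[OF tendsto_const, of a]) (auto)
  then have "filterlim (\<lambda>n. - 1 + (real (Suc n))\<^sup>2 * a) at_top sequentially"
    by (rule filterlim_tendsto_add_at_top[OF tendsto_const])
  then show ?thesis by (simp del: of_nat_Suc)
qed

lemma cutoff_tendsto_1:
  assumes "snd p \<noteq> 0"
  shows "(\<lambda>n. cutoff ((real (Suc n))\<^sup>2) p) \<longlonglongrightarrow> 1"
proof -
  define t where "t n = (real (Suc n))\<^sup>2 * (cmod (snd p))\<^sup>2 - 1" for n
  have top: "filterlim t at_top sequentially"
    unfolding t_def using assms by (intro quadratic_at_top) simp
  have "(\<lambda>n. exp (- inverse (t n))) \<longlonglongrightarrow> exp (- 0)"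
    by (intro tendsto_intros tendsto_inverse_0_at_top top)
  moreover have "eventually (\<lambda>n. t n > 0) sequentially" using top by (simp add: filterlim_at_top_dense)
  then have "eventually (\<lambda>n. exp (- inverse (t n)) = flat 0 (t n)) sequentially"
    by eventually_elim (simp add: flat_def)
  ultimately have "(\<lambda>n. flat 0 (t n)) \<longlonglongrightarrow> 1" by (simp add: tendsto_cong)
  then have "(\<lambda>n. complex_of_real (flat 0 (t n))) \<longlonglongrightarrow> of_real 1" by (rule tendsto_of_real)
  then show ?thesis by (simp add: cutoff_def t_def)
qed

lemma dbar_cutoff_tendsto_0:
  assumes "snd p \<noteq> 0"
  shows "(\<lambda>n. snd (dbar (cutoff ((real (Suc n))\<^sup>2)) p)) \<longlonglongrightarrow> 0"
proof -
  define t where "t n = (real (Suc n))\<^sup>2 * (cmod (snd p))\<^sup>2 - 1" for n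
  have top: "filterlim t at_top sequentially"
    unfolding t_def using assms by (intro quadratic_at_top) simp
  have "(\<lambda>n. (inverse (t n) + (inverse (t n))\<^sup>2) / cmod (snd p)) \<longlonglongrightarrow> (0 + 0\<^sup>2) / cmod (snd p)"
    using assms by (intro tendsto_intros tendsto_inverse_0_at_top top) auto
  then have lim: "(\<lambda>n. (inverse (t n) + (inverse (t n))\<^sup>2) / cmod (snd p)) \<longlonglongrightarrow> 0" by simp
  have ev: "eventually (\<lambda>n. t n > 0) sequentially" using top by (simp add: filterlim_at_top_dense)
  show ?thesis
  proof (rule Lim_null_comparison[OF _ lim])
    show "eventually (\<lambda>n. norm (snd (dbar (cutoff ((real (Suc n))\<^sup>2)) p)) \<le> (inverse (t n) + (inverse (t n))\<^sup>2) / cmod (snd p)) sequentially"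
      using ev
    proof eventually_elim
      case (elim n)
      have "norm (snd (dbar (cutoff ((real (Suc n))\<^sup>2)) p)) * cmod (snd p) = flat 2 (t n) * (t n + 1)"
        unfolding t_def by (rule norm_dbar_cutoff) simp
      also have "\<dots> \<le> inverse (t n) + (inverse (t n))\<^sup>2" by (rule flat_2_bound'[OF elim])
      finally show ?case using assms by (simp add: pos_le_divide_eq)
    qed
  qed
qed

lemma AE_snd_nonzero: "AE p in lborel. snd (p :: C2) \<noteq> 0"
proof -
  have "(0, 1) \<in> (Basis :: C2 set)" by (simp add: Basis_prod_def Basis_complex_def)
  then have "negligible {p :: C2. p \<bullet> (0, 1) = 0}"
    by (rule negligible_standard_hyperplane)
  then have "negligible {p :: C2. snd p = 0}"
    by (rule negligible_subset) auto
  then have "{p :: C2. snd p = 0} \<in> null_sets lebesgue"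
    by (simp add: negligible_iff_null_sets)
  then have "AE p in lebesgue. p \<notin> {p :: C2. snd p = 0}" by (rule AE_not_in)
  then show ?thesis by (simp add: AE_completion_iff)
qed

lemma approximable_limit:
  assumes [measurable]: "f \<in> borel_measurable borel" "h \<in> borel_measurable borel"
    "\<And>n. u n \<in> borel_measurable borel" "\<And>n. v n \<in> borel_measurable borel"
    and ap: "\<And>n. approximable (u n) (v n)"
    and lim: "(\<lambda>n. sqL2 (\<lambda>p. u n p - f p)) \<longlonglongrightarrow> 0" "(\<lambda>n. sqL2 (\<lambda>p. v n p - h p)) \<longlonglongrightarrow> 0"
  shows "approximable f h"
  unfolding approximable_def
proof (intro allI impI)
  fix e :: real assume "e > 0"
  then have e4: "0 < e / 4" "0 < ennreal (e / 4)" by auto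
  have "eventually (\<lambda>n. sqL2 (\<lambda>p. u n p - f p) < ennreal (e / 4) \<and> sqL2 (\<lambda>p. v n p - h p) < ennreal (e / 4)) sequentially"
    using order_tendstoD(2)[OF lim(1) e4(2)] order_tendstoD(2)[OF lim(2) e4(2)] by (rule eventually_conj)
  then obtain n where n: "sqL2 (\<lambda>p. u n p - f p) < ennreal (e / 4)" "sqL2 (\<lambda>p. v n p - h p) < ennreal (e / 4)"
    using eventually_happens'[OF sequentially_bot] by fast
  obtain F where F: "F \<in> test_functions hartogs_triangle" "sqL2 (\<lambda>x. F x - u n x) < ennreal (e / 4)"
      "sqL2 (\<lambda>x. dbar F x - v n x) < ennreal (e / 4)"
    using ap[of n] e4(1) unfolding approximable_def by blast
  have FC: "C1c F" "Ck (Suc 0) F" using test_functionsD(1,2)[OF F(1)] by blast+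
  have [measurable]: "F \<in> borel_measurable borel" "dbar F \<in> borel_measurable borel"
    by (intro borel_measurable_continuous C1c_continuous continuous_dbar FC)+
  have "sqL2 (\<lambda>x. F x - f x) \<le> 2 * sqL2 (\<lambda>x. F x - u n x) + 2 * sqL2 (\<lambda>x. u n x - f x)"
    by (rule sqL2_diff_triangle) measurable
  also have "\<dots> < ennreal e" by (rule ennreal_add_lt_quarters[OF F(2) n(1)])
  finally have 1: "sqL2 (\<lambda>x. F x - f x) < ennreal e" .
  have "sqL2 (\<lambda>x. dbar F x - h x) \<le> 2 * sqL2 (\<lambda>x. dbar F x - v n x) + 2 * sqL2 (\<lambda>x. v n x - h x)"
    by (rule sqL2_diff_triangle) measurable
  also have "\<dots> < ennreal e" by (rule ennreal_add_lt_quarters[OF F(3) n(2)])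
  finally show "\<exists>F\<in>test_functions hartogs_triangle. sqL2 (\<lambda>x. F x - f x) < ennreal e \<and> sqL2 (\<lambda>x. dbar F x - h x) < ennreal e"
    using F(1) 1 by blast
qed

text \<open>Each \<open>\<rho> n * f\<close> is approximable because it vanishes near $w = 0$. The Hardy inequality for these
  functions, with the truncation of the weight removed along the same sequence, shows
  $f/|w| \in L^2$. This function dominates the error terms \<open>f * dbar (\<rho> n)\<close>, so the functions
  \<open>\<rho> n * f\<close> converge to \<open>f\<close> in the graph norm.\<close>

lemma weak_dbar_imp_approximable:
  assumes f[measurable]: "f \<in> borel_measurable borel" and h[measurable]: "h \<in> borel_measurable borel"
    and fin: "sqL2 f < \<infinity>" "sqL2 h < \<infinity>" and wd: "weak_dbar f h"
    and supp: "\<And>p. f p \<noteq> 0 \<Longrightarrow> p \<in> hartogs_triangle"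
  shows "approximable f h"
proof -
  define c where "c n = (real (Suc n))\<^sup>2" for n
  have c: "c n > 0" for n by (simp add: c_def)
  define \<rho> where "\<rho> n = cutoff (c n)" for n
  define u where "u n p = \<rho> n p * f p" for n p
  define v where "v n p = (\<rho> n p * fst (h p) + f p * fst (dbar (\<rho> n) p), \<rho> n p * snd (h p) + f p * snd (dbar (\<rho> n) p))" for n p
  have \<rho>C: "Ck k (\<rho> n)" for k n unfolding \<rho>_def by (rule Ck_cutoff)
  have [measurable]: "\<rho> n \<in> borel_measurable borel" "dbar (\<rho> n) \<in> borel_measurable borel" for n
    using borel_measurable_continuous[OF continuous_dbar[OF \<rho>C]] borel_measurable_continuous[of "\<rho> n"] \<rho>C[of 0 n] by auto
  have um[measurable]: "u n \<in> borel_measurable borel" for n unfolding u_def by measurable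
  have vm[measurable]: "v n \<in> borel_measurable borel" for n unfolding v_def by measurable
  have fst0: "fst (dbar (\<rho> n) p) = 0" for n p by (simp add: \<rho>_def dbar_cutoff)
  have \<rho>1: "norm (\<rho> n p) \<le> 1" "norm (\<rho> n p - 1) \<le> 1" for n p unfolding \<rho>_def by (rule norm_cutoff)+
  have \<rho>b: "norm (snd (dbar (\<rho> n) p)) * cmod (snd p) \<le> 2" for n p
    unfolding \<rho>_def norm_dbar_cutoff[OF c] by (rule flat_2_bound)
  have n2h: "sqL2 (\<lambda>p. fst (h p)) < \<infinity>" "sqL2 (\<lambda>p. snd (h p)) < \<infinity>"
    using fin(2) unfolding sqL2_prod[OF h] by auto
  have supp': "cmod (fst p) < cmod (snd p)" "cmod (snd p) < 1" if "f p \<noteq> 0" for p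
    using supp[OF that] by (auto simp: hartogs_triangle_def)
  have snd0: "snd p \<noteq> 0" if "f p \<noteq> 0" for p
    using supp'(1)[OF that] norm_ge_zero[of "fst p"] by auto
  have usupp: "cmod (fst p) \<le> cmod (snd p) \<and> cmod (snd p) \<le> 1 \<and> 1 / real (Suc n) \<le> cmod (snd p)"
    if "u n p \<noteq> 0" for n p
  proof -
    have "f p \<noteq> 0" "\<rho> n p \<noteq> 0" using that by (auto simp: u_def)
    then have "c n * (cmod (snd p))\<^sup>2 - 1 > 0" by (auto simp: \<rho>_def cutoff_def flat_def split: if_splits)
    then have "1\<^sup>2 < (real (Suc n) * cmod (snd p))\<^sup>2" by (simp add: c_def power_mult_distrib del: of_nat_Suc)
    then have "1 < real (Suc n) * cmod (snd p)" by (rule power_less_imp_less_base) simp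
    then have "1 / real (Suc n) \<le> cmod (snd p)" by (simp add: divide_le_eq mult.commute del: of_nat_Suc)
    with supp'[OF \<open>f p \<noteq> 0\<close>] show ?thesis by simp
  qed
  have n2u: "sqL2 (u n) < \<infinity>" for n
  proof -
    have "sqL2 (u n) \<le> sqL2 f"
      by (rule sqL2_mono) (use \<rho>1(1) in \<open>auto simp: u_def norm_mult intro: mult_left_le_one_le\<close>)
    with fin(1) show ?thesis by (rule order.strict_trans1[rotated])
  qed
  have n2v: "sqL2 (v n) < \<infinity>" for n
  proof -
    have 1: "sqL2 (\<lambda>p. fst (v n p)) \<le> sqL2 (\<lambda>p. fst (h p))"
      by (rule sqL2_mono) (use \<rho>1(1) in \<open>auto simp: v_def fst0 norm_mult intro: mult_left_le_one_le\<close>)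
    have 2: "sqL2 (\<lambda>p. \<rho> n p * snd (h p)) \<le> sqL2 (\<lambda>p. snd (h p))"
      by (rule sqL2_mono) (use \<rho>1(1) in \<open>auto simp: norm_mult intro: mult_left_le_one_le\<close>)
    have 3: "sqL2 (\<lambda>p. f p * snd (dbar (\<rho> n) p)) \<le> sqL2 (\<lambda>p. of_real (2 * real (Suc n)) * f p)"
    proof (rule sqL2_mono)
      fix p
      have "norm (snd (dbar (\<rho> n) p)) \<le> 2 * real (Suc n)"
      proof (cases "1 / real (Suc n) \<le> cmod (snd p)")
        case True
        have "norm (snd (dbar (\<rho> n) p)) * (1 / real (Suc n)) \<le> norm (snd (dbar (\<rho> n) p)) * cmod (snd p)"
          by (intro mult_left_mono True) auto
        with \<rho>b[of n p] have "norm (snd (dbar (\<rho> n) p)) * (1 / real (Suc n)) \<le> 2" by linarith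
        then show ?thesis by (simp add: divide_le_eq del: of_nat_Suc)
      next
        case False
        then have "cmod (snd p) * real (Suc n) \<le> 1" by (simp add: divide_le_eq not_le less_divide_eq del: of_nat_Suc)
        then have "(real (Suc n) * cmod (snd p))\<^sup>2 \<le> 1\<^sup>2" by (intro power_mono) (auto simp: mult.commute)
        then have "c n * (cmod (snd p))\<^sup>2 - 1 \<le> 0" by (simp add: c_def power_mult_distrib del: of_nat_Suc)
        then have "snd (dbar (\<rho> n) p) = 0" unfolding \<rho>_def dbar_cutoff by (simp add: flat_def)
        then show ?thesis by simp
      qed
      from mult_left_mono[OF this norm_ge_zero[of "f p"]]
      show "norm (f p * snd (dbar (\<rho> n) p)) \<le> norm (of_real (2 * real (Suc n)) * f p)"
        unfolding norm_mult norm_of_real by (simp add: mult.commute del: of_nat_Suc)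
    qed
    also have "\<dots> = ennreal ((norm (complex_of_real (2 * real (Suc n))))\<^sup>2) * sqL2 f" by (rule sqL2_cmult[OF f])
    also have "\<dots> < \<infinity>" using fin(1) by (simp add: ennreal_mult_less_top)
    finally have 3: "sqL2 (\<lambda>p. f p * snd (dbar (\<rho> n) p)) < \<infinity>" .
    have "sqL2 (\<lambda>p. snd (v n p)) \<le> 2 * sqL2 (\<lambda>p. \<rho> n p * snd (h p)) + 2 * sqL2 (\<lambda>p. f p * snd (dbar (\<rho> n) p))"
      unfolding v_def snd_conv by (rule sqL2_add) measurable
    also have "\<dots> < \<infinity>" using 3 order.strict_trans1[OF 2 n2h(2)] by (simp add: ennreal_mult_less_top)
    finally show ?thesis using order.strict_trans1[OF 1 n2h(1)] unfolding sqL2_prod[OF vm] by simp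
  qed
  have ap: "approximable (u n) (v n)" for n
  proof (rule approximable_if_away_from_origin[OF um vm n2u n2v])
    show "weak_dbar (u n) (v n)"
      unfolding u_def v_def by (rule weak_dbar_mult[OF f h fin wd \<rho>C])
    show "0 < 1 / real (Suc n)" "1 / real (Suc n) \<le> 1" by auto
  qed (rule usupp)
  \<comment> \<open>where \<open>w = 0\<close>, division by zero gives \<open>0\<close>; this is harmless because \<open>f\<close> vanishes there\<close>
  define g where "g p = 1 / (cmod (snd p))\<^sup>2 * (norm (f p))\<^sup>2" for p
  have hardy: "(\<integral>\<^sup>+ p. ennreal (g p) \<partial>lborel) \<le> 64 * sqL2 (\<lambda>p. fst (h p))"
  proof -
    define s where "s n p = ennreal (hardy_weight (1 / real (Suc n)) p * (norm (u n p))\<^sup>2)" for n p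
    have [measurable]: "s n \<in> borel_measurable borel" for n unfolding s_def by measurable
    have lim: "(\<lambda>n. s n p) \<longlonglongrightarrow> ennreal (g p)" for p
    proof (cases "f p = 0")
      case True
      then show ?thesis by (simp add: s_def g_def u_def)
    next
      case False
      note p = snd0[OF False]
      have "(\<lambda>n. \<rho> n p * f p) \<longlonglongrightarrow> 1 * f p"
        unfolding \<rho>_def c_def by (intro tendsto_intros cutoff_tendsto_1 p)
      then have U: "(\<lambda>n. u n p) \<longlonglongrightarrow> f p" by (simp add: u_def)
      have "(\<lambda>n. 1 / (cmod (snd p))\<^sup>2 * (norm (u n p))\<^sup>2) \<longlonglongrightarrow> 1 / (cmod (snd p))\<^sup>2 * (norm (f p))\<^sup>2"
        by (intro tendsto_intros U)
      then have 1: "(\<lambda>n. ennreal (1 / (cmod (snd p))\<^sup>2 * (norm (u n p))\<^sup>2)) \<longlonglongrightarrow> ennreal (g p)"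
        unfolding g_def by (rule tendsto_ennrealI)
      have "(\<lambda>n. 1 / real (Suc n)) \<longlonglongrightarrow> 0" by (rule LIMSEQ_Suc[OF lim_1_over_n])
      then have "eventually (\<lambda>n. 1 / real (Suc n) < cmod (snd p)) sequentially"
        using p by (intro order_tendstoD(2)) auto
      then have "eventually (\<lambda>n. ennreal (1 / (cmod (snd p))\<^sup>2 * (norm (u n p))\<^sup>2) = s n p) sequentially"
        by eventually_elim (simp add: s_def hardy_weight_def)
      with 1 show ?thesis by (rule Lim_transform_eventually)
    qed
    have "(\<integral>\<^sup>+ p. ennreal (g p) \<partial>lborel) = (\<integral>\<^sup>+ p. liminf (\<lambda>n. s n p) \<partial>lborel)"
      using lim_imp_Liminf[OF sequentially_bot lim] by simp
    also have "\<dots> \<le> liminf (\<lambda>n. \<integral>\<^sup>+ p. s n p \<partial>lborel)"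
      by (rule nn_integral_liminf) measurable
    also have "\<dots> \<le> liminf (\<lambda>n. 64 * sqL2 (\<lambda>p. fst (h p)))"
    proof (intro Liminf_mono always_eventually allI)
      fix n
      have "(\<integral>\<^sup>+ p. s n p \<partial>lborel) \<le> 64 * sqL2 (\<lambda>p. fst (v n p))"
        unfolding s_def by (rule hardy_approximable[OF um vm ap]) simp
      also have "\<dots> \<le> 64 * sqL2 (\<lambda>p. fst (h p))"
        by (intro mult_left_mono sqL2_mono) (use \<rho>1(1) in \<open>auto simp: v_def fst0 norm_mult intro: mult_left_le_one_le\<close>)
      finally show "(\<integral>\<^sup>+ p. s n p \<partial>lborel) \<le> 64 * sqL2 (\<lambda>p. fst (h p))" .
    qed
    also have "\<dots> = 64 * sqL2 (\<lambda>p. fst (h p))" by (simp add: Liminf_const)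
    finally show ?thesis .
  qed
  define q where "q p = norm (f p) / cmod (snd p)" for p
  have [measurable]: "q \<in> borel_measurable borel" unfolding q_def by measurable
  have n2q: "sqL2 q < \<infinity>"
  proof -
    have "sqL2 q = (\<integral>\<^sup>+ p. ennreal (g p) \<partial>lborel)"
      unfolding sqL2_def q_def g_def by (simp add: power_divide)
    also have "\<dots> \<le> 64 * sqL2 (\<lambda>p. fst (h p))" by (rule hardy)
    also have "\<dots> < \<infinity>" using n2h(1) by (simp add: ennreal_mult_less_top)
    finally show ?thesis .
  qed
  have lim_u: "(\<lambda>n. sqL2 (\<lambda>p. u n p - f p)) \<longlonglongrightarrow> 0"
  proof (rule sqL2_dominated_convergence[where w = "\<lambda>p. norm (f p)"])
    show "norm (u n p - f p) \<le> norm (f p)" for n p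
    proof -
      have "u n p - f p = (\<rho> n p - 1) * f p" by (simp add: u_def algebra_simps)
      then show ?thesis using \<rho>1(2)[of n p] by (simp add: norm_mult mult_left_le_one_le)
    qed
    show "sqL2 (\<lambda>p. norm (f p)) < \<infinity>" using fin(1) by (simp add: sqL2_def)
    show "AE p in lborel. (\<lambda>n. u n p - f p) \<longlonglongrightarrow> 0"
      using AE_snd_nonzero
    proof eventually_elim
      case (elim p)
      have "(\<lambda>n. \<rho> n p * f p - f p) \<longlonglongrightarrow> 1 * f p - f p"
        unfolding \<rho>_def c_def by (intro tendsto_intros cutoff_tendsto_1 elim)
      then show ?case by (simp add: u_def)
    qed
  qed measurable
  \<comment> \<open>a majorant: the first component of the error is at most \<open>|h|\<close>, the second \<open>|h| + 2 |f| / |w|\<close>\<close>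
  define w where "w p = norm (h p) + norm (h p) + 2 * q p" for p
  have [measurable]: "w \<in> borel_measurable borel" unfolding w_def by measurable
  have lim_v: "(\<lambda>n. sqL2 (\<lambda>p. v n p - h p)) \<longlonglongrightarrow> 0"
  proof (rule sqL2_dominated_convergence[where w = w])
    show "norm (v n p - h p) \<le> w p" for n p
    proof -
      have 1: "norm (fst (v n p - h p)) \<le> norm (fst (h p))"
      proof -
        have "fst (v n p - h p) = (\<rho> n p - 1) * fst (h p)" by (simp add: v_def fst0 algebra_simps)
        then show ?thesis using \<rho>1(2)[of n p] by (simp add: norm_mult mult_left_le_one_le)
      qed
      have 2: "norm (snd (v n p - h p)) \<le> norm (snd (h p)) + 2 * q p"
      proof -
        have eq: "snd (v n p - h p) = (\<rho> n p - 1) * snd (h p) + f p * snd (dbar (\<rho> n) p)" by (simp add: v_def algebra_simps)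
        have a: "norm ((\<rho> n p - 1) * snd (h p)) \<le> norm (snd (h p))"
          using \<rho>1(2)[of n p] by (simp add: norm_mult mult_left_le_one_le)
        have b: "norm (f p * snd (dbar (\<rho> n) p)) \<le> 2 * q p"
        proof (cases "f p = 0")
          case False
          then have "norm (snd (dbar (\<rho> n) p)) \<le> 2 / cmod (snd p)"
            using \<rho>b[of n p] snd0[OF False] by (simp add: pos_le_divide_eq)
          from mult_left_mono[OF this norm_ge_zero[of "f p"]] show ?thesis
            by (simp add: norm_mult q_def mult.commute[of 2])
        qed (simp add: q_def)
        show ?thesis unfolding eq by (rule order.trans[OF norm_triangle_ineq add_mono[OF a b]])
      qed
      have "norm (v n p - h p) \<le> norm (fst (v n p - h p)) + norm (snd (v n p - h p))"
        using norm_Pair_le[of "fst (v n p - h p)" "snd (v n p - h p)"] unfolding prod.collapse .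
      moreover have "norm (fst (h p)) \<le> norm (h p)" "norm (snd (h p)) \<le> norm (h p)"
        by (cases "h p"; simp add: norm_fst_le norm_snd_le)+
      ultimately show ?thesis using 1 2 unfolding w_def by linarith
    qed
    have "sqL2 (\<lambda>p. norm (h p) + norm (h p)) \<le> 2 * sqL2 (\<lambda>p. norm (h p)) + 2 * sqL2 (\<lambda>p. norm (h p))"
      by (rule sqL2_add) measurable
    also have "\<dots> < \<infinity>" using fin(2) by (simp add: sqL2_def ennreal_mult_less_top)
    finally have a: "sqL2 (\<lambda>p. norm (h p) + norm (h p)) < \<infinity>" .
    have "sqL2 (\<lambda>p. q p + q p) \<le> 2 * sqL2 q + 2 * sqL2 q" by (rule sqL2_add) measurable
    also have "\<dots> < \<infinity>" using n2q by (simp add: ennreal_mult_less_top)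
    finally have "sqL2 (\<lambda>p. q p + q p) < \<infinity>" .
    moreover have "(\<lambda>p. q p + q p) = (\<lambda>p. 2 * q p)" by auto
    ultimately have b: "sqL2 (\<lambda>p. 2 * q p) < \<infinity>" by (simp only:)
    have "sqL2 w \<le> 2 * sqL2 (\<lambda>p. norm (h p) + norm (h p)) + 2 * sqL2 (\<lambda>p. 2 * q p)"
      unfolding w_def by (rule sqL2_add) measurable
    also have "\<dots> < \<infinity>" using a b by (simp add: ennreal_mult_less_top)
    finally show "sqL2 w < \<infinity>" .
    show "AE p in lborel. (\<lambda>n. v n p - h p) \<longlonglongrightarrow> 0"
      using AE_snd_nonzero
    proof eventually_elim
      case (elim p)
      have "(\<lambda>n. v n p - h p) \<longlonglongrightarrow> (1 * fst (h p) + f p * 0, 1 * snd (h p) + f p * 0) - h p"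
        unfolding v_def fst0 unfolding \<rho>_def c_def
        by (intro tendsto_intros cutoff_tendsto_1 dbar_cutoff_tendsto_0 elim)
      then show ?case by simp
    qed
  qed measurable
  show ?thesis by (rule approximable_limit[OF f h um vm ap lim_u lim_v])
qed

section \<open>Equality of the two closures\<close>

lemma norm_pairing_sq_le:
  fixes v \<psi> :: "'a::euclidean_space \<Rightarrow> complex"
  assumes [measurable]: "v \<in> borel_measurable borel" "\<psi> \<in> borel_measurable borel"
  shows "ennreal ((norm (LBINT x. v x * \<psi> x))\<^sup>2) \<le> sqL2 v * sqL2 \<psi>"
proof -
  have "ennreal (norm (LBINT x. v x * \<psi> x)) \<le> (\<integral>\<^sup>+ x. ennreal (norm (v x)) * ennreal (norm (\<psi> x)) \<partial>lborel)"
  proof (cases "integrable lborel (\<lambda>x. v x * \<psi> x)")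
    case True
    from integral_norm_bound_ennreal[OF this] show ?thesis
      by (simp add: norm_mult ennreal_mult)
  qed (simp add: not_integrable_integral_eq)
  then have "(ennreal (norm (LBINT x. v x * \<psi> x)))\<^sup>2 \<le> (\<integral>\<^sup>+ x. ennreal (norm (v x)) * ennreal (norm (\<psi> x)) \<partial>lborel)\<^sup>2"
    by (intro power_mono) auto
  also have "\<dots> \<le> (\<integral>\<^sup>+ x. (ennreal (norm (v x)))\<^sup>2 \<partial>lborel) * (\<integral>\<^sup>+ x. (ennreal (norm (\<psi> x)))\<^sup>2 \<partial>lborel)"
    by (rule Cauchy_Schwarz_nn_integral) measurable
  finally show ?thesis by (simp add: ennreal_power sqL2_def)
qed

lemma pairing_tendsto:
  fixes f \<psi> :: "'a::euclidean_space \<Rightarrow> complex"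
  assumes [measurable]: "f \<in> borel_measurable borel" "\<psi> \<in> borel_measurable borel" "\<And>n. u n \<in> borel_measurable borel"
    and fin: "sqL2 f < \<infinity>" "sqL2 \<psi> < \<infinity>" "\<And>n. sqL2 (u n) < \<infinity>"
    and lim: "(\<lambda>n. sqL2 (\<lambda>x. u n x - f x)) \<longlonglongrightarrow> 0"
  shows "(\<lambda>n. \<integral>x. u n x * \<psi> x \<partial>lborel) \<longlonglongrightarrow> (LBINT x. f x * \<psi> x)"
proof -
  have eq: "(LBINT x. (u n x - f x) * \<psi> x) = (LBINT x. u n x * \<psi> x) - (LBINT x. f x * \<psi> x)" for n
    unfolding left_diff_distrib
    by (intro Bochner_Integration.integral_diff L2_mult_integrable fin) measurable
  have "(\<lambda>n. sqL2 \<psi> * sqL2 (\<lambda>x. u n x - f x)) \<longlonglongrightarrow> sqL2 \<psi> * 0"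
    by (rule ennreal_tendsto_cmult[OF _ lim]) (use fin in simp)
  then have lim0: "(\<lambda>n. sqL2 \<psi> * sqL2 (\<lambda>x. u n x - f x)) \<longlonglongrightarrow> 0" by simp
  have le: "ennreal ((norm (LBINT x. (u n x - f x) * \<psi> x))\<^sup>2) \<le> sqL2 \<psi> * sqL2 (\<lambda>x. u n x - f x)" for n
    unfolding mult.commute[of "sqL2 \<psi>"] by (rule norm_pairing_sq_le) measurable
  have "(\<lambda>n. ennreal ((norm (LBINT x. (u n x - f x) * \<psi> x))\<^sup>2)) \<longlonglongrightarrow> 0"
    by (rule tendsto_sandwich[OF _ _ tendsto_const lim0]) (intro always_eventually allI le zero_le)+
  then have "(\<lambda>n. (norm (LBINT x. (u n x - f x) * \<psi> x))\<^sup>2) \<longlonglongrightarrow> 0"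
    by (subst (asm) ennreal_tendsto_0_iff) auto
  then have "(\<lambda>n. (LBINT x. u n x * \<psi> x) - (LBINT x. f x * \<psi> x)) \<longlonglongrightarrow> 0"
    unfolding eq by (simp add: power_tendsto_0_iff tendsto_norm_zero_iff)
  then show ?thesis by (simp add: LIM_zero_iff)
qed

lemma C1c_weak_dbar:
  assumes F: "C1c F"
  shows "weak_dbar F (dbar F)"
  unfolding weak_dbar_def
proof
  fix \<phi> :: "C2 \<Rightarrow> complex" assume \<phi>: "\<phi> \<in> test_functions UNIV"
  have C: "C1c \<phi>" "Ck (Suc 0) \<phi>" using test_functionsD(1,2)[OF \<phi>] by blast+
  have parts: "(LBINT p. F p * ((fd \<phi> p v + \<i> * fd \<phi> p v') / 2)) = - (LBINT p. (fd F p v + \<i> * fd F p v') / 2 * \<phi> p)" for v v'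
  proof -
    have i: "integrable lborel (\<lambda>p. F p * fd \<phi> p v)" for v
      using C1c_integrable_fd_mult[OF C(1) C1c_continuous[OF F], of v] by (simp add: mult.commute)
    have j: "integrable lborel (\<lambda>p. fd F p v * \<phi> p)" for v
      using C1c_integrable_fd_mult[OF F C1c_continuous[OF C(1)], of v] .
    have "(LBINT p. F p * ((fd \<phi> p v + \<i> * fd \<phi> p v') / 2))
      = (LBINT p. (1 / 2) * (F p * fd \<phi> p v) + (\<i> / 2) * (F p * fd \<phi> p v'))"
      by (simp add: field_simps)
    also have "\<dots> = (1 / 2) * (LBINT p. F p * fd \<phi> p v) + (\<i> / 2) * (LBINT p. F p * fd \<phi> p v')"
      by (subst Bochner_Integration.integral_add) (simp_all only: integral_mult_right_zero integrable_mult_right i)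
    also have "\<dots> = - ((1 / 2) * (LBINT p. fd F p v * \<phi> p) + (\<i> / 2) * (LBINT p. fd F p v' * \<phi> p))"
      unfolding integral_by_parts_C1c[OF F C(2)] by simp
    also have "(1 / 2) * (LBINT p. fd F p v * \<phi> p) + (\<i> / 2) * (LBINT p. fd F p v' * \<phi> p)
      = (LBINT p. (1 / 2) * (fd F p v * \<phi> p) + (\<i> / 2) * (fd F p v' * \<phi> p))"
      by (subst Bochner_Integration.integral_add) (simp_all only: integral_mult_right_zero integrable_mult_right j)
    also have "\<dots> = (LBINT p. (fd F p v + \<i> * fd F p v') / 2 * \<phi> p)"
      by (simp add: field_simps)
    finally show ?thesis .
  qed
  show "(LBINT p. F p * fst (dbar \<phi> p)) = - (LBINT p. fst (dbar F p) * \<phi> p) \<and>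
     (LBINT p. F p * snd (dbar \<phi> p)) = - (LBINT p. snd (dbar F p) * \<phi> p)"
    unfolding dbar_def fst_conv snd_conv by (intro conjI parts)
qed

lemma C1c_finite_sqL2:
  assumes F: "C1c F"
  shows "sqL2 F < \<infinity>" "sqL2 (dbar F) < \<infinity>"
proof -
  obtain R where R: "R > 0" "\<And>x. R < norm x \<Longrightarrow> F x = 0" "\<And>x v. R < norm x \<Longrightarrow> fd F x v = 0"
    using C1cE[OF F] by blast
  have dR: "dbar F p = 0" if "R < norm p" for p using R(3)[OF that] by (simp add: dbar_def prod_eq_iff)
  have c: "continuous_on UNIV F" "continuous_on UNIV (dbar F)"
    using C1c_continuous[OF F] continuous_dbar F by (auto simp: C1c_def simp del: Ck.simps)
  obtain B where "\<And>x. norm (F x) \<le> B" using bounded_bounded_support[OF c(1) R(2)] by metis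
  then show "sqL2 F < \<infinity>" by (rule sqL2_bounded_support_finite[OF _ R(2)])
  obtain B' where "\<And>x. norm (dbar F x) \<le> B'" using bounded_bounded_support[OF c(2) dR] by metis
  then show "sqL2 (dbar F) < \<infinity>" by (rule sqL2_bounded_support_finite[OF _ dR])
qed

lemma weak_dbar_limit:
  assumes f[measurable]: "f \<in> borel_measurable borel" and h[measurable]: "h \<in> borel_measurable borel"
    and fin: "sqL2 f < \<infinity>" "sqL2 h < \<infinity>" and F: "\<And>n. C1c (F n)"
    and lim: "(\<lambda>n. sqL2 (\<lambda>x. F n x - f x)) \<longlonglongrightarrow> 0" "(\<lambda>n. sqL2 (\<lambda>x. dbar (F n) x - h x)) \<longlonglongrightarrow> 0"
  shows "weak_dbar f h"
  unfolding weak_dbar_def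
proof
  fix \<phi> :: "C2 \<Rightarrow> complex" assume \<phi>: "\<phi> \<in> test_functions UNIV"
  have C: "C1c \<phi>" using test_functionsD(2)[OF \<phi>] .
  have m: "G \<in> borel_measurable borel" "dbar G \<in> borel_measurable borel" if "C1c G" for G
  proof -
    have "Ck (Suc 0) G" using that by (simp add: C1c_def del: Ck.simps)
    then show "G \<in> borel_measurable borel" "dbar G \<in> borel_measurable borel"
      by (intro borel_measurable_continuous C1c_continuous continuous_dbar that; assumption)+
  qed
  note [measurable] = m[OF C] m[OF F]
  have le: "sqL2 (\<lambda>x. fst (u x)) \<le> sqL2 u" "sqL2 (\<lambda>x. snd (u x)) \<le> sqL2 u"
    if "u \<in> borel_measurable borel" for u :: "C2 \<Rightarrow> C2"
    unfolding sqL2_prod[OF that] by auto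
  note fin\<phi> = C1c_finite_sqL2[OF C] and finF = C1c_finite_sqL2[OF F]
  have lim1: "(\<lambda>n. sqL2 (\<lambda>x. fst (dbar (F n) x) - fst (h x))) \<longlonglongrightarrow> 0"
  proof (rule tendsto_sandwich[OF _ _ tendsto_const lim(2)])
    have "sqL2 (\<lambda>x. fst (dbar (F n) x - h x)) \<le> sqL2 (\<lambda>x. dbar (F n) x - h x)" for n
      by (rule le(1)) measurable
    then show "eventually (\<lambda>n. sqL2 (\<lambda>x. fst (dbar (F n) x) - fst (h x)) \<le> sqL2 (\<lambda>x. dbar (F n) x - h x)) sequentially"
      by simp
  qed simp
  have lim2: "(\<lambda>n. sqL2 (\<lambda>x. snd (dbar (F n) x) - snd (h x))) \<longlonglongrightarrow> 0"
  proof (rule tendsto_sandwich[OF _ _ tendsto_const lim(2)])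
    have "sqL2 (\<lambda>x. snd (dbar (F n) x - h x)) \<le> sqL2 (\<lambda>x. dbar (F n) x - h x)" for n
      by (rule le(2)) measurable
    then show "eventually (\<lambda>n. sqL2 (\<lambda>x. snd (dbar (F n) x) - snd (h x)) \<le> sqL2 (\<lambda>x. dbar (F n) x - h x)) sequentially"
      by simp
  qed simp
  have eq: "(LBINT p. f p * A p) = - (LBINT p. H p * \<phi> p)"
    if w: "\<And>n. (LBINT p. F n p * A p) = - (LBINT p. U n p * \<phi> p)"
      and [measurable]: "A \<in> borel_measurable borel" "H \<in> borel_measurable borel" "\<And>n. U n \<in> borel_measurable borel"
      and finA: "sqL2 A < \<infinity>" "sqL2 H < \<infinity>" "\<And>n. sqL2 (U n) < \<infinity>" and limU: "(\<lambda>n. sqL2 (\<lambda>x. U n x - H x)) \<longlonglongrightarrow> 0"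
    for A H U
  proof -
    have 1: "(\<lambda>n. \<integral>p. F n p * A p \<partial>lborel) \<longlonglongrightarrow> (LBINT p. f p * A p)"
      by (rule pairing_tendsto[OF _ _ _ fin(1) finA(1) finF(1) lim(1)]) measurable
    have "(\<lambda>n. \<integral>p. U n p * \<phi> p \<partial>lborel) \<longlonglongrightarrow> (LBINT p. H p * \<phi> p)"
      by (rule pairing_tendsto[OF _ _ _ finA(2) fin\<phi>(1) finA(3) limU]) measurable
    from LIMSEQ_unique[OF 1[unfolded w] tendsto_minus[OF this]] show ?thesis .
  qed
  have w: "(LBINT p. F n p * fst (dbar \<phi> p)) = - (LBINT p. fst (dbar (F n) p) * \<phi> p)"
     "(LBINT p. F n p * snd (dbar \<phi> p)) = - (LBINT p. snd (dbar (F n) p) * \<phi> p)" for n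
    using C1c_weak_dbar[OF F[of n]] \<phi> unfolding weak_dbar_def by blast+
  have fin': "sqL2 (\<lambda>x. fst (u x)) < \<infinity>" "sqL2 (\<lambda>x. snd (u x)) < \<infinity>"
    if "u \<in> borel_measurable borel" "sqL2 u < \<infinity>" for u :: "C2 \<Rightarrow> C2"
    using order.strict_trans1[OF le(1)[OF that(1)] that(2)] order.strict_trans1[OF le(2)[OF that(1)] that(2)] by auto
  have "(LBINT p. f p * fst (dbar \<phi> p)) = - (LBINT p. fst (h p) * \<phi> p)"
    by (rule eq[OF w(1) _ _ _ _ _ _ lim1]) (measurable, intro fin' fin fin\<phi> finF m C F h)+
  moreover have "(LBINT p. f p * snd (dbar \<phi> p)) = - (LBINT p. snd (h p) * \<phi> p)"
    by (rule eq[OF w(2) _ _ _ _ _ _ lim2]) (measurable, intro fin' fin fin\<phi> finF m C F h)+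
  ultimately show "(LBINT p. f p * fst (dbar \<phi> p)) = - (LBINT p. fst (h p) * \<phi> p) \<and>
     (LBINT p. f p * snd (dbar \<phi> p)) = - (LBINT p. snd (h p) * \<phi> p)" ..
qed

lemma open_hartogs_triangle: "open hartogs_triangle"
proof -
  have "open ({p :: C2. cmod (fst p) < cmod (snd p)} \<inter> {p. cmod (snd p) < 1})"
    by (intro open_Int open_Collect_less continuous_intros)
  also have "{p :: C2. cmod (fst p) < cmod (snd p)} \<inter> {p. cmod (snd p) < 1} = hartogs_triangle"
    by (auto simp: hartogs_triangle_def)
  finally show ?thesis .
qed

lemma nn_integral_lebesgue_on:
  assumes "S \<in> sets lebesgue"
  shows "(\<integral>\<^sup>+ x. u x \<partial>lebesgue_on S) = (\<integral>\<^sup>+ x. (if x \<in> S then u x else 0) \<partial>lborel)"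
proof -
  have "(\<integral>\<^sup>+ x. u x \<partial>lebesgue_on S) = (\<integral>\<^sup>+ x. u x * indicator S x \<partial>lebesgue)"
    by (rule nn_integral_restrict_space) (use assms in simp)
  also have "\<dots> = (\<integral>\<^sup>+ x. u x * indicator S x \<partial>lborel)" by (rule nn_integral_completion)
  also have "(\<lambda>x. u x * indicator S x) = (\<lambda>x. if x \<in> S then u x else 0)" by (auto simp: indicator_def)
  finally show ?thesis .
qed

lemma zero_extension_L2:
  assumes "S \<in> sets lebesgue" "f \<in> L2 S"
  shows "zero_extension S f \<in> L2 UNIV"
proof -
  have "zero_extension S f \<in> borel_measurable lebesgue"
    using assms borel_measurable_if_I[of f S] by (auto simp: L2_def zero_extension_def)
  moreover have "integrable lebesgue (\<lambda>x. if x \<in> S then (norm (f x))\<^sup>2 else 0)"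
    by (rule iffD2[OF Lebesgue_Measure.integrable_restrict_UNIV[OF assms(1)]]) (use assms(2) in \<open>simp add: L2_def\<close>)
  moreover have "(\<lambda>x. if x \<in> S then (norm (f x))\<^sup>2 else 0) = (\<lambda>x. (norm (zero_extension S f x))\<^sup>2)"
    by (auto simp: zero_extension_def)
  ultimately show ?thesis by (simp add: L2_def lebesgue_on_UNIV_eq)
qed

lemma L2_representative:
  fixes f :: "'a::euclidean_space \<Rightarrow> 'b::euclidean_space"
  assumes "f \<in> L2 UNIV"
  obtains f' where "f' \<in> borel_measurable borel" "AE x in lborel. f x = f' x" "sqL2 f' < \<infinity>"
proof -
  have m: "f \<in> borel_measurable lebesgue" and i: "integrable lebesgue (\<lambda>x. (norm (f x))\<^sup>2)"
    using assms by (auto simp: L2_def lebesgue_on_UNIV_eq)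
  obtain f' where f': "f' \<in> borel_measurable borel" "AE x in lebesgue. f x = f' x"
    using lebesgue_borel_representative[OF m] by blast
  then have ae: "AE x in lborel. f x = f' x" by (simp add: AE_completion_iff)
  have "sqL2 f' = sqL2 f"
    unfolding sqL2_def using ae by (intro nn_integral_cong_AE) (auto elim: eventually_mono)
  also have "\<dots> = (\<integral>\<^sup>+ x. ennreal ((norm (f x))\<^sup>2) \<partial>lebesgue)" by (simp add: sqL2_def nn_integral_completion)
  also have "\<dots> < \<infinity>" using i by (simp add: integrable_iff_bounded)
  finally show ?thesis using that f'(1) ae by blast
qed

lemma lebesgue_integral_representative:
  fixes f \<psi> :: "'a::euclidean_space \<Rightarrow> complex"
  assumes f: "f \<in> borel_measurable lebesgue" and f': "f' \<in> borel_measurable borel" "AE x in lborel. f x = f' x"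
    and \<psi>: "\<psi> \<in> borel_measurable borel"
  shows "(\<integral>x. f x * \<psi> x \<partial>lebesgue) = (LBINT x. f' x * \<psi> x)"
proof -
  have \<psi>l: "\<psi> \<in> borel_measurable lebesgue" and f'l: "f' \<in> borel_measurable lebesgue"
    using \<psi> f'(1) by (auto intro: measurable_completion)
  have "(\<integral>x. f x * \<psi> x \<partial>lebesgue) = (\<integral>x. f' x * \<psi> x \<partial>lebesgue)"
  proof (rule integral_cong_AE)
    show "AE x in lebesgue. f x * \<psi> x = f' x * \<psi> x"
      using AE_completion[OF f'(2)] by eventually_elim simp
  qed (use f f'l \<psi>l in measurable)
  also have "\<dots> = (LBINT x. f' x * \<psi> x)"
    by (rule integral_completion) (use f' \<psi> in measurable)
  finally show ?thesis .
qed

lemma has_distr_dbar_UNIV_iff_weak_dbar: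
  assumes f: "f \<in> borel_measurable lebesgue" and h: "h \<in> borel_measurable lebesgue"
    and f': "f' \<in> borel_measurable borel" "AE x in lborel. f x = f' x"
    and h': "h' \<in> borel_measurable borel" "AE x in lborel. h x = h' x"
  shows "has_distr_dbar UNIV f h \<longleftrightarrow> weak_dbar f' h'"
proof -
  have hs: "(\<lambda>x. fst (h x)) \<in> borel_measurable lebesgue" "(\<lambda>x. snd (h x)) \<in> borel_measurable lebesgue"
    "(\<lambda>x. fst (h' x)) \<in> borel_measurable borel" "(\<lambda>x. snd (h' x)) \<in> borel_measurable borel"
    using h h'(1) by measurable
  have ae: "AE x in lborel. fst (h x) = fst (h' x)" "AE x in lborel. snd (h x) = snd (h' x)"
    using h'(2) by (auto elim: eventually_mono)
  have *: "(LINT p|lebesgue_on UNIV. f p * fst (dbar \<phi> p)) = (LBINT p. f' p * fst (dbar \<phi> p))"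
    "(LINT p|lebesgue_on UNIV. f p * snd (dbar \<phi> p)) = (LBINT p. f' p * snd (dbar \<phi> p))"
    "(LINT p|lebesgue_on UNIV. fst (h p) * \<phi> p) = (LBINT p. fst (h' p) * \<phi> p)"
    "(LINT p|lebesgue_on UNIV. snd (h p) * \<phi> p) = (LBINT p. snd (h' p) * \<phi> p)"
    if "\<phi> \<in> test_functions UNIV" for \<phi>
  proof -
    have C: "C1c \<phi>" "Ck (Suc 0) \<phi>" using test_functionsD(1,2)[OF that] by blast+
    have m: "\<phi> \<in> borel_measurable borel" "dbar \<phi> \<in> borel_measurable borel"
      by (intro borel_measurable_continuous C1c_continuous continuous_dbar C)+
    have d: "(\<lambda>p. fst (dbar \<phi> p)) \<in> borel_measurable borel" "(\<lambda>p. snd (dbar \<phi> p)) \<in> borel_measurable borel"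
      using m(2) by measurable
    show "(LINT p|lebesgue_on UNIV. f p * fst (dbar \<phi> p)) = (LBINT p. f' p * fst (dbar \<phi> p))"
      "(LINT p|lebesgue_on UNIV. f p * snd (dbar \<phi> p)) = (LBINT p. f' p * snd (dbar \<phi> p))"
      "(LINT p|lebesgue_on UNIV. fst (h p) * \<phi> p) = (LBINT p. fst (h' p) * \<phi> p)"
      "(LINT p|lebesgue_on UNIV. snd (h p) * \<phi> p) = (LBINT p. snd (h' p) * \<phi> p)"
      unfolding lebesgue_on_UNIV_eq
      by (rule lebesgue_integral_representative[OF f f' d(1)] lebesgue_integral_representative[OF f f' d(2)]
          lebesgue_integral_representative[OF hs(1,3) ae(1) m(1)] lebesgue_integral_representative[OF hs(2,4) ae(2) m(1)])+
  qed
  show ?thesis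
    unfolding has_distr_dbar_def weak_dbar_def by (simp add: * cong: ball_cong)
qed

text \<open>Outside \<open>S\<close> the functions \<open>F n\<close> and the extension of \<open>f\<close> by zero agree, so that convergence on \<open>S\<close> is
  convergence on the whole space.\<close>

lemma L2_tendsto_iff_sqL2:
  fixes f :: "'a::euclidean_space \<Rightarrow> 'b::euclidean_space"
  assumes S: "S \<in> sets lebesgue" and F: "\<And>n x. x \<notin> S \<Longrightarrow> F n x = 0"
    and f': "AE x in lborel. zero_extension S f x = f' x"
  shows "L2_tendsto S F f \<longleftrightarrow> (\<lambda>n. sqL2 (\<lambda>x. F n x - f' x)) \<longlonglongrightarrow> 0"
proof -
  have "(\<integral>\<^sup>+ x. ennreal ((norm (F n x - f x))\<^sup>2) \<partial>lebesgue_on S) = sqL2 (\<lambda>x. F n x - f' x)" for n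
    unfolding nn_integral_lebesgue_on[OF S] sqL2_def
  proof (rule nn_integral_cong_AE)
    show "AE x in lborel. (if x \<in> S then ennreal ((norm (F n x - f x))\<^sup>2) else 0) = ennreal ((norm (F n x - f' x))\<^sup>2)"
      using f'
    proof eventually_elim
      case (elim x)
      show ?case
      proof (cases "x \<in> S")
        case True
        then have "f' x = f x" using elim by (simp add: zero_extension_def)
        with True show ?thesis by (simp only: if_True)
      next
        case False
        then have "f' x = 0" using elim by (simp add: zero_extension_def)
        with False show ?thesis using F[OF False] by simp
      qed
    qed
  qed
  then show ?thesis by (simp add: L2_tendsto_def)
qed

lemma dbar_outside_support:
  assumes "F \<in> test_functions \<Omega>" "p \<notin> \<Omega>"
  shows "dbar F p = 0"
proof -
  have S: "open (- closure {x. F x \<noteq> 0})" "p \<in> - closure {x. F x \<noteq> 0}"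
    using assms by (auto simp: test_functions_def)
  have "F y = 0" if "y \<in> - closure {x. F x \<noteq> 0}" for y
    using that closure_subset[of "{x. F x \<noteq> 0}"] by blast
  then have "fd F p v = 0" for v by (rule frechet_derivative_zero_open[OF S])
  then show ?thesis by (simp add: dbar_def prod_eq_iff)
qed

theorem proposition3p7:
  shows "dbar_weak_minimal hartogs_triangle = dbar_strong_minimal hartogs_triangle"
proof (intro equalityI subrelI)
  let ?T = hartogs_triangle
  have T: "?T \<in> sets lebesgue" using borel_open[OF open_hartogs_triangle] by (simp add: sets_completionI_sets)
  fix f :: "C2 \<Rightarrow> complex" and g :: "C2 \<Rightarrow> C2"
  {
    assume "(f, g) \<in> dbar_strong_minimal ?T"
    then obtain F where fg: "f \<in> L2 ?T" "g \<in> L2 ?T" and F: "\<And>n. F n \<in> test_functions ?T"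
      and lim: "L2_tendsto ?T F f" "L2_tendsto ?T (\<lambda>n. dbar (F n)) g"
      unfolding dbar_strong_minimal_def by blast
    let ?f0 = "zero_extension ?T f" and ?g0 = "zero_extension ?T g"
    have L: "?f0 \<in> L2 UNIV" "?g0 \<in> L2 UNIV" using zero_extension_L2[OF T] fg by auto
    obtain f' where f': "f' \<in> borel_measurable borel" "AE x in lborel. ?f0 x = f' x" "sqL2 f' < \<infinity>"
      using L2_representative[OF L(1)] by blast
    obtain g' where g': "g' \<in> borel_measurable borel" "AE x in lborel. ?g0 x = g' x" "sqL2 g' < \<infinity>"
      using L2_representative[OF L(2)] by blast
    have "(\<lambda>n. sqL2 (\<lambda>x. F n x - f' x)) \<longlonglongrightarrow> 0"
      using lim(1) by (subst (asm) L2_tendsto_iff_sqL2[OF T _ f'(2)]) (use test_functionsD(3)[OF F] in blast)+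
    moreover have "(\<lambda>n. sqL2 (\<lambda>x. dbar (F n) x - g' x)) \<longlonglongrightarrow> 0"
      using lim(2) by (subst (asm) L2_tendsto_iff_sqL2[OF T _ g'(2)]) (use dbar_outside_support[OF F] in blast)+
    ultimately have "weak_dbar f' g'"
      by (intro weak_dbar_limit[OF f'(1) g'(1) f'(3) g'(3), of F] test_functionsD(2)[OF F])
    moreover have "?f0 \<in> borel_measurable lebesgue" "?g0 \<in> borel_measurable lebesgue"
      using L by (auto simp: L2_def lebesgue_on_UNIV_eq)
    ultimately have "has_distr_dbar UNIV ?f0 ?g0"
      using has_distr_dbar_UNIV_iff_weak_dbar f'(1,2) g'(1,2) by blast
    moreover have "AE p in lebesgue_on ?T. g p = ?g0 p"
      using T by (simp add: AE_restrict_space_iff zero_extension_def)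
    ultimately show "(f, g) \<in> dbar_weak_minimal ?T"
      unfolding dbar_weak_minimal_def using fg L(2) by blast
  next
    assume "(f, g) \<in> dbar_weak_minimal ?T"
    then obtain h where fg: "f \<in> L2 ?T" "g \<in> L2 ?T" and h: "h \<in> L2 UNIV"
      and hd: "has_distr_dbar UNIV (zero_extension ?T f) h" and gh: "AE p in lebesgue_on ?T. g p = h p"
      unfolding dbar_weak_minimal_def by blast
    let ?f0 = "zero_extension ?T f"
    have L: "?f0 \<in> L2 UNIV" using zero_extension_L2[OF T fg(1)] .
    have m: "?f0 \<in> borel_measurable lebesgue" "h \<in> borel_measurable lebesgue"
      using L h by (auto simp: L2_def lebesgue_on_UNIV_eq)
    have gh': "AE p in lborel. p \<in> ?T \<longrightarrow> g p = h p"
      using gh T by (simp add: AE_restrict_space_iff AE_completion_iff)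
    obtain f1 where f1: "f1 \<in> borel_measurable borel" "AE x in lborel. ?f0 x = f1 x" "sqL2 f1 < \<infinity>"
      using L2_representative[OF L] by blast
    define f' where "f' x = (if x \<in> ?T then f1 x else 0)" for x
    have Tb[measurable]: "?T \<in> sets borel" using open_hartogs_triangle by simp
    have f': "f' \<in> borel_measurable borel" "AE x in lborel. ?f0 x = f' x" "sqL2 f' < \<infinity>"
    proof -
      show "f' \<in> borel_measurable borel" unfolding f'_def using f1(1) by measurable
      show "AE x in lborel. ?f0 x = f' x"
        using f1(2) by eventually_elim (auto simp: f'_def zero_extension_def)
      have "sqL2 f' \<le> sqL2 f1" by (rule sqL2_mono) (simp add: f'_def)
      then show "sqL2 f' < \<infinity>" using f1(3) by (rule order.strict_trans1)
    qed
    obtain h' where h': "h' \<in> borel_measurable borel" "AE x in lborel. h x = h' x" "sqL2 h' < \<infinity>"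
      using L2_representative[OF h] by blast
    have "weak_dbar f' h'"
      using hd has_distr_dbar_UNIV_iff_weak_dbar[OF m f'(1,2) h'(1,2)] by blast
    then have ap: "approximable f' h'"
      by (rule weak_dbar_imp_approximable[OF f'(1) h'(1) f'(3) h'(3)]) (simp add: f'_def split: if_splits)
    have "\<forall>n. \<exists>F\<in>test_functions ?T. sqL2 (\<lambda>x. F x - f' x) < ennreal (1 / real (Suc n)) \<and> sqL2 (\<lambda>x. dbar F x - h' x) < ennreal (1 / real (Suc n))"
      using ap unfolding approximable_def by (simp del: of_nat_Suc)
    then obtain F where F: "\<And>n. F n \<in> test_functions ?T"
      and Fe: "\<And>n. sqL2 (\<lambda>x. F n x - f' x) < ennreal (1 / real (Suc n))" "\<And>n. sqL2 (\<lambda>x. dbar (F n) x - h' x) < ennreal (1 / real (Suc n))"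
      by metis
    have e0: "(\<lambda>n. ennreal (1 / real (Suc n))) \<longlonglongrightarrow> 0"
      using tendsto_ennrealI[OF LIMSEQ_Suc[OF lim_1_over_n]] by simp
    have l1: "(\<lambda>n. sqL2 (\<lambda>x. F n x - f' x)) \<longlonglongrightarrow> 0"
      by (rule tendsto_sandwich[OF _ _ tendsto_const e0]) (use Fe(1) in \<open>auto intro!: always_eventually less_imp_le\<close>)
    have l2: "(\<lambda>n. sqL2 (\<lambda>x. dbar (F n) x - h' x)) \<longlonglongrightarrow> 0"
      by (rule tendsto_sandwich[OF _ _ tendsto_const e0]) (use Fe(2) in \<open>auto intro!: always_eventually less_imp_le\<close>)
    have lim1: "L2_tendsto ?T F f"
      by (subst L2_tendsto_iff_sqL2[OF T _ f'(2)]) (use test_functionsD(3)[OF F] l1 in blast)+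
    \<comment> \<open>a priori \<open>h'\<close> may be nonzero outside the triangle, so the two integrals need not agree; an inequality suffices\<close>
    have lim2: "L2_tendsto ?T (\<lambda>n. dbar (F n)) g"
      unfolding L2_tendsto_def
    proof (rule tendsto_sandwich[OF _ _ tendsto_const l2])
      show "eventually (\<lambda>n. (\<integral>\<^sup>+ x. ennreal ((norm (dbar (F n) x - g x))\<^sup>2) \<partial>lebesgue_on ?T) \<le> sqL2 (\<lambda>x. dbar (F n) x - h' x)) sequentially"
      proof (intro always_eventually allI)
        fix n
        show "(\<integral>\<^sup>+ x. ennreal ((norm (dbar (F n) x - g x))\<^sup>2) \<partial>lebesgue_on ?T) \<le> sqL2 (\<lambda>x. dbar (F n) x - h' x)"
          unfolding nn_integral_lebesgue_on[OF T] sqL2_def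
        proof (rule nn_integral_mono_AE)
          show "AE x in lborel. (if x \<in> ?T then ennreal ((norm (dbar (F n) x - g x))\<^sup>2) else 0) \<le> ennreal ((norm (dbar (F n) x - h' x))\<^sup>2)"
            using gh' h'(2) by eventually_elim auto
        qed
      qed
    qed auto
    have "has_distr_dbar ?T f g"
      unfolding has_distr_dbar_def
    proof
      fix \<phi> assume \<phi>: "\<phi> \<in> test_functions ?T"
      then have \<phi>U: "\<phi> \<in> test_functions UNIV" using test_functions_mono[of ?T UNIV] by blast
      have A: "(LINT p|lebesgue_on ?T. f p * \<psi> p) = (LINT p|lebesgue_on UNIV. ?f0 p * \<psi> p)" for \<psi> :: "C2 \<Rightarrow> complex"
        unfolding lebesgue_on_UNIV_eq Lebesgue_Measure.integral_restrict_UNIV[OF T, symmetric]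
        by (rule Bochner_Integration.integral_cong) (auto simp: zero_extension_def)
      have B: "(LINT p|lebesgue_on ?T. P (g p) * \<phi> p) = (LINT p|lebesgue_on UNIV. P (h p) * \<phi> p)"
        if P: "continuous_on UNIV P" for P :: "C2 \<Rightarrow> complex"
      proof -
        have "\<phi> \<in> borel_measurable borel"
          by (intro borel_measurable_continuous C1c_continuous test_functionsD(2)[OF \<phi>])
        then have \<phi>m: "\<phi> \<in> borel_measurable lebesgue" by (auto intro: measurable_completion)
        have "(LINT p|lebesgue_on ?T. P (g p) * \<phi> p) = (LINT p|lebesgue_on ?T. P (h p) * \<phi> p)"
        proof (rule integral_cong_AE)
          show "(\<lambda>p. P (g p) * \<phi> p) \<in> borel_measurable (lebesgue_on ?T)"
            using fg(2) borel_measurable_continuous_on[OF P] measurable_restrict_space1[OF \<phi>m]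
            by (intro borel_measurable_times) (auto simp: L2_def)
          show "(\<lambda>p. P (h p) * \<phi> p) \<in> borel_measurable (lebesgue_on ?T)"
            using measurable_restrict_space1[OF m(2)] borel_measurable_continuous_on[OF P] measurable_restrict_space1[OF \<phi>m]
            by (intro borel_measurable_times) auto
          show "AE p in lebesgue_on ?T. P (g p) * \<phi> p = P (h p) * \<phi> p"
            using gh by eventually_elim simp
        qed
        also have "\<dots> = (LINT p|lebesgue_on UNIV. P (h p) * \<phi> p)"
          unfolding lebesgue_on_UNIV_eq Lebesgue_Measure.integral_restrict_UNIV[OF T, symmetric]
          by (rule Bochner_Integration.integral_cong) (use test_functionsD(3)[OF \<phi>] in auto)
        finally show ?thesis .
      qed
      have "continuous_on UNIV (fst :: C2 \<Rightarrow> complex)" "continuous_on UNIV (snd :: C2 \<Rightarrow> complex)"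
        by (intro continuous_intros)+
      note B' = B[OF this(1)] B[OF this(2)]
      show "(LINT p|lebesgue_on ?T. f p * fst (dbar \<phi> p)) = - (LINT p|lebesgue_on ?T. fst (g p) * \<phi> p) \<and>
        (LINT p|lebesgue_on ?T. f p * snd (dbar \<phi> p)) = - (LINT p|lebesgue_on ?T. snd (g p) * \<phi> p)"
        unfolding A B' using hd \<phi>U unfolding has_distr_dbar_def by blast
    qed
    with fg F lim1 lim2 show "(f, g) \<in> dbar_strong_minimal ?T"
      unfolding dbar_strong_minimal_def by blast
  }
qed

end
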